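(* Let $\mathcal A$ and $\mathcal B$ be nonequivalent Kronecker pairs. Then $\langle\mathcal A\rangle<\langle\mathcal B\rangle$ if and only if $\mathcal B$ can be obtained from $\mathcal A$ by permutations of direct summands and replacements of direct summands of the types (i)--(vi) listed below, in which $m,n\in\{1,2,\dots\}$ and $\lambda\in\mathbb C\cup\{\infty\}$. (The notation $\mathcal P\rightsquigarrow\mathcal Q$ means that the direct summand $\mathcal P$ is replaced by $\mathcal Q$; summands $\mathcal D_0(\lambda)$ are omitted.) Moreover, for each replacement $\mathcal P\rightsquigarrow\mathcal Q$ and every nonzero $\varepsilon\in\mathbb C$, the pair written after "via" (which is a perturbation of $\mathcal P$ that is arbitrarily small when $\varepsilon$ is) has Kronecker canonical form $\mathcal Q$. (i) $\mathcal L_m^T\oplus\mathcal L_n^T\rightsquigarrow\mathcal L_{m+1}^T\oplus\mathcal L_{n-1}^T$, in which $m+2\le n$, via $$\left(\begin{bmatrix}L_m^T&0\\0&L_n^T\end{bmatrix},\begin{bmatrix}R_m^T&\varepsilon 0^{\nwarrow}\\0&R_n^T\end{bmatrix}\right).$$ (ii) $\mathcal L_m\oplus\mathcal L_n\rightsquigarrow\mathcal L_{m+1}\oplus\mathcal L_{n-1}$, in which $m+2\le n$, via $$\left(\begin{bmatrix}L_m&0\\0&L_n\end{bmatrix},\begin{bmatrix}R_m&0\\\varepsilon 0^{\nwarrow}&R_n\end{bmatrix}\right).$$ (iii) $\mathcal L_m^T\oplus\mathcal D_n(\lambda)\rightsquigarrow\mathcal L_{m+1}^T\oplus\mathcal D_{n-1}(\lambda)$,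 via $$\left(\begin{bmatrix}L_m^T&0\\0&I_n\end{bmatrix},\begin{bmatrix}R_m^T&\varepsilon 0^{\nearrow}\\0&J_n(\lambda)\end{bmatrix}\right)\text{ if }\lambda\in\mathbb C,\qquad \left(\begin{bmatrix}L_m^T&\varepsilon 0^{\searrow}\\0&J_n(0)\end{bmatrix},\begin{bmatrix}R_m^T&0\\0&I_n\end{bmatrix}\right)\text{ if }\lambda=\infty.$$ (iv) $\mathcal L_m\oplus\mathcal D_n(\lambda)\rightsquigarrow\mathcal L_{m+1}\oplus\mathcal D_{n-1}(\lambda)$, via $$\left(\begin{bmatrix}L_m&0\\0&I_n\end{bmatrix},\begin{bmatrix}R_m&0\\\varepsilon 0^{\nwarrow}&J_n(\lambda)\end{bmatrix}\right)\text{ if }\lambda\in\mathbb C,\qquad \left(\begin{bmatrix}L_m&0\\\varepsilon 0^{\nearrow}&J_n(0)\end{bmatrix},\begin{bmatrix}R_m&0\\0&I_n\end{bmatrix}\right)\text{ if }\lambda=\infty.$$ (v) $\mathcal D_m(\lambda)\oplus\mathcal D_n(\lambda)\rightsquigarrow\mathcal D_{m-1}(\lambda)\oplus\mathcal D_{n+1}(\lambda)$, in which $m\le n$, via $$\left(I_{m+n},\begin{bmatrix}J_m(\lambda)&\varepsilon 0^{\nwarrow}\\0&J_n(\lambda)\end{bmatrix}\right)\text{ if }\lambda\in\mathbb C,\qquad \left(\begin{bmatrix}J_m(0)&\varepsilon 0^{\nwarrow}\\0&J_n(0)\end{bmatrix},I_{m+n}\right)\text{ if }\lambda=\infty.$$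 (vi) $\mathcal L_m^T\oplus\mathcal L_n\rightsquigarrow\mathcal D_{r_1}(\mu_1)\oplus\dots\oplus\mathcal D_{r_k}(\mu_k)$, in which $\mu_1,\dots,\mu_k\in\mathbb C\cup\{\infty\}$ are distinct and $r_1+\dots+r_k=m+n-1$, via $$\left(\begin{bmatrix}L_m^T&P\\0&L_n\end{bmatrix},\begin{bmatrix}R_m^T&Q\\0&R_n\end{bmatrix}\right),$$ in which $P$ is the $m\times n$ matrix whose last column is $(\alpha_1,\dots,\alpha_m)^T$ and whose other entries are zero, $Q$ is the $m\times n$ matrix whose first row is $(\beta_1,\dots,\beta_n)$ and whose other entries are zero, $$(-\beta_1,\dots,-\beta_n,\alpha_1,\dots,\alpha_m):=\varepsilon\,(c_0,\dots,c_{r-1},1,0,\dots,0),$$ and $r$ and $c_0,\dots,c_{r-1}$ are defined by $$c_0+c_1x+\dots+c_{r-1}x^{r-1}+x^r:=\prod_{\mu_i\ne\infty}(x-\mu_i)^{r_i}.$$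
   Context: All matrices are complex, and both matrices in each matrix pair have the same size; sizes with zero rows or zero columns are allowed. Two pairs $(A,B)$ and $(A',B')$ are equivalent if $(A',B')=(SAR,SBR)$ for some nonsingular $S,R$. The orbit $\langle\mathcal A\rangle$ is the set of all pairs equivalent to $\mathcal A$. One writes $\langle\mathcal A\rangle\le\langle\mathcal B\rangle$ if $\langle\mathcal A\rangle$ is contained in the closure of $\langle\mathcal B\rangle$ (equivalently, a pair equivalent to $\mathcal B$ can be obtained by an arbitrarily small perturbation of $\mathcal A$), and $\langle\mathcal A\rangle<\langle\mathcal B\rangle$ if in addition $\langle\mathcal A\rangle\neq\langle\mathcal B\rangle$. Direct sums of pairs are taken componentwise: $(A,B)\oplus(C,D)=(A\oplus C,B\oplus D)$. For $n\ge1$, $L_n$ and $R_n$ are the $(n-1)\times n$ matrices $L_n=[I_{n-1}\;0]$ and $R_n=[0\;I_{n-1}]$ (with a zero column last, respectively first); $L_1=R_1$ is the $0\times1$ matrix. $J_n(\lambda)$ is the $n\times n$ upper triangular Jordan block with $\lambda$ on the diagonal and ones on the first superdiagonal. The indecomposable Kronecker pairs are $\mathcal L_n:=(L_n,R_n)$, $\mathcal L_n^T:=(L_n^T,R_n^T)$, and $\mathcal D_n(\lambda):=(I_n,J_n(\lambda))$ for $\lambda\in\mathbb C$, $\mathcal D_n(\infty):=(J_n(0),I_n)$, where $n\ge 1$. A Kronecker pair is a direct sum of indecomposable Kronecker pairs. Every pair is equivalent to a Kronecker pair, its Kronecker canonical form, which is unique up to permutations of direct summands. $0^{\nwarrow},0^{\nearrow},0^{\swarrow},0^{\searrow}$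 denote matrices (of sizes clear from the context) all of whose entries are zero except for one entry equal to $1$, located in the top-left, top-right, bottom-left, bottom-right corner, respectively. *)

theory Defs
  imports
    "HOL-Analysis.Function_Topology"
    "HOL-Computational_Algebra.Polynomial"
    "Jordan_Normal_Form.Jordan_Normal_Form"
begin

type_synonym mat_pair = "complex mat \<times> complex mat"

definition pair_equiv :: "mat_pair \<Rightarrow> mat_pair \<Rightarrow> bool" where
  "pair_equiv P Q \<longleftrightarrow>
    (\<exists>S R. S \<in> carrier_mat (dim_row (fst P)) (dim_row (fst P)) \<and> invertible_mat S \<and>
           R \<in> carrier_mat (dim_col (fst P)) (dim_col (fst P)) \<and> invertible_mat R \<and>
           Q = (S * fst P * R, S * snd P * R))"

definition orbit :: "mat_pair \<Rightarrow> mat_pair set" where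
  "orbit P = {Q. pair_equiv P Q}"

(* The type of matrices contains all sizes, so the closure of an orbit is taken in the space of
   pairs of one fixed size.  That space carries the entrywise (Euclidean) topology: the type of
   functions nat * nat => complex has the product topology, and entries outside the matrix are
   sent to 0. *)
definition entries :: "nat \<Rightarrow> nat \<Rightarrow> complex mat \<Rightarrow> (nat \<times> nat \<Rightarrow> complex)" where
  "entries m n A = (\<lambda>(i, j). if i < m \<and> j < n then A $$ (i, j) else 0)"

definition pair_space :: "nat \<Rightarrow> nat \<Rightarrow> mat_pair topology" where
  "pair_space m n =
    pullback_topology (carrier_mat m n \<times> carrier_mat m n)
      (\<lambda>(A, B). (entries m n A, entries m n B)) euclidean"

definition orbit_le :: "mat_pair \<Rightarrow> mat_pair \<Rightarrow> bool" where
  "orbit_le P Q \<longleftrightarrow>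
    orbit P \<subseteq> pair_space (dim_row (fst Q)) (dim_col (fst Q)) closure_of orbit Q"

definition orbit_less :: "mat_pair \<Rightarrow> mat_pair \<Rightarrow> bool" where
  "orbit_less P Q \<longleftrightarrow> orbit_le P Q \<and> orbit P \<noteq> orbit Q"

datatype ext_complex = Fin complex | Infty

definition L_mat :: "nat \<Rightarrow> complex mat" where
  "L_mat n = mat (n - 1) n (\<lambda>(i, j). if j = i then 1 else 0)"

definition R_mat :: "nat \<Rightarrow> complex mat" where
  "R_mat n = mat (n - 1) n (\<lambda>(i, j). if j = i + 1 then 1 else 0)"

datatype summand = SL nat | SLT nat | SD nat ext_complex

(* The indecomposable pairs are the summands of index at least 1. *)
fun summand_index :: "summand \<Rightarrow> nat" where
  "summand_index (SL n) = n"
| "summand_index (SLT n) = n"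
| "summand_index (SD n \<mu>) = n"

definition summands :: "summand list \<Rightarrow> bool" where
  "summands ss \<longleftrightarrow> (\<forall>s \<in> set ss. 1 \<le> summand_index s)"

fun summand_pair :: "summand \<Rightarrow> mat_pair" where
  "summand_pair (SL n) = (L_mat n, R_mat n)"
| "summand_pair (SLT n) = (transpose_mat (L_mat n), transpose_mat (R_mat n))"
| "summand_pair (SD n (Fin a)) = (1\<^sub>m n, jordan_block n a)"
| "summand_pair (SD n Infty) = (jordan_block n 0, 1\<^sub>m n)"

definition kronecker_pair :: "summand list \<Rightarrow> mat_pair" where
  "kronecker_pair ss =
    (diag_block_mat (map (fst \<circ> summand_pair) ss), diag_block_mat (map (snd \<circ> summand_pair) ss))"

definition has_kcf :: "mat_pair \<Rightarrow> summand list \<Rightarrow> bool" where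
  "has_kcf P ss \<longleftrightarrow> summands ss \<and> pair_equiv P (kronecker_pair ss)"

(* The convention that D_0(mu) is omitted. *)
definition D_opt :: "nat \<Rightarrow> ext_complex \<Rightarrow> summand list" where
  "D_opt n \<mu> = (if n = 0 then [] else [SD n \<mu>])"

definition upper_block :: "complex mat \<Rightarrow> complex mat \<Rightarrow> complex mat \<Rightarrow> complex mat" where
  "upper_block A X D = four_block_mat A X (0\<^sub>m (dim_row D) (dim_col A)) D"

definition lower_block :: "complex mat \<Rightarrow> complex mat \<Rightarrow> complex mat \<Rightarrow> complex mat" where
  "lower_block A X D = four_block_mat A (0\<^sub>m (dim_row A) (dim_col D)) X D"

definition diag_block :: "complex mat \<Rightarrow> complex mat \<Rightarrow> complex mat" where
  "diag_block A D = four_block_mat A (0\<^sub>m (dim_row A) (dim_col D)) (0\<^sub>m (dim_row D) (dim_col A)) D"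

definition corner_nw :: "nat \<Rightarrow> nat \<Rightarrow> complex mat" where
  "corner_nw m n = mat m n (\<lambda>(i, j). if i = 0 \<and> j = 0 then 1 else 0)"

definition corner_ne :: "nat \<Rightarrow> nat \<Rightarrow> complex mat" where
  "corner_ne m n = mat m n (\<lambda>(i, j). if i = 0 \<and> j = n - 1 then 1 else 0)"

definition corner_se :: "nat \<Rightarrow> nat \<Rightarrow> complex mat" where
  "corner_se m n = mat m n (\<lambda>(i, j). if i = m - 1 \<and> j = n - 1 then 1 else 0)"

(* The monic polynomial with coefficients c_0, ..., c_(r-1), 1; beyond its degree r its
   coefficients are 0, which supplies the zero padding of the vector of betas and alphas. *)
definition eigen_poly :: "(nat \<times> ext_complex) list \<Rightarrow> complex poly" where
  "eigen_poly rs =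
    (\<Prod>(k, \<mu>)\<leftarrow>rs. case \<mu> of Fin a \<Rightarrow> [:- a, 1:] ^ k | Infty \<Rightarrow> 1)"

(* With p = eigen_poly rs: alpha_(i+1) = eps * coeff p (n + i), beta_(j+1) = - eps * coeff p j. *)
definition alpha_mat :: "nat \<Rightarrow> nat \<Rightarrow> (nat \<times> ext_complex) list \<Rightarrow> complex \<Rightarrow> complex mat" where
  "alpha_mat m n rs \<epsilon> =
    mat m n (\<lambda>(i, j). if j = n - 1 then \<epsilon> * coeff (eigen_poly rs) (n + i) else 0)"

definition beta_mat :: "nat \<Rightarrow> nat \<Rightarrow> (nat \<times> ext_complex) list \<Rightarrow> complex \<Rightarrow> complex mat" where
  "beta_mat m n rs \<epsilon> =
    mat m n (\<lambda>(i, j). if i = 0 then - (\<epsilon> * coeff (eigen_poly rs) j) else 0)"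

(* replacement P Q V: P may be replaced by Q, and V maps eps to the pair written after "via". *)
inductive replacement :: "summand list \<Rightarrow> summand list \<Rightarrow> (complex \<Rightarrow> mat_pair) \<Rightarrow> bool" where
  i: "1 \<le> m \<Longrightarrow> m + 2 \<le> n \<Longrightarrow>
    replacement [SLT m, SLT n] [SLT (m + 1), SLT (n - 1)]
      (\<lambda>\<epsilon>. (diag_block (transpose_mat (L_mat m)) (transpose_mat (L_mat n)),
            upper_block (transpose_mat (R_mat m)) (\<epsilon> \<cdot>\<^sub>m corner_nw m (n - 1)) (transpose_mat (R_mat n))))"
| ii: "1 \<le> m \<Longrightarrow> m + 2 \<le> n \<Longrightarrow>
    replacement [SL m, SL n] [SL (m + 1), SL (n - 1)]
      (\<lambda>\<epsilon>. (diag_block (L_mat m) (L_mat n),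
            lower_block (R_mat m) (\<epsilon> \<cdot>\<^sub>m corner_nw (n - 1) m) (R_mat n)))"
| iii_fin: "1 \<le> m \<Longrightarrow> 1 \<le> n \<Longrightarrow>
    replacement [SLT m, SD n (Fin a)] (SLT (m + 1) # D_opt (n - 1) (Fin a))
      (\<lambda>\<epsilon>. (diag_block (transpose_mat (L_mat m)) (1\<^sub>m n),
            upper_block (transpose_mat (R_mat m)) (\<epsilon> \<cdot>\<^sub>m corner_ne m n) (jordan_block n a)))"
| iii_inf: "1 \<le> m \<Longrightarrow> 1 \<le> n \<Longrightarrow>
    replacement [SLT m, SD n Infty] (SLT (m + 1) # D_opt (n - 1) Infty)
      (\<lambda>\<epsilon>. (upper_block (transpose_mat (L_mat m)) (\<epsilon> \<cdot>\<^sub>m corner_se m n) (jordan_block n 0),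
            diag_block (transpose_mat (R_mat m)) (1\<^sub>m n)))"
| iv_fin: "1 \<le> m \<Longrightarrow> 1 \<le> n \<Longrightarrow>
    replacement [SL m, SD n (Fin a)] (SL (m + 1) # D_opt (n - 1) (Fin a))
      (\<lambda>\<epsilon>. (diag_block (L_mat m) (1\<^sub>m n),
            lower_block (R_mat m) (\<epsilon> \<cdot>\<^sub>m corner_nw n m) (jordan_block n a)))"
| iv_inf: "1 \<le> m \<Longrightarrow> 1 \<le> n \<Longrightarrow>
    replacement [SL m, SD n Infty] (SL (m + 1) # D_opt (n - 1) Infty)
      (\<lambda>\<epsilon>. (lower_block (L_mat m) (\<epsilon> \<cdot>\<^sub>m corner_ne n m) (jordan_block n 0),
            diag_block (R_mat m) (1\<^sub>m n)))"
| v_fin: "1 \<le> m \<Longrightarrow> m \<le> n \<Longrightarrow>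
    replacement [SD m (Fin a), SD n (Fin a)] (D_opt (m - 1) (Fin a) @ [SD (n + 1) (Fin a)])
      (\<lambda>\<epsilon>. (1\<^sub>m (m + n),
            upper_block (jordan_block m a) (\<epsilon> \<cdot>\<^sub>m corner_nw m n) (jordan_block n a)))"
| v_inf: "1 \<le> m \<Longrightarrow> m \<le> n \<Longrightarrow>
    replacement [SD m Infty, SD n Infty] (D_opt (m - 1) Infty @ [SD (n + 1) Infty])
      (\<lambda>\<epsilon>. (upper_block (jordan_block m 0) (\<epsilon> \<cdot>\<^sub>m corner_nw m n) (jordan_block n 0),
            1\<^sub>m (m + n)))"
| vi: "1 \<le> m \<Longrightarrow> 1 \<le> n \<Longrightarrow> distinct (map snd rs) \<Longrightarrow> \<forall>k \<in> set (map fst rs). 1 \<le> k \<Longrightarrow>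
    sum_list (map fst rs) = m + n - 1 \<Longrightarrow>
    replacement [SLT m, SL n] (map (\<lambda>(k, \<mu>). SD k \<mu>) rs)
      (\<lambda>\<epsilon>. (upper_block (transpose_mat (L_mat m)) (alpha_mat m n rs \<epsilon>) (L_mat n),
            upper_block (transpose_mat (R_mat m)) (beta_mat m n rs \<epsilon>) (R_mat n)))"

inductive kronecker_step :: "summand list \<Rightarrow> summand list \<Rightarrow> bool" where
  permute: "mset xs = mset ys \<Longrightarrow> kronecker_step xs ys"
| replace: "replacement P Q V \<Longrightarrow> kronecker_step (us @ P @ vs) (us @ Q @ vs)"

end

(* Degeneration to normal forms is governed by semicontinuous dimensions. For a pair (A, B) the
   dimension of the solution space of A V X = B V Y is invariant under equivalence and can only grow
   in a limit. With (X, Y) = (L_(k+1), R_(k+1)), (J_k(a), I) and (I, J_k(0)) these dimensions are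
   explicit sums over the summands (and for row minimal indices one transposes), so an inclusion of
   orbit closures gives numerical inequalities between the two lists of summands.

   Conversely, the inequalities produce replacements one at a time. As long as the degenerate list
   has more L-summands than the other one, either some eigenvalue block can be absorbed by the
   largest L-summand, or the largest L_m^T and L_n can be traded for eigenvalue blocks of the least
   admissible sizes, which an averaging argument shows to be small enough. When the numbers agree,
   one absorbs surplus eigenvalue blocks and then balances indices as for the dominance order.

   The canonical form of each perturbed pair is found from homomorphisms onto the indecomposable
   pairs, written as maps to polynomial spaces that are jointly injective. *)
theory Submission
  imports Defs "HOL-Library.Multiset"
begin

text \<open>All the dimensions are simple functions of \<open>k\<close>: an index \<open>n\<close>
  contributes the positive part of \<open>k + 1 - n\<close> (convex, one kink) to the polynomial
  solutions, and a Jordan block of size \<open>n\<close> contributes \<open>min n k\<close>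
  (concave, one kink) at its eigenvalue. Second differences recover the indices, and a comparison of
  two lists becomes a comparison of piecewise linear functions. Each of the replacements (i)--(v)
  lowers the functions that it affects by one on an interval or a half-line of \<open>k\<close>, so
  it preserves the inequalities when the surplus is positive there. The point is to locate such a
  range.

  The obstacle is that one \<open>L\<close>-summand contributes \<open>k\<close> to the inequality
  of every eigenvalue at once. Deleting it by (vi) must be paid for at all eigenvalues
  simultaneously, by blocks whose sizes have to fit into \<open>m + n - 1\<close>. The bound on
  these sizes cannot be seen at a single eigenvalue: it comes from distributing the total excess in
  block size over all \<open>h\<close> surplus \<open>L\<close>-summands, which explains why
  \<open>h\<close> appears as a factor on both sides before it is cancelled.\<close>

section \<open>Sums of truncated parts\<close>

text \<open>The truncated subtraction is intended: \<open>Suc k - n\<close> is the dimension contributed by \<open>L_n\<close> to the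
  polynomial solutions of degree \<open>< k\<close>.\<close>
definition deficit :: "nat \<Rightarrow> nat multiset \<Rightarrow> nat" where
  "deficit k S = (\<Sum>i\<in>#S. Suc k - i)"

definition trunc_sum :: "nat \<Rightarrow> nat multiset \<Rightarrow> nat" where
  "trunc_sum k S = (\<Sum>i\<in>#S. min i k)"

section \<open>Slopes, second differences and asymptotes of the two functions\<close>

lemma deficit_simps [simp]:
  "deficit k {#} = 0"
  "deficit k (add_mset i S) = (Suc k - i) + deficit k S"
  "deficit k (S + T) = deficit k S + deficit k T"
  by (simp_all add: deficit_def)

lemma trunc_sum_simps [simp]:
  "trunc_sum k {#} = 0"
  "trunc_sum k (add_mset i S) = min i k + trunc_sum k S"
  "trunc_sum k (S + T) = trunc_sum k S + trunc_sum k T"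
  by (simp_all add: trunc_sum_def)

text \<open>As a function of \<open>k\<close> the term \<open>Suc k - i\<close> is zero up to
  \<open>k + 1 = i\<close> and has slope one afterwards, so its second difference is the indicator
  of the kink. The deficits therefore determine the multiplicity of every part from 2 on.\<close>

lemma deficit_second_difference:
  "deficit (Suc (Suc k)) S + deficit k S = 2 * deficit (Suc k) S + count S (Suc (Suc k))"
  by (induction S) auto

lemma deficit_Suc: "deficit (Suc k) S = deficit k S + size {#i\<in>#S. i \<le> Suc k#}"
  by (induction S) auto

lemma deficit_0: "\<forall>i\<in>#S. 0 < i \<Longrightarrow> deficit 0 S = 0"
  by (induction S) auto

lemma deficit_1: "\<forall>i\<in>#S. 0 < i \<Longrightarrow> deficit 1 S = count S 1"
  by (induction S) auto

text \<open>This is the affine asymptote of the deficit: the slope is the number of parts and the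
  constant term encodes their sum. Comparing deficits for large \<open>k\<close> thus compares sizes
  first and sums second.\<close>

lemma deficit_large: "\<forall>i\<in>#S. i \<le> Suc k \<Longrightarrow> deficit k S + sum_mset S = size S * Suc k"
  by (induction S) auto

lemma deficit_lower: "size S * Suc k \<le> deficit k S + sum_mset S"
  by (induction S) auto

lemma trunc_sum_Suc: "trunc_sum (Suc k) S = trunc_sum k S + size {#i\<in>#S. k < i#}"
  by (induction S) auto

lemma trunc_sum_0 [simp]: "trunc_sum 0 S = 0"
  by (induction S) auto

lemma trunc_sum_large: "\<forall>i\<in>#S. i \<le> k \<Longrightarrow> trunc_sum k S = sum_mset S"
  by (induction S) auto

lemma trunc_sum_le: "trunc_sum k S \<le> sum_mset S"
  by (induction S) auto


lemma le_sum_mset: "i \<in># S \<Longrightarrow> i \<le> sum_mset (S :: nat multiset)"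
  by (induction S) auto

lemma deficit_le_imp_size_le:
  assumes "\<And>k. deficit k T \<le> deficit k S"
  shows "size T \<le> size S"
proof (rule ccontr)
  assume "\<not> size T \<le> size S"
  \<comment> \<open>Beyond all parts of \<open>S\<close>, and so large that one extra unit of slope
    outweighs \<open>sum_mset T\<close>.\<close>
  define k where "k = sum_mset S + sum_mset T"
  have "size T * Suc k \<le> deficit k S + sum_mset T"
    using deficit_lower[of T k] assms[of k] by linarith
  moreover have "deficit k S + sum_mset S = size S * Suc k"
    by (rule deficit_large) (use le_sum_mset in \<open>fastforce simp: k_def\<close>)
  moreover have "Suc (size S) * Suc k \<le> size T * Suc k"
    using \<open>\<not> size T \<le> size S\<close> by (intro mult_le_mono1) simp
  ultimately show False by (simp add: k_def)
qed

lemma sum_mset_le_of_deficit_le: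
  assumes "\<And>k. deficit k T \<le> deficit k S" and "size T = size S"
  shows "sum_mset S \<le> sum_mset T"
proof -
  define k where "k = sum_mset S + sum_mset T"
  have "size T * Suc k \<le> deficit k T + sum_mset T" by (rule deficit_lower)
  moreover have "deficit k S + sum_mset S = size S * Suc k"
    by (rule deficit_large) (use le_sum_mset in \<open>fastforce simp: k_def\<close>)
  ultimately show ?thesis using assms(1)[of k] assms(2) by simp
qed

text \<open>At \<open>k = M - 1\<close> no part of \<open>S\<close> is truncated, so the
  \<open>h\<close> surplus parts account for at most \<open>M\<close> each. This gives the upper
  bounds on index sums in the averaging argument for (vi).\<close>

lemma sum_mset_diff_le:
  assumes "\<And>k. deficit k T \<le> deficit k S" and "size S = size T + h"
    and "\<forall>i\<in>#S. i \<le> M" and "1 \<le> M"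
  shows "sum_mset S \<le> sum_mset T + h * M"
proof -
  have "deficit (M - 1) S + sum_mset S = size S * Suc (M - 1)"
    by (rule deficit_large) (use assms in auto)
  moreover have "size T * Suc (M - 1) \<le> deficit (M - 1) T + sum_mset T"
    by (rule deficit_lower)
  ultimately show ?thesis
    using assms(1)[of "M - 1"] assms(2,4) by (simp add: algebra_simps)
qed

text \<open>Beyond the largest part of \<open>S\<close> its deficit grows with the full slope
  \<open>size S\<close>, while that of \<open>T\<close> never grows faster than
  \<open>size T\<close>. The surplus therefore gains at least \<open>c\<close> per step.\<close>

lemma deficit_diff_mono:
  assumes "\<forall>i\<in>#S. i \<le> Suc k" and "size T + c \<le> size S" and "k \<le> l"
  shows "deficit l T + deficit k S + c * (l - k) \<le> deficit l S + deficit k T"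
  using \<open>k \<le> l\<close>
proof (induction l rule: dec_induct)
  case (step l)
  have "size {#i\<in>#S. i \<le> Suc l#} = size S"
  proof -
    have "\<forall>i\<in>#S. i \<le> Suc l" using assms(1) step.hyps(1) by (meson Suc_le_mono le_trans)
    then have "{#i\<in>#S. i \<le> Suc l#} = S" by (simp add: filter_mset_eq_conv)
    then show ?thesis by simp
  qed
  moreover have "size {#i\<in>#T. i \<le> Suc l#} \<le> size T"
    by (simp add: size_filter_mset_lesseq)
  moreover have "c * (Suc l - k) = c * (l - k) + c"
    using step.hyps by (simp add: Suc_diff_le)
  moreover note step.IH assms(2) deficit_Suc[of l S] deficit_Suc[of l T]
  ultimately show ?case by linarith
qed simp

text \<open>Raising the largest part costs one unit of deficit for every \<open>k\<close> from
  \<open>M\<close> on. Strictness has to be proved at \<open>k = M\<close> only, since the surplus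
  cannot shrink from there on.\<close>

lemma deficit_increment_max:
  assumes le: "\<And>k. deficit k T \<le> deficit k (add_mset M S)"
    and max: "\<forall>i\<in>#S. i \<le> M" and M: "1 \<le> M"
    and strict: "size T < Suc (size S) \<or> size T = Suc (size S) \<and> M + sum_mset S < sum_mset T"
  shows "deficit k T \<le> deficit k (add_mset (Suc M) S)"
proof (cases "k < M")
  case True
  then show ?thesis using le[of k] by simp
next
  case False
  let ?S = "add_mset M S"
  have sz: "size T \<le> size ?S" using strict by auto
  have lt: "deficit M T < deficit M ?S"
  proof (rule ccontr)
    assume "\<not> deficit M T < deficit M ?S"
    then have eq: "deficit M T = deficit M ?S" using le[of M] by simp
    show False
    proof (cases "size T < Suc (size S)")
      case True
      \<comment> \<open>With fewer parts in \<open>T\<close> the surplus gains at least one from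
        \<open>M - 1\<close> to \<open>M\<close>, so it cannot vanish at \<open>M\<close>.\<close>
      have "deficit M T + deficit (M - 1) ?S + 1 * (M - (M - 1)) \<le> deficit M ?S + deficit (M - 1) T"
        by (rule deficit_diff_mono) (use max M True in auto)
      then show False using eq le[of "M - 1"] M by simp
    next
      case False
      have a: "deficit M T + deficit (M - 1) ?S + 0 * (M - (M - 1)) \<le> deficit M ?S + deficit (M - 1) T"
        by (rule deficit_diff_mono) (use max M sz in auto)
      have dS: "deficit M ?S = deficit (M - 1) ?S + size ?S"
      proof -
        have "{#i\<in>#?S. i \<le> M#} = ?S" using max by (auto simp: filter_mset_eq_conv)
        then show ?thesis using deficit_Suc[of "M - 1" ?S] M by simp
      qed
      have dT: "deficit M T = deficit (M - 1) T + size {#i\<in>#T. i \<le> M#}"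
        using deficit_Suc[of "M - 1" T] M by simp
      \<comment> \<open>With equally many parts, a vanishing surplus at \<open>M\<close> forces
        \<open>T\<close> to have full slope too. Then no part of \<open>T\<close> exceeds
        \<open>M\<close>, both deficits lie on their asymptotes, and the sums would have to
        agree.\<close>
      have "size {#i\<in>#T. i \<le> M#} = size T"
        using eq dS dT le[of "M - 1"] sz size_filter_mset_lesseq[of "\<lambda>i. i \<le> M" T]
        by linarith
      then have "{#i\<in>#T. i \<le> M#} = T"
        by (metis multiset_filter_subset mset_subset_size nat_less_le subset_mset.le_less)
      then have "\<forall>i\<in>#T. i \<le> Suc M" by (auto simp: filter_mset_eq_conv)
      from deficit_large[OF this] have "deficit M T + sum_mset T = size T * Suc M" .
      moreover have "\<forall>i\<in>#?S. i \<le> Suc M" using max by auto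
      from deficit_large[OF this] have "deficit M ?S + sum_mset ?S = size ?S * Suc M" .
      ultimately show False using eq False strict by simp
    qed
  qed
  have "deficit k T + deficit M ?S + 0 * (k - M) \<le> deficit k ?S + deficit M T"
    by (rule deficit_diff_mono) (use max sz False in auto)
  then have "deficit k T < deficit k ?S" using lt by linarith
  then show ?thesis using False by (simp add: Suc_diff_le)
qed

text \<open>The deleted part is invisible for \<open>k < M\<close>. From \<open>M - 1\<close> on the
  remaining parts have full slope and are still at least as many as those of \<open>T\<close>, so
  the surplus at \<open>M - 1\<close> persists.\<close>

lemma deficit_remove_max:
  assumes le: "\<And>k. deficit k T \<le> deficit k (add_mset M S)"
    and max: "\<forall>i\<in>#S. i \<le> M" and M: "1 \<le> M" and sz: "size T \<le> size S"
  shows "deficit k T \<le> deficit k S"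
proof (cases "k < M")
  case True
  then show ?thesis using le[of k] by simp
next
  case False
  have "deficit k T + deficit (M - 1) S + 0 * (k - (M - 1)) \<le> deficit k S + deficit (M - 1) T"
    by (rule deficit_diff_mono) (use max M sz False in auto)
  moreover have "deficit (M - 1) T \<le> deficit (M - 1) S" using le[of "M - 1"] M by simp
  ultimately show ?thesis by linarith
qed

section \<open>Moves on two parts of one multiset\<close>

lemma interval_around:
  fixes P :: "nat \<Rightarrow> bool"
  assumes "P k" and "\<not> P 0" and "\<And>l. L \<le> l \<Longrightarrow> \<not> P l"
  obtains p q where "0 < p" "p \<le> k" "k \<le> q" "\<And>l. p \<le> l \<Longrightarrow> l \<le> q \<Longrightarrow> P l" "\<not> P (p - 1)" "\<not> P (Suc q)"
proof -
  define p where "p = (LEAST p. \<forall>l. p \<le> l \<and> l \<le> k \<longrightarrow> P l)"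
  have p: "\<forall>l. p \<le> l \<and> l \<le> k \<longrightarrow> P l" unfolding p_def
    by (rule LeastI[of _ k]) (use assms(1) in auto)
  have pk: "p \<le> k" unfolding p_def by (rule Least_le) (use assms(1) in auto)
  have p0: "0 < p" using p pk assms(2) by (metis gr0I order_refl zero_le)
  have "\<not> P (p - 1)"
  proof
    assume "P (p - 1)"
    then have "\<forall>l. p - 1 \<le> l \<and> l \<le> k \<longrightarrow> P l"
      using p by (metis Suc_pred' le_antisym not_less_eq_eq p0)
    then have "p \<le> p - 1" unfolding p_def by (rule Least_le)
    then show False using p0 by simp
  qed
  moreover define q where "q = (LEAST q. k \<le> q \<and> \<not> P (Suc q))"
  have q: "k \<le> q \<and> \<not> P (Suc q)" unfolding q_def
    by (rule LeastI[of _ "k + L"]) (use assms(3) in auto)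
  have "P l" if "k \<le> l" "l \<le> q" for l using that
  proof (induction l rule: dec_induct)
    case base
    then show ?case using assms(1) by simp
  next
    case (step l)
    then show ?case using not_less_Least[of l "\<lambda>q. k \<le> q \<and> \<not> P (Suc q)"] unfolding q_def[symmetric]
      by auto
  qed
  then have "P l" if "p \<le> l" "l \<le> q" for l using p that by (cases "l \<le> k") auto
  ultimately show thesis using that[of p q] p0 pk q by blast
qed

text \<open>Apply the balancing move at the two ends of a maximal interval on which the deficits
  differ: the second difference of \<open>deficit\<close> is \<open>count\<close>.\<close>
lemma deficit_balancing_step:
  assumes le: "\<And>k. deficit k T \<le> deficit k S"
    and pos: "\<forall>i\<in>#S. 0 < i" "\<forall>i\<in>#T. 0 < i"
    and eq: "size S = size T" "sum_mset S = sum_mset T" and ne: "S \<noteq> T"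
  obtains m n S' where "S = add_mset m (add_mset n S')" "m + 2 \<le> n"
    "\<And>k. deficit k T \<le> deficit k (add_mset (Suc m) (add_mset (n - 1) S'))"
proof -
  define P where "P = (\<lambda>k. deficit k T < deficit k S)"
  have "\<exists>k. P k"
  proof (rule ccontr)
    assume "\<not> (\<exists>k. P k)"
    then have e: "deficit k S = deficit k T" for k using le[of k] by (auto simp: P_def not_less le_antisym)
    \<comment> \<open>Parts from 2 on are second differences of deficits, the part 1 is visible in
      \<open>deficit 1\<close>, and positivity excludes 0.\<close>
    have "count S i = count T i" for i
    proof -
      consider "i = 0" | "i = 1" | k where "i = Suc (Suc k)" by (metis One_nat_def not0_implies_Suc)
      then show ?thesis
      proof cases
        case 1
        then show ?thesis using pos by (metis count_eq_zero_iff less_irrefl)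
      next
        case 2
        then show ?thesis using e[of 1] deficit_1 pos by metis
      next
        case 3
        then show ?thesis
          using e[of k] e[of "Suc k"] e[of "Suc (Suc k)"]
            deficit_second_difference[of k S] deficit_second_difference[of k T] by simp
      qed
    qed
    then show False using ne by (simp add: multiset_eq_iff)
  qed
  then obtain k where k: "P k" by blast
  have P0: "\<not> P 0" using deficit_0 pos by (simp add: P_def)
  \<comment> \<open>Equal sizes and equal sums give the same asymptote. For large \<open>l\<close>
    the deficit of \<open>S\<close> lies on it, and that of \<open>T\<close> is never below
    it.\<close>
  have PL: "\<not> P l" if "sum_mset S + sum_mset T \<le> l" for l
  proof -
    have "deficit l S + sum_mset S = size S * Suc l"
      by (rule deficit_large) (use le_sum_mset that in fastforce)
    moreover have "size T * Suc l \<le> deficit l T + sum_mset T" by (rule deficit_lower)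
    ultimately show ?thesis using eq by (simp add: P_def)
  qed
  obtain p q where pq: "0 < p" "p \<le> k" "k \<le> q" "\<And>l. p \<le> l \<Longrightarrow> l \<le> q \<Longrightarrow> P l"
    "\<not> P (p - 1)" "\<not> P (Suc q)"
    using interval_around[of P k, OF k P0 PL] by metis
  have eqp: "deficit (p - 1) T = deficit (p - 1) S" "deficit (Suc q) T = deficit (Suc q) S"
    using pq(5,6) le by (simp_all add: P_def le_antisym not_less)
  have Pp: "deficit p T < deficit p S" and Pq: "deficit q T < deficit q S"
    using pq(4)[of p] pq(4)[of q] pq(2,3) by (simp_all add: P_def)
  \<comment> \<open>The surplus is zero at \<open>p - 1\<close>, positive at \<open>p\<close> and
    nonnegative at \<open>p - 2\<close>. Its second difference is positive, so \<open>p\<close>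
    occurs more often in \<open>S\<close> than in \<open>T\<close>. For \<open>p = 1\<close> there
    is no \<open>p - 2\<close>, and \<open>deficit_1\<close> is used instead.\<close>
  have "p \<in># S"
  proof (cases "p = 1")
    case True
    then show ?thesis using Pp deficit_1[OF pos(1)] by (metis count_eq_zero_iff gr_implies_not0)
  next
    case False
    then obtain r where r: "p = Suc (Suc r)" using pq(1) by (metis One_nat_def gr0_implies_Suc neq0_conv)
    have "count T p < count S p"
      using deficit_second_difference[of r S] deficit_second_difference[of r T] Pp eqp(1) le[of r]
      by (simp add: r)
    then show ?thesis by (metis count_eq_zero_iff gr_implies_not0)
  qed
  \<comment> \<open>At the right end the surplus is positive at \<open>q\<close> and zero at
    \<open>q + 1\<close>, so the kink belonging to the part \<open>q + 2\<close> is stronger in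
    \<open>S\<close>. With \<open>p \<le> q\<close> this is the gap \<open>m + 2 \<le> n\<close> of
    (i) and (ii).\<close>
  moreover have "Suc (Suc q) \<in># S"
  proof -
    have "count T (Suc (Suc q)) < count S (Suc (Suc q))"
      using deficit_second_difference[of q S] deficit_second_difference[of q T] Pq eqp(2)
        le[of "Suc (Suc q)"] by simp
    then show ?thesis by (metis count_eq_zero_iff gr_implies_not0)
  qed
  ultimately have "Suc (Suc q) \<in># S - {#p#}"
    using pq(2,3) by (simp add: in_diff_count)
  then obtain S' where "S - {#p#} = add_mset (Suc (Suc q)) S'" by (rule mset_add)
  then have S': "S = add_mset p (add_mset (Suc (Suc q)) S')"
    using \<open>p \<in># S\<close> by (metis insert_DiffM)
  show thesis
  proof (rule that[OF S'])
    show "p + 2 \<le> Suc (Suc q)" using pq by simp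
    fix k
    \<comment> \<open>The two moves together lower the deficit by one exactly for
      \<open>p \<le> k \<le> q\<close>, where the surplus is at least one.\<close>
    show "deficit k T \<le> deficit k (add_mset (Suc p) (add_mset (Suc (Suc q) - 1) S'))"
    proof (cases "p \<le> k \<and> k \<le> q")
      case True
      then have "deficit k T < deficit k S" using pq(4)[of k] by (simp add: P_def)
      moreover have "Suc k - p = Suc (Suc k - Suc p)" using True by linarith
      ultimately show ?thesis using True by (simp add: S')
    next
      case False
      have "k < p \<Longrightarrow> Suc k - p = 0" "k > q \<Longrightarrow> Suc k - Suc q = Suc (Suc k - Suc (Suc q))" by auto
      with False show ?thesis using le[of k] by (cases "k < p") (simp_all add: S')
    qed
  qed
qed

text \<open>In \<open>k\<close>, the slope of \<open>min x k\<close> drops from one to zero at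
  \<open>x\<close>. The slope that \<open>trunc_sum\<close> loses between the two ends therefore
  counts the parts in the interval.\<close>

lemma size_filter_interval:
  assumes "0 < p" "p \<le> q"
  shows "trunc_sum p S + trunc_sum q S
    = trunc_sum (p - 1) S + trunc_sum (Suc q) S + size {#i\<in>#S. p \<le> i \<and> i \<le> q#}"
proof (induction S)
  case (add x S)
  have "min x p + min x q = min x (p - 1) + min x (Suc q) + (if p \<le> x \<and> x \<le> q then 1 else 0)"
  proof -
    consider "x < p" | "p \<le> x" "x \<le> q" | "q < x" by linarith
    then show ?thesis using assms by cases (auto simp: min_absorb1 min_absorb2)
  qed
  then show ?case
    using add by (cases "p \<le> x \<and> x \<le> q") (simp_all only: trunc_sum_simps filter_mset_add_mset size_add_mset simp_thms if_True if_False)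
qed simp

text \<open>The concave counterpart of balancing. On a maximal interval of positive surplus the
  surplus rises from zero and returns to zero, so \<open>S\<close> has at least two more parts in
  the interval than \<open>T\<close>. Any two parts found there may be pushed apart.\<close>

lemma trunc_sum_spreading_step:
  assumes le: "\<And>k. trunc_sum k T \<le> trunc_sum k S"
    and pos: "\<forall>i\<in>#S. 0 < i" "\<forall>i\<in>#T. 0 < i"
    and eq: "sum_mset S = sum_mset T" and ne: "S \<noteq> T"
  obtains m n S' where "S = add_mset m (add_mset n S')" "0 < m" "m \<le> n"
    "\<And>k. trunc_sum k T \<le> trunc_sum k (add_mset (m - 1) (add_mset (Suc n) S'))"
proof -
  define P where "P = (\<lambda>k. trunc_sum k T < trunc_sum k S)"
  have "\<exists>k. P k"
  proof (rule ccontr)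
    assume "\<not> (\<exists>k. P k)"
    then have e: "trunc_sum k S = trunc_sum k T" for k
      using le[of k] by (auto simp: P_def not_less le_antisym)
    have "count S i = count T i" for i
    proof (cases i)
      case 0
      then show ?thesis using pos by (metis count_eq_zero_iff less_irrefl)
    next
      case (Suc k)
      have c: "count A i = size {#j\<in>#A. i \<le> j \<and> j \<le> i#}" for A
        by (induction A) auto
      show ?thesis
        using size_filter_interval[of i i S] size_filter_interval[of i i T] e[of i] e[of "i - 1"]
          e[of "Suc i"] Suc c by simp
    qed
    then show False using ne by (simp add: multiset_eq_iff)
  qed
  then obtain k where k: "P k" by blast
  have P0: "\<not> P 0" by (simp add: P_def)
  have PL: "\<not> P l" if "sum_mset T \<le> l" for l
  proof -
    have "trunc_sum l T = sum_mset T"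
      by (rule trunc_sum_large) (use le_sum_mset that in fastforce)
    then show ?thesis using eq trunc_sum_le[of l S] by (simp add: P_def)
  qed
  obtain p q where pq: "0 < p" "p \<le> k" "k \<le> q" "\<And>l. p \<le> l \<Longrightarrow> l \<le> q \<Longrightarrow> P l"
    "\<not> P (p - 1)" "\<not> P (Suc q)"
    using interval_around[of P k, OF k P0 PL] by metis
  have eqp: "trunc_sum (p - 1) T = trunc_sum (p - 1) S" "trunc_sum (Suc q) T = trunc_sum (Suc q) S"
    using pq(5,6) le by (simp_all add: P_def le_antisym not_less)
  have "trunc_sum p T < trunc_sum p S" "trunc_sum q T < trunc_sum q S"
    using pq(4)[of p] pq(4)[of q] pq(2,3) by (simp_all add: P_def)
  then have two: "2 \<le> size {#i\<in>#S. p \<le> i \<and> i \<le> q#}"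
    using size_filter_interval[of p q S] size_filter_interval[of p q T] eqp pq(1-3) by simp
  then obtain x X where X: "{#i\<in>#S. p \<le> i \<and> i \<le> q#} = add_mset x X"
    by (metis multiset_cases size_empty not_numeral_le_zero)
  then obtain y Y where Y: "X = add_mset y Y"
    using two by (cases X) auto
  define m n where "m = min x y" and "n = max x y"
  have mn: "{#i\<in>#S. p \<le> i \<and> i \<le> q#} = add_mset m (add_mset n Y)" "m \<le> n"
    unfolding X Y m_def n_def by (auto simp: min_def max_def)
  then have rng: "p \<le> m" "n \<le> q"
    by (metis (no_types, lifting) mem_Collect_eq set_mset_filter union_single_eq_member
        insert_iff set_mset_add_mset_insert)+
  have "add_mset m (add_mset n Y) \<subseteq># S" using mn(1) by (metis multiset_filter_subset)
  then obtain S'' where "S = add_mset m (add_mset n Y) + S''" by (metis subset_mset.add_diff_inverse)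
  then have S': "S = add_mset m (add_mset n (Y + S''))" by simp
  show thesis
  proof (rule that[OF S'])
    show "0 < m" "m \<le> n" using pq(1) rng mn by auto
    fix k
    \<comment> \<open>Lowering \<open>m\<close> and raising \<open>n\<close> costs one unit exactly
      for \<open>m \<le> k \<le> n\<close>, which lies inside the interval of positive
      surplus.\<close>
    show "trunc_sum k T \<le> trunc_sum k (add_mset (m - 1) (add_mset (Suc n) (Y + S'')))"
    proof (cases "m \<le> k \<and> k \<le> n")
      case True
      then have "trunc_sum k T < trunc_sum k S" using pq(4)[of k] rng by (simp add: P_def)
      moreover have "min m k + min n k = Suc (min (m - 1) k + min (Suc n) k)"
        using True pq(1) rng by (auto simp: min_absorb1 min_absorb2)
      ultimately show ?thesis by (simp add: S')
    next
      case False
      then have "min m k + min n k \<le> min (m - 1) k + min (Suc n) k"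
        using mn(2) by (auto simp: min_def)
      then show ?thesis using le[of k] by (simp add: S')
    qed
  qed
qed

section \<open>Replacements of summands as steps on multisets\<close>

definition sl :: "summand multiset \<Rightarrow> nat multiset" where
  "sl M = \<Sum>\<^sub># (image_mset (\<lambda>s. case s of SL n \<Rightarrow> {#n#} | _ \<Rightarrow> {#}) M)"

definition slt :: "summand multiset \<Rightarrow> nat multiset" where
  "slt M = \<Sum>\<^sub># (image_mset (\<lambda>s. case s of SLT n \<Rightarrow> {#n#} | _ \<Rightarrow> {#}) M)"

definition sd :: "ext_complex \<Rightarrow> summand multiset \<Rightarrow> nat multiset" where
  "sd \<mu> M = \<Sum>\<^sub># (image_mset (\<lambda>s. case s of SD n \<nu> \<Rightarrow> if \<nu> = \<mu> then {#n#} else {#} | _ \<Rightarrow> {#}) M)"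

definition dtotal :: "summand multiset \<Rightarrow> nat" where
  "dtotal M = \<Sum>\<^sub># (image_mset (\<lambda>s. case s of SD n \<nu> \<Rightarrow> n | _ \<Rightarrow> 0) M)"

lemma part_simps [simp]:
  "sl {#} = {#}" "slt {#} = {#}" "sd \<mu> {#} = {#}" "dtotal {#} = 0"
  "sl (add_mset (SL n) M) = add_mset n (sl M)"
  "sl (add_mset (SLT n) M) = sl M" "sl (add_mset (SD n \<nu>) M) = sl M"
  "slt (add_mset (SLT n) M) = add_mset n (slt M)"
  "slt (add_mset (SL n) M) = slt M" "slt (add_mset (SD n \<nu>) M) = slt M"
  "sd \<mu> (add_mset (SD n \<nu>) M) = (if \<nu> = \<mu> then add_mset n (sd \<mu> M) else sd \<mu> M)"
  "sd \<mu> (add_mset (SL n) M) = sd \<mu> M" "sd \<mu> (add_mset (SLT n) M) = sd \<mu> M"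
  "dtotal (add_mset (SD n \<nu>) M) = n + dtotal M"
  "dtotal (add_mset (SL n) M) = dtotal M" "dtotal (add_mset (SLT n) M) = dtotal M"
  "sl (M + N) = sl M + sl N" "slt (M + N) = slt M + slt N" "sd \<mu> (M + N) = sd \<mu> M + sd \<mu> N"
  "dtotal (M + N) = dtotal M + dtotal N"
  by (simp_all add: sl_def slt_def sd_def dtotal_def)

lemma count_parts:
  "count (sl M) n = count M (SL n)" "count (slt M) n = count M (SLT n)"
  "count (sd \<mu> M) n = count M (SD n \<mu>)"
proof -
  have "count (sl M) n = count M (SL n) \<and> count (slt M) n = count M (SLT n)
    \<and> count (sd \<mu> M) n = count M (SD n \<mu>)"
  proof (induction M)
    case (add s M)
    then show ?case by (cases s) auto
  qed simp
  then show "count (sl M) n = count M (SL n)" "count (slt M) n = count M (SLT n)"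
    "count (sd \<mu> M) n = count M (SD n \<mu>)" by auto
qed

lemma in_parts:
  "n \<in># sl M \<longleftrightarrow> SL n \<in># M" "n \<in># slt M \<longleftrightarrow> SLT n \<in># M" "n \<in># sd \<mu> M \<longleftrightarrow> SD n \<mu> \<in># M"
  by (metis count_parts not_in_iff)+

lemma mset_eq_parts:
  assumes "sl M = sl N" "slt M = slt N" "\<And>\<mu>. sd \<mu> M = sd \<mu> N"
  shows "M = N"
proof (rule multiset_eqI)
  fix s show "count M s = count N s"
    by (cases s) (metis assms count_parts)+
qed

lemma obtain_pair_parts:
  shows "sl M = add_mset m (add_mset n S) \<Longrightarrow> \<exists>N. M = add_mset (SL m) (add_mset (SL n) N)"
    and "slt M = add_mset m (add_mset n S) \<Longrightarrow> \<exists>N. M = add_mset (SLT m) (add_mset (SLT n) N)"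
    and "sd \<mu> M = add_mset m (add_mset n S) \<Longrightarrow> \<exists>N. M = add_mset (SD m \<mu>) (add_mset (SD n \<mu>) N)"
proof -
  assume a: "sl M = add_mset m (add_mset n S)"
  then have "SL m \<in># M" by (metis in_parts(1) union_single_eq_member)
  then obtain N where N: "M = add_mset (SL m) N" by (metis insert_DiffM)
  then have "SL n \<in># N" using a in_parts(1)[of n N] by simp
  then show "\<exists>N. M = add_mset (SL m) (add_mset (SL n) N)" using N by (metis insert_DiffM)
next
  assume a: "slt M = add_mset m (add_mset n S)"
  then have "SLT m \<in># M" by (metis in_parts(2) union_single_eq_member)
  then obtain N where N: "M = add_mset (SLT m) N" by (metis insert_DiffM)
  then have "SLT n \<in># N" using a in_parts(2)[of n N] by simp
  then show "\<exists>N. M = add_mset (SLT m) (add_mset (SLT n) N)" using N by (metis insert_DiffM)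
next
  assume a: "sd \<mu> M = add_mset m (add_mset n S)"
  then have "SD m \<mu> \<in># M" by (metis in_parts(3) union_single_eq_member)
  then obtain N where N: "M = add_mset (SD m \<mu>) N" by (metis insert_DiffM)
  then have "SD n \<mu> \<in># N" using a in_parts(3)[of n \<mu> N] by simp
  then show "\<exists>N. M = add_mset (SD m \<mu>) (add_mset (SD n \<mu>) N)" using N by (metis insert_DiffM)
qed

definition eigenvalues :: "summand multiset \<Rightarrow> ext_complex set" where
  "eigenvalues M = {\<mu>. sd \<mu> M \<noteq> {#}}"

lemma finite_eigenvalues: "finite (eigenvalues M)"
proof (induction M)
  case (add s M)
  have "eigenvalues (add_mset s M) \<subseteq> (case s of SD n \<nu> \<Rightarrow> {\<nu>} | _ \<Rightarrow> {}) \<union> eigenvalues M"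
    by (cases s) (auto simp: eigenvalues_def)
  moreover have "finite (case s of SD n \<nu> \<Rightarrow> {\<nu>} | _ \<Rightarrow> {})" by (cases s) auto
  ultimately show ?case using add finite_subset by blast
qed (simp add: eigenvalues_def)

lemma dtotal_eq_sum:
  "finite E \<Longrightarrow> eigenvalues M \<subseteq> E \<Longrightarrow> dtotal M = (\<Sum>\<mu>\<in>E. sum_mset (sd \<mu> M))"
proof (induction M)
  case (add s M)
  show ?case
  proof (cases s)
    case (SD n \<nu>)
    then have "\<nu> \<in> E" "eigenvalues M \<subseteq> E" using add.prems(2) by (auto simp: eigenvalues_def split: if_splits)
    moreover have "(\<Sum>\<mu>\<in>E. sum_mset (sd \<mu> (add_mset s M)))
      = (\<Sum>\<mu>\<in>E. (if \<nu> = \<mu> then n else 0) + sum_mset (sd \<mu> M))"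
      by (intro sum.cong) (auto simp: SD)
    ultimately show ?thesis using add SD by (simp add: sum.distrib)
  next
    case (SL n)
    then show ?thesis using add by (simp add: eigenvalues_def)
  next
    case (SLT n)
    then show ?thesis using add by (simp add: eigenvalues_def)
  qed
qed simp

definition pos_mset :: "summand multiset \<Rightarrow> bool" where
  "pos_mset M \<longleftrightarrow> (\<forall>s\<in>#M. 1 \<le> summand_index s)"

lemma pos_mset_parts:
  assumes "pos_mset M"
  shows "\<forall>i\<in>#sl M. 0 < i" "\<forall>i\<in>#slt M. 0 < i" "\<forall>i\<in>#sd \<mu> M. 0 < i"
  using assms by (force simp: pos_mset_def in_parts)+

text \<open>The numerical conditions that semicontinuity of ranks imposes on \<open>M\<close> and \<open>N\<close> when
  \<open>M\<close> is the more degenerate of the two; the last two compare the matrix sizes.\<close>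
definition dominates :: "summand multiset \<Rightarrow> summand multiset \<Rightarrow> bool" where
  "dominates M N \<longleftrightarrow>
    (\<forall>k. deficit k (sl N) \<le> deficit k (sl M)) \<and>
    (\<forall>k. deficit k (slt N) \<le> deficit k (slt M)) \<and>
    (\<forall>\<mu> k. k * size (sl N) + trunc_sum k (sd \<mu> N) \<le> k * size (sl M) + trunc_sum k (sd \<mu> M)) \<and>
    size (sl M) + size (slt N) = size (sl N) + size (slt M) \<and>
    sum_mset (sl M) + sum_mset (slt M) + dtotal M + size (slt N)
      = sum_mset (sl N) + sum_mset (slt N) + dtotal N + size (slt M)"

text \<open>Forgets the order of the summands and the perturbation; the order is restored later by
  \<open>permute\<close> steps.\<close>

definition mset_step :: "summand multiset \<Rightarrow> summand multiset \<Rightarrow> bool" where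
  "mset_step M N \<longleftrightarrow> (\<exists>P Q V K. replacement P Q V \<and> M = mset P + K \<and> N = mset Q + K)"

section \<open>Quantities for the termination measure\<close>

abbreviation sum_squares :: "nat multiset \<Rightarrow> nat" where
  "sum_squares S \<equiv> (\<Sum>i\<in>#S. i * i)"

definition d_squares :: "summand multiset \<Rightarrow> nat" where
  "d_squares M = \<Sum>\<^sub># (image_mset (\<lambda>s. case s of SD n \<nu> \<Rightarrow> n * n | _ \<Rightarrow> 0) M)"

lemma d_squares_simps [simp]:
  "d_squares {#} = 0" "d_squares (add_mset (SD n \<nu>) M) = n * n + d_squares M"
  "d_squares (add_mset (SL n) M) = d_squares M" "d_squares (add_mset (SLT n) M) = d_squares M"
  "d_squares (M + N) = d_squares M + d_squares N"
  by (simp_all add: d_squares_def)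

text \<open>Keeps the subtraction in \<open>square_energy\<close> from truncating.\<close>

lemma d_squares_le: "d_squares M \<le> dtotal M * dtotal M"
proof (induction M)
  case (add s M)
  then show ?case by (cases s) (auto simp: algebra_simps)
qed simp

definition D_mset :: "nat \<Rightarrow> ext_complex \<Rightarrow> summand multiset" where
  "D_mset n \<mu> = (if n = 0 then {#} else {#SD n \<mu>#})"

lemma mset_D_opt: "mset (D_opt n \<mu>) = D_mset n \<mu>"
  by (simp add: D_opt_def D_mset_def)

lemma D_mset_simps [simp]:
  "sl (D_mset n \<mu>) = {#}" "slt (D_mset n \<mu>) = {#}" "dtotal (D_mset n \<mu>) = n"
  "trunc_sum k (sd \<nu> (D_mset n \<mu>)) = (if \<mu> = \<nu> then min n k else 0)"
  "d_squares (D_mset n \<mu>) = n * n"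
  by (simp_all add: D_mset_def)

section \<open>The six types of replacement on multisets\<close>

lemma mset_step_ii:
  "1 \<le> m \<Longrightarrow> m + 2 \<le> n \<Longrightarrow>
    mset_step (add_mset (SL m) (add_mset (SL n) K)) (add_mset (SL (Suc m)) (add_mset (SL (n - 1)) K))"
  unfolding mset_step_def
  by (rule exI[of _ "[SL m, SL n]"], rule exI[of _ "[SL (m + 1), SL (n - 1)]"])
     (use replacement.ii[of m n] in auto)

lemma mset_step_i:
  "1 \<le> m \<Longrightarrow> m + 2 \<le> n \<Longrightarrow>
    mset_step (add_mset (SLT m) (add_mset (SLT n) K)) (add_mset (SLT (Suc m)) (add_mset (SLT (n - 1)) K))"
  unfolding mset_step_def
  by (rule exI[of _ "[SLT m, SLT n]"], rule exI[of _ "[SLT (m + 1), SLT (n - 1)]"])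
     (use replacement.i[of m n] in auto)

lemma mset_step_iii:
  assumes "1 \<le> m" "1 \<le> n"
  shows "mset_step (add_mset (SLT m) (add_mset (SD n \<mu>) K)) (add_mset (SLT (Suc m)) (D_mset (n - 1) \<mu> + K))"
proof -
  obtain V where "replacement [SLT m, SD n \<mu>] (SLT (m + 1) # D_opt (n - 1) \<mu>) V"
    by (cases \<mu>) (use assms replacement.iii_fin replacement.iii_inf in metis)+
  then show ?thesis unfolding mset_step_def
    by (intro exI[of _ "[SLT m, SD n \<mu>]"] exI[of _ "SLT (m + 1) # D_opt (n - 1) \<mu>"])
      (auto simp: mset_D_opt)
qed

lemma mset_step_iv:
  assumes "1 \<le> m" "1 \<le> n"
  shows "mset_step (add_mset (SL m) (add_mset (SD n \<mu>) K)) (add_mset (SL (Suc m)) (D_mset (n - 1) \<mu> + K))"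
proof -
  obtain V where "replacement [SL m, SD n \<mu>] (SL (m + 1) # D_opt (n - 1) \<mu>) V"
    by (cases \<mu>) (use assms replacement.iv_fin replacement.iv_inf in metis)+
  then show ?thesis unfolding mset_step_def
    by (intro exI[of _ "[SL m, SD n \<mu>]"] exI[of _ "SL (m + 1) # D_opt (n - 1) \<mu>"])
      (auto simp: mset_D_opt)
qed

lemma mset_step_v:
  assumes "1 \<le> m" "m \<le> n"
  shows "mset_step (add_mset (SD m \<mu>) (add_mset (SD n \<mu>) K)) (add_mset (SD (Suc n) \<mu>) (D_mset (m - 1) \<mu> + K))"
proof -
  obtain V where "replacement [SD m \<mu>, SD n \<mu>] (D_opt (m - 1) \<mu> @ [SD (n + 1) \<mu>]) V"
    by (cases \<mu>) (use assms replacement.v_fin replacement.v_inf in metis)+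
  then show ?thesis unfolding mset_step_def
    by (intro exI[of _ "[SD m \<mu>, SD n \<mu>]"] exI[of _ "D_opt (m - 1) \<mu> @ [SD (n + 1) \<mu>]"])
      (auto simp: mset_D_opt)
qed

lemma mset_step_vi:
  assumes "1 \<le> m" "1 \<le> n" "finite E" "(\<Sum>\<mu>\<in>E. r \<mu>) = m + n - 1"
  shows "mset_step (add_mset (SLT m) (add_mset (SL n) K)) ((\<Sum>\<mu>\<in>E. D_mset (r \<mu>) \<mu>) + K)"
proof -
  define E' where "E' = {\<mu>\<in>E. r \<mu> \<noteq> 0}"
  obtain es where es: "set es = E'" "distinct es"
    using finite_distinct_list[of E'] assms(3) by (auto simp: E'_def)
  define rs where "rs = map (\<lambda>\<mu>. (r \<mu>, \<mu>)) es"
  have "sum_list (map fst rs) = (\<Sum>\<mu>\<in>E'. r \<mu>)"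
    by (simp add: rs_def o_def sum_list_distinct_conv_sum_set es)
  also have "\<dots> = (\<Sum>\<mu>\<in>E. r \<mu>)"
    unfolding E'_def by (rule sum.mono_neutral_left) (use assms(3) in auto)
  finally have "sum_list (map fst rs) = m + n - 1" using assms(4) by simp
  moreover have "distinct (map snd rs)" by (simp add: rs_def o_def es)
  moreover have "\<forall>k\<in>set (map fst rs). 1 \<le> k" using es by (auto simp: rs_def E'_def)
  ultimately have "\<exists>V. replacement [SLT m, SL n] (map (\<lambda>(k, \<mu>). SD k \<mu>) rs) V"
    using replacement.vi[OF assms(1,2), of rs] by blast
  then obtain V where V: "replacement [SLT m, SL n] (map (\<lambda>(k, \<mu>). SD k \<mu>) rs) V" ..
  have "mset (map (\<lambda>(k, \<mu>). SD k \<mu>) rs) = mset (map (\<lambda>\<mu>. SD (r \<mu>) \<mu>) es)"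
    by (simp add: rs_def o_def)
  also have "\<dots> = (\<Sum>\<mu>\<in>E'. {#SD (r \<mu>) \<mu>#})"
    using es(2) unfolding es(1)[symmetric] by (induction es) auto
  also have "\<dots> = (\<Sum>\<mu>\<in>E'. D_mset (r \<mu>) \<mu>)"
    by (rule sum.cong) (auto simp: D_mset_def E'_def)
  also have "\<dots> = (\<Sum>\<mu>\<in>E. D_mset (r \<mu>) \<mu>)"
    unfolding E'_def by (rule sum.mono_neutral_left) (use assms(3) in \<open>auto simp: D_mset_def\<close>)
  finally show ?thesis unfolding mset_step_def using V
    by (intro exI[of _ "[SLT m, SL n]"] exI[of _ "map (\<lambda>(k, \<mu>). SD k \<mu>) rs"]) auto
qed

lemma mset_step_pos: "mset_step M N \<Longrightarrow> pos_mset M \<Longrightarrow> pos_mset N"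
  unfolding mset_step_def
proof (elim exE conjE)
  fix P Q V K assume a: "replacement P Q V" "M = mset P + K" "N = mset Q + K" "pos_mset M"
  have "\<forall>s\<in>set Q. 1 \<le> summand_index s" using a(1)
    by (cases rule: replacement.cases) (auto simp: D_opt_def)
  then show "pos_mset N" using a by (auto simp: pos_mset_def)
qed

section \<open>The numerical conditions produce replacements\<close>

text \<open>Replacement (iv) lowers two functions by one: the deficits from \<open>m\<close> on,
  which \<open>deficit_increment_max\<close> permits because \<open>m\<close> is the largest index,
  and the eigenvalue function of \<mu> from \<open>n\<close> on, where \<open>slack\<close> provides
  the room.\<close>

lemma absorb_into_SL:
  assumes dom: "dominates M N" and M: "M = add_mset (SL m) (add_mset (SD n \<mu>) K)"
    and m: "1 \<le> m" "\<forall>i\<in>#sl K. i \<le> m" and n: "1 \<le> n"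
    and strict: "size (sl N) < size (sl M) \<or> size (sl N) = size (sl M) \<and> sum_mset (sl M) < sum_mset (sl N)"
    and slack: "\<And>k. n \<le> k \<Longrightarrow>
      k * size (sl N) + trunc_sum k (sd \<mu> N) < k * size (sl M) + trunc_sum k (sd \<mu> M)"
  shows "dominates (add_mset (SL (Suc m)) (D_mset (n - 1) \<mu> + K)) N" (is "dominates ?M' N")
proof -
  have "deficit k (sl N) \<le> deficit k (sl ?M')" for k
  proof -
    have "deficit k (sl N) \<le> deficit k (add_mset (Suc m) (sl K))"
      by (rule deficit_increment_max) (use dom M m strict in \<open>auto simp: dominates_def\<close>)
    then show ?thesis by simp
  qed
  moreover have "k * size (sl N) + trunc_sum k (sd \<nu> N) \<le> k * size (sl ?M') + trunc_sum k (sd \<nu> ?M')" for \<nu> k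
  proof -
    have F: "k * size (sl N) + trunc_sum k (sd \<nu> N) \<le> k * size (sl M) + trunc_sum k (sd \<nu> M)"
      using dom unfolding dominates_def by blast
    show ?thesis
    proof (cases "\<nu> = \<mu> \<and> n \<le> k")
      case True
      then have "min n k = Suc (min (n - 1) k)" using n by (auto simp: min_def)
      then show ?thesis using slack[of k] True by (simp add: M del: min_less_iff_conj)
    next
      case False
      then show ?thesis using F by (auto simp: M)
    qed
  qed
  ultimately show ?thesis using dom n unfolding dominates_def M by auto
qed

lemma absorb_into_SLT:
  assumes dom: "dominates M N" and M: "M = add_mset (SLT m) (add_mset (SD n \<mu>) K)"
    and m: "1 \<le> m" "\<forall>i\<in>#slt K. i \<le> m" and n: "1 \<le> n"
    and strict: "size (slt N) = size (slt M) \<and> sum_mset (slt M) < sum_mset (slt N)"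
    and slack: "\<And>k. n \<le> k \<Longrightarrow>
      k * size (sl N) + trunc_sum k (sd \<mu> N) < k * size (sl M) + trunc_sum k (sd \<mu> M)"
  shows "dominates (add_mset (SLT (Suc m)) (D_mset (n - 1) \<mu> + K)) N" (is "dominates ?M' N")
proof -
  have "deficit k (slt N) \<le> deficit k (slt ?M')" for k
  proof -
    have "deficit k (slt N) \<le> deficit k (add_mset (Suc m) (slt K))"
      by (rule deficit_increment_max) (use dom M m strict in \<open>auto simp: dominates_def\<close>)
    then show ?thesis by simp
  qed
  moreover have "k * size (sl N) + trunc_sum k (sd \<nu> N) \<le> k * size (sl ?M') + trunc_sum k (sd \<nu> ?M')" for \<nu> k
  proof -
    have F: "k * size (sl N) + trunc_sum k (sd \<nu> N) \<le> k * size (sl M) + trunc_sum k (sd \<nu> M)"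
      using dom unfolding dominates_def by blast
    show ?thesis
    proof (cases "\<nu> = \<mu> \<and> n \<le> k")
      case True
      then have "min n k = Suc (min (n - 1) k)" using n by (auto simp: min_def)
      then show ?thesis using slack[of k] True by (simp add: M del: min_less_iff_conj)
    next
      case False
      then show ?thesis using F by (auto simp: M)
    qed
  qed
  ultimately show ?thesis using dom n unfolding dominates_def M by auto
qed

lemma obtain_Max:
  assumes "S \<noteq> {#}"
  obtains m S' where "S = add_mset m S'" "\<forall>i\<in>#S'. i \<le> (m :: nat)"
proof
  have "Max_mset S \<in># S" using assms by simp
  then show "S = add_mset (Max_mset S) (S - {#Max_mset S#})" by simp
  show "\<forall>i\<in>#S - {#Max_mset S#}. i \<le> Max_mset S" by (meson Max_ge finite_set_mset in_diffD)
qed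

text \<open>With \<open>r\<close> the last \<open>k\<close> at which the hypothesis is an equality, the right-hand side has
  slope at least one more than the left-hand side beyond \<open>r\<close>.\<close>
lemma last_tight_point:
  assumes le: "\<And>k. k * b + trunc_sum k B \<le> k * a + trunc_sum k A" and ba: "b < a"
    and tight: "k0 * b + trunc_sum k0 B = k0 * a + trunc_sum k0 A" and k0: "\<forall>i\<in>#A. i \<le> k0"
  obtains r where "(a - b) * r + sum_mset A \<le> sum_mset B"
    "\<And>r' k. r \<le> r' \<Longrightarrow> k * b + trunc_sum k B \<le> k * (a - 1) + trunc_sum k A + min r' k"
proof -
  define T where "T = {k. k * b + trunc_sum k B = k * a + trunc_sum k A}"
  \<comment> \<open>Beyond \<open>sum_mset B\<close> the extra slope of the right-hand side excludes
    equality, so there is a last tight point.\<close>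
  have "T \<subseteq> {..sum_mset B}"
  proof
    fix k assume "k \<in> T"
    then have "k * b + trunc_sum k B = k * a + trunc_sum k A" by (simp add: T_def)
    moreover have "k * b + k \<le> k * a"
      using ba by (metis Suc_leI add.commute mult_Suc_right mult_le_mono2)
    ultimately show "k \<in> {..sum_mset B}" using trunc_sum_le[of k B] by simp
  qed
  then have fin: "finite T" by (rule finite_subset) simp
  have k0T: "k0 \<in> T" using tight by (simp add: T_def)
  define r where "r = Max T"
  have rT: "r \<in> T" unfolding r_def using fin k0T by (intro Max_in) auto
  then have req: "r * b + trunc_sum r B = r * a + trunc_sum r A" by (simp add: T_def)
  have k0r: "k0 \<le> r" unfolding r_def using fin k0T by (rule Max_ge)
  then have A: "trunc_sum k A = sum_mset A" if "r \<le> k" for k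
    using that k0 by (intro trunc_sum_large) (meson le_trans)
  \<comment> \<open>The first step past \<open>r\<close> gains at least one. Later the contribution
    of \<open>A\<close> is constant and the slope of \<open>trunc_sum k B\<close> can only decrease,
    so every further step gains at least one as well.\<close>
  have sep: "k * b + trunc_sum k B + (k - r) \<le> k * a + trunc_sum k A" if "r \<le> k" for k
    using that
  proof (induction k rule: dec_induct)
    case base
    then show ?case using req by simp
  next
    case (step k)
    have "Suc r \<notin> T" using Max_ge[OF fin, of "Suc r"] by (auto simp: r_def)
    then have "Suc r * b + trunc_sum (Suc r) B < Suc r * a + trunc_sum (Suc r) A"
      using le[of "Suc r"] by (simp add: T_def)
    then have "b + size {#i\<in>#B. r < i#} < a"
      using req A[of r] A[of "Suc r"] unfolding trunc_sum_Suc[of r B] by simp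
    moreover have "size {#i\<in>#B. k < i#} \<le> size {#i\<in>#B. r < i#}"
      using step.hyps(1) by (induction B) auto
    ultimately have "b + size {#i\<in>#B. k < i#} + 1 \<le> a" by simp
    moreover have "Suc k * b = k * b + b" "Suc k * a = k * a + a" by simp_all
    moreover have "Suc k - r = Suc (k - r)" using step.hyps by simp
    ultimately show ?case
      using step.IH A[of k] A[of "Suc k"] step.hyps unfolding trunc_sum_Suc[of k B] by simp
  qed
  show thesis
  proof (rule that[of r])
    have "trunc_sum r B \<le> sum_mset B" by (rule trunc_sum_le)
    moreover have "r * a = r * b + (a - b) * r"
      using ba by (metis add_mult_distrib2 le_add_diff_inverse less_imp_le mult.commute)
    ultimately show "(a - b) * r + sum_mset A \<le> sum_mset B"
      using req A[of r] by simp
    fix r' k assume r': "r \<le> r'"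
    \<comment> \<open>Deleting one \<open>L\<close>-summand costs \<open>k\<close>, and a new block
      of size \<open>r'\<close> returns \<open>min r' k\<close>. Up to \<open>r\<close> this is full
      compensation; beyond \<open>r\<close> the gap \<open>k - r\<close> and
      \<open>r \<le> r'\<close> cover the cost.\<close>
    have "k * (a - 1) + k = k * a" using ba by (cases a) auto
    then show "k * b + trunc_sum k B \<le> k * (a - 1) + trunc_sum k A + min r' k"
      using le[of k] sep[of k] r' by (cases "k \<le> r") auto
  qed
qed

lemma parts_sum_D_mset:
  assumes "finite E"
  shows "sl (\<Sum>\<mu>\<in>E. D_mset (r \<mu>) \<mu>) = {#}" "slt (\<Sum>\<mu>\<in>E. D_mset (r \<mu>) \<mu>) = {#}"
    "dtotal (\<Sum>\<mu>\<in>E. D_mset (r \<mu>) \<mu>) = (\<Sum>\<mu>\<in>E. r \<mu>)"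
    "trunc_sum k (sd \<nu> (\<Sum>\<mu>\<in>E. D_mset (r \<mu>) \<mu>)) = (if \<nu> \<in> E then min (r \<nu>) k else 0)"
  using assms by (induction E) auto

text \<open>Balancing indices lowers their sum of squares, whereas spreading blocks raises
  \<open>d_squares\<close>. The latter is bounded by the square of \<open>dtotal\<close>, so its
  complement is measured.\<close>

definition square_energy :: "summand multiset \<Rightarrow> nat" where
  "square_energy M = sum_squares (sl M) + sum_squares (slt M) + (dtotal M * dtotal M - d_squares M)"

text \<open>Lexicographic: (vi) removes an \<open>L\<close>-summand (and may enlarge
  \<open>dtotal\<close>), (iii) and (iv) shrink \<open>dtotal\<close>, and (i), (ii), (v) keep both
  and lower the energy.\<close>

abbreviation reduction_order :: "(summand multiset \<times> summand multiset) set" where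
  "reduction_order \<equiv> measures [\<lambda>M. size (sl M), dtotal, square_energy]"

text \<open>A dichotomy. If at some eigenvalue the inequality is strict for every \<open>k\<close>
  beyond the blocks of \<open>M\<close>, its largest block can be absorbed by (iv). Otherwise every
  eigenvalue has a last tight point, and these points are the block sizes that (vi) has to
  supply.\<close>

lemma step_fewer_SL:
  assumes dom: "dominates M N" and pos: "pos_mset M" "pos_mset N" and lt: "size (sl N) < size (sl M)"
  shows "\<exists>M'. mset_step M M' \<and> dominates M' N \<and> (M', M) \<in> reduction_order"
proof -
  have F: "k * size (sl N) + trunc_sum k (sd \<nu> N) \<le> k * size (sl M) + trunc_sum k (sd \<nu> M)" for \<nu> k
    using dom unfolding dominates_def by blast
  define tight where "tight = (\<lambda>\<mu> k. k * size (sl N) + trunc_sum k (sd \<mu> N)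
    = k * size (sl M) + trunc_sum k (sd \<mu> M) \<and> (\<forall>i\<in>#sd \<mu> M. i \<le> k))"
  obtain m S where S: "sl M = add_mset m S" "\<forall>i\<in>#S. i \<le> m"
    using obtain_Max[of "sl M"] lt by (metis gr_implies_not0 size_empty)
  then have "SL m \<in># M" by (metis in_parts(1) union_single_eq_member)
  then obtain K1 where K1: "M = add_mset (SL m) K1" by (metis insert_DiffM)
  then have SK1: "S = sl K1" using S by simp
  have m: "1 \<le> m" using pos(1) by (simp add: K1 pos_mset_def)
  show ?thesis
  proof (cases "\<forall>\<mu>. \<exists>k. tight \<mu> k")
    case False
    then obtain \<mu> where \<mu>: "\<And>k. \<not> tight \<mu> k" by blast
    \<comment> \<open>Without blocks at \<mu> the value \<open>k = 0\<close> would be tight.\<close>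
    have "sd \<mu> M \<noteq> {#}"
      using \<mu>[of 0] by (auto simp: tight_def)
    then obtain n A where A: "sd \<mu> M = add_mset n A" "\<forall>i\<in>#A. i \<le> n" by (rule obtain_Max)
    then have "SD n \<mu> \<in># M" by (metis in_parts(3) union_single_eq_member)
    then have "SD n \<mu> \<in># K1" using K1 by auto
    then obtain K where K: "K1 = add_mset (SD n \<mu>) K" by (metis insert_DiffM)
    have n: "1 \<le> n" using pos(1) by (simp add: K1 K pos_mset_def)
    have MK: "M = add_mset (SL m) (add_mset (SD n \<mu>) K)" using K1 K by simp
    let ?M' = "add_mset (SL (Suc m)) (D_mset (n - 1) \<mu> + K)"
    have "dominates ?M' N"
    proof (rule absorb_into_SL[OF dom MK m _ n])
      show "\<forall>i\<in>#sl K. i \<le> m" using S SK1 K by simp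
      show "size (sl N) < size (sl M) \<or> size (sl N) = size (sl M) \<and> sum_mset (sl M) < sum_mset (sl N)"
        using lt by simp
      fix k assume "n \<le> k"
      then have "\<forall>i\<in>#sd \<mu> M. i \<le> k" using A by auto
      then show "k * size (sl N) + trunc_sum k (sd \<mu> N) < k * size (sl M) + trunc_sum k (sd \<mu> M)"
        using \<mu>[of k] F[of k \<mu>] by (simp add: tight_def)
    qed
    moreover have "mset_step M ?M'" unfolding MK by (rule mset_step_iv[OF m n])
    moreover have "(?M', M) \<in> reduction_order" using n by (simp add: MK)
    ultimately show ?thesis by blast
  next
    case True
    define h where "h = size (sl M) - size (sl N)"
    have "\<exists>r. h * r + sum_mset (sd \<mu> M) \<le> sum_mset (sd \<mu> N) \<and> (\<forall>r' k. r \<le> r' \<longrightarrow>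
        k * size (sl N) + trunc_sum k (sd \<mu> N) \<le> k * (size (sl M) - 1) + trunc_sum k (sd \<mu> M) + min r' k)" for \<mu>
    proof -
      obtain k0 where "tight \<mu> k0" using True by blast
      then show ?thesis unfolding h_def tight_def
        by (elim conjE, rule_tac last_tight_point[OF F lt, of k0 \<mu>]) blast+
    qed
    then obtain r where r: "\<And>\<mu>. h * r \<mu> + sum_mset (sd \<mu> M) \<le> sum_mset (sd \<mu> N)"
      "\<And>\<mu> r' k. r \<mu> \<le> r' \<Longrightarrow>
        k * size (sl N) + trunc_sum k (sd \<mu> N) \<le> k * (size (sl M) - 1) + trunc_sum k (sd \<mu> M) + min r' k"
      by metis
    have h: "1 \<le> h" "size (sl M) = size (sl N) + h" using lt by (simp_all add: h_def)
    have h': "size (slt M) = size (slt N) + h"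
      using dom h unfolding dominates_def by simp
    obtain m' S' where S': "slt M = add_mset m' S'" "\<forall>i\<in>#S'. i \<le> m'"
      using obtain_Max[of "slt M"] h h' by (metis add_is_0 not_one_le_zero size_empty)
    then have "SLT m' \<in># M" by (metis in_parts(2) union_single_eq_member)
    then have "SLT m' \<in># K1" using K1 by auto
    then obtain K where K: "K1 = add_mset (SLT m') K" by (metis insert_DiffM)
    have MK: "M = add_mset (SLT m') (add_mset (SL m) K)" using K1 K by simp
    have m': "1 \<le> m'" using pos(1) by (simp add: MK pos_mset_def)
    define E where "E = insert Infty (eigenvalues M \<union> eigenvalues N)"
    have fin: "finite E" and sub: "eigenvalues M \<subseteq> E" "eigenvalues N \<subseteq> E"
      by (auto simp: E_def finite_eigenvalues)
    \<comment> \<open>Averaging: at each \<mu> the total block size of \<open>N\<close> exceeds that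
      of \<open>M\<close> by at least \<open>h * r \<mu>\<close>. The size equation and the largest
      indices \<open>m\<close>, \<open>m'\<close> bound the sum of these excesses by
      \<open>h * (m + m' - 1)\<close>, and \<open>h\<close> cancels.\<close>
    have "h * (\<Sum>\<mu>\<in>E. r \<mu>) + dtotal M \<le> dtotal N"
      unfolding dtotal_eq_sum[OF fin sub(1)] dtotal_eq_sum[OF fin sub(2)] sum_distrib_left sum.distrib[symmetric]
      by (rule sum_mono) (rule r(1))
    moreover have "sum_mset (sl M) \<le> sum_mset (sl N) + h * m"
      by (rule sum_mset_diff_le) (use dom h S m in \<open>auto simp: dominates_def\<close>)
    moreover have "sum_mset (slt M) \<le> sum_mset (slt N) + h * m'"
      by (rule sum_mset_diff_le) (use dom h' S' m' in \<open>auto simp: dominates_def\<close>)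
    moreover have "sum_mset (sl M) + sum_mset (slt M) + dtotal M + size (slt N)
      = sum_mset (sl N) + sum_mset (slt N) + dtotal N + size (slt M)"
      using dom unfolding dominates_def by blast
    ultimately have "h * (\<Sum>\<mu>\<in>E. r \<mu>) + h \<le> h * m + h * m'" using h' by linarith
    then have "h * ((\<Sum>\<mu>\<in>E. r \<mu>) + 1) \<le> h * (m + m')" by (simp add: distrib_left)
    then have sum_r: "(\<Sum>\<mu>\<in>E. r \<mu>) + 1 \<le> m + m'" using h(1) by (metis mult_le_cancel1 not_one_le_zero gr0I)
    \<comment> \<open>The sizes must add up to exactly \<open>m' + m - 1\<close>. A larger block
      only helps the inequalities, so the remainder goes to \<open>Infty\<close>, which was put into
      \<open>E\<close> for this purpose.\<close>
    define r' where "r' = (\<lambda>\<mu>. if \<mu> = Infty then r \<mu> + (m' + m - 1 - (\<Sum>\<mu>\<in>E. r \<mu>)) else r \<mu>)"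
    have "(\<Sum>\<mu>\<in>E. r' \<mu>) = (\<Sum>\<mu>\<in>E. r \<mu> + (if \<mu> = Infty then m' + m - 1 - (\<Sum>\<mu>\<in>E. r \<mu>) else 0))"
      unfolding r'_def by (intro sum.cong) auto
    also have "\<dots> = m' + m - 1" using sum_r fin unfolding sum.distrib by (simp add: E_def)
    finally have sum_r': "(\<Sum>\<mu>\<in>E. r' \<mu>) = m' + m - 1" .
    let ?M' = "(\<Sum>\<mu>\<in>E. D_mset (r' \<mu>) \<mu>) + K"
    have step: "mset_step M ?M'" unfolding MK by (rule mset_step_vi[OF m' m fin sum_r'])
    note parts = parts_sum_D_mset[OF fin]
    have "deficit k (sl N) \<le> deficit k (sl ?M')" for k
      unfolding part_simps parts
      by (simp, rule deficit_remove_max[of _ m])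
        (use dom S m lt in \<open>auto simp: MK dominates_def\<close>)
    moreover have "deficit k (slt N) \<le> deficit k (slt ?M')" for k
      unfolding part_simps parts
      by (simp, rule deficit_remove_max[of _ m'])
        (use dom S' m' h h' in \<open>auto simp: MK dominates_def\<close>)
    moreover have "k * size (sl N) + trunc_sum k (sd \<nu> N) \<le> k * size (sl ?M') + trunc_sum k (sd \<nu> ?M')" for \<nu> k
    proof (cases "\<nu> \<in> E")
      case True
      have "r \<nu> \<le> r' \<nu>" by (simp add: r'_def)
      from r(2)[OF this, of k] show ?thesis
        unfolding part_simps trunc_sum_simps parts using True by (simp add: MK)
    next
      case False
      then have "sd \<nu> M = {#}" "sd \<nu> N = {#}" using sub by (auto simp: eigenvalues_def)
      moreover have "size (sl N) \<le> size (sl K)" using lt by (simp add: MK)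
      ultimately show ?thesis
        unfolding part_simps trunc_sum_simps parts using False by (simp add: MK)
    qed
    ultimately have "dominates ?M' N"
      unfolding dominates_def
    proof (intro conjI allI)
      have d: "size (sl M) + size (slt N) = size (sl N) + size (slt M)"
        "sum_mset (sl M) + sum_mset (slt M) + dtotal M + size (slt N)
          = sum_mset (sl N) + sum_mset (slt N) + dtotal N + size (slt M)"
        using dom unfolding dominates_def by auto
      then show "size (sl ?M') + size (slt N) = size (sl N) + size (slt ?M')"
        "sum_mset (sl ?M') + sum_mset (slt ?M') + dtotal ?M' + size (slt N)
          = sum_mset (sl N) + sum_mset (slt N) + dtotal N + size (slt ?M')"
        unfolding part_simps parts using sum_r' m m' by (simp_all add: MK)
    qed blast+
    moreover have "(?M', M) \<in> reduction_order"
      by (simp add: MK parts)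
    ultimately show ?thesis using step by blast
  qed
qed

text \<open>With equally many \<open>L\<close>-summands the term \<open>k * size\<close> cancels.
  The index sums can then only rise and the block totals only fall on the way to \<open>N\<close>. A
  strict fall pays for an absorption; if all totals agree, only moves inside one multiset
  remain.\<close>

lemma step_equal_SL:
  assumes dom: "dominates M N" and pos: "pos_mset M" "pos_mset N" and eq: "size (sl N) = size (sl M)"
    and ne: "M \<noteq> N"
  shows "\<exists>M'. mset_step M M' \<and> dominates M' N \<and> (M', M) \<in> reduction_order"
proof -
  have F: "trunc_sum k (sd \<nu> N) \<le> trunc_sum k (sd \<nu> M)" for \<nu> k
    using dom eq unfolding dominates_def by simp
  have eq': "size (slt N) = size (slt M)" using dom eq unfolding dominates_def by simp
  have tot: "sum_mset (sl M) + sum_mset (slt M) + dtotal M = sum_mset (sl N) + sum_mset (slt N) + dtotal N"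
    using dom eq' unfolding dominates_def by simp
  have le1: "sum_mset (sl M) \<le> sum_mset (sl N)"
    using sum_mset_le_of_deficit_le[of "sl N" "sl M"] dom eq unfolding dominates_def by simp
  have le2: "sum_mset (slt M) \<le> sum_mset (slt N)"
    using sum_mset_le_of_deficit_le[of "slt N" "slt M"] dom eq' unfolding dominates_def by simp
  define E where "E = eigenvalues M \<union> eigenvalues N"
  have fin: "finite E" and sub: "eigenvalues M \<subseteq> E" "eigenvalues N \<subseteq> E"
    by (auto simp: E_def finite_eigenvalues)
  have le3: "sum_mset (sd \<mu> N) \<le> sum_mset (sd \<mu> M)" for \<mu>
  proof -
    define k where "k = sum_mset (sd \<mu> N) + sum_mset (sd \<mu> M)"
    have "trunc_sum k (sd \<mu> N) = sum_mset (sd \<mu> N)" "trunc_sum k (sd \<mu> M) = sum_mset (sd \<mu> M)"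
      by (rule trunc_sum_large; use le_sum_mset in \<open>fastforce simp: k_def\<close>)+
    then show ?thesis using F[of k \<mu>] by simp
  qed
  show ?thesis
  proof (cases "dtotal N < dtotal M")
    case True
    then obtain \<mu> where \<mu>: "sum_mset (sd \<mu> N) < sum_mset (sd \<mu> M)"
      unfolding dtotal_eq_sum[OF fin sub(1)] dtotal_eq_sum[OF fin sub(2)]
      by (meson not_le sum_mono)
    then have "sd \<mu> M \<noteq> {#}" by auto
    then obtain n A where A: "sd \<mu> M = add_mset n A" "\<forall>i\<in>#A. i \<le> n" by (rule obtain_Max)
    then have "SD n \<mu> \<in># M" by (metis in_parts(3) union_single_eq_member)
    then obtain K1 where K1: "M = add_mset (SD n \<mu>) K1" by (metis insert_DiffM)
    have n: "1 \<le> n" using pos(1) by (simp add: K1 pos_mset_def)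
    \<comment> \<open>From the largest block \<open>n\<close> on nothing is truncated in
      \<open>M\<close>, so the strict inequality of the block totals carries over.\<close>
    have slack: "k * size (sl N) + trunc_sum k (sd \<mu> N) < k * size (sl M) + trunc_sum k (sd \<mu> M)"
      if "n \<le> k" for k
    proof -
      have "trunc_sum k (sd \<mu> M) = sum_mset (sd \<mu> M)"
        by (rule trunc_sum_large) (use A that in auto)
      then show ?thesis using \<mu> trunc_sum_le[of k "sd \<mu> N"] eq by simp
    qed
    \<comment> \<open>The block size that disappears has to reappear in the indices of one of the
      two kinds.\<close>
    consider "sum_mset (sl M) < sum_mset (sl N)" | "sum_mset (slt M) < sum_mset (slt N)"
      using True tot by linarith
    then show ?thesis
    proof cases
      case 1
      then have "sl M \<noteq> {#}" using eq by auto
      then obtain m S where S: "sl M = add_mset m S" "\<forall>i\<in>#S. i \<le> m" by (rule obtain_Max)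
      then have "SL m \<in># M" by (metis in_parts(1) union_single_eq_member)
      then have "SL m \<in># K1" using K1 by auto
      then obtain K where K: "K1 = add_mset (SL m) K" by (metis insert_DiffM)
      have MK: "M = add_mset (SL m) (add_mset (SD n \<mu>) K)" using K1 K by simp
      have m: "1 \<le> m" using pos(1) by (simp add: MK pos_mset_def)
      let ?M' = "add_mset (SL (Suc m)) (D_mset (n - 1) \<mu> + K)"
      have "dominates ?M' N"
        by (rule absorb_into_SL[OF dom MK m _ n _ slack]) (use S 1 eq in \<open>auto simp: MK\<close>)
      moreover have "mset_step M ?M'" unfolding MK by (rule mset_step_iv[OF m n])
      moreover have "(?M', M) \<in> reduction_order" using n by (simp add: MK)
      ultimately show ?thesis by blast
    next
      case 2
      then have "slt M \<noteq> {#}" using eq' by auto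
      then obtain m S where S: "slt M = add_mset m S" "\<forall>i\<in>#S. i \<le> m" by (rule obtain_Max)
      then have "SLT m \<in># M" by (metis in_parts(2) union_single_eq_member)
      then have "SLT m \<in># K1" using K1 by auto
      then obtain K where K: "K1 = add_mset (SLT m) K" by (metis insert_DiffM)
      have MK: "M = add_mset (SLT m) (add_mset (SD n \<mu>) K)" using K1 K by simp
      have m: "1 \<le> m" using pos(1) by (simp add: MK pos_mset_def)
      let ?M' = "add_mset (SLT (Suc m)) (D_mset (n - 1) \<mu> + K)"
      have "dominates ?M' N"
        by (rule absorb_into_SLT[OF dom MK m _ n _ slack]) (use S 2 eq' in \<open>auto simp: MK\<close>)
      moreover have "mset_step M ?M'" unfolding MK by (rule mset_step_iii[OF m n])
      moreover have "(?M', M) \<in> reduction_order" using n by (simp add: MK)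
      ultimately show ?thesis by blast
    qed
  next
    case False
    have "dtotal N \<le> dtotal M"
      unfolding dtotal_eq_sum[OF fin sub(1)] dtotal_eq_sum[OF fin sub(2)]
      by (rule sum_mono) (rule le3)
    then have eqs: "dtotal M = dtotal N" "sum_mset (sl M) = sum_mset (sl N)" "sum_mset (slt M) = sum_mset (slt N)"
      using False tot le1 le2 by linarith+
    \<comment> \<open>Inequalities at every eigenvalue with equal totals are equalities.\<close>
    have eq3: "sum_mset (sd \<mu> N) = sum_mset (sd \<mu> M)" for \<mu>
    proof (cases "\<mu> \<in> E")
      case True
      show ?thesis
      proof (rule ccontr)
        assume "sum_mset (sd \<mu> N) \<noteq> sum_mset (sd \<mu> M)"
        then have "sum_mset (sd \<mu> N) < sum_mset (sd \<mu> M)" using le3[of \<mu>] by simp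
        then have "dtotal N < dtotal M"
          unfolding dtotal_eq_sum[OF fin sub(1)] dtotal_eq_sum[OF fin sub(2)]
          by (intro sum_strict_mono_ex1) (use fin le3 True in auto)
        then show False using eqs by simp
      qed
    next
      case False
      then have "sd \<mu> M = {#}" "sd \<mu> N = {#}" using sub by (auto simp: eigenvalues_def)
      then show ?thesis by simp
    qed
    consider "sl M \<noteq> sl N" | "slt M \<noteq> slt N" | \<mu> where "sd \<mu> M \<noteq> sd \<mu> N"
      using ne mset_eq_parts by blast
    then show ?thesis
    proof cases
      case 1
      obtain m n S' where S': "sl M = add_mset m (add_mset n S')" "m + 2 \<le> n"
        "\<And>k. deficit k (sl N) \<le> deficit k (add_mset (Suc m) (add_mset (n - 1) S'))"
        by (rule deficit_balancing_step[of "sl N" "sl M"])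
          (use dom pos eq eqs 1 in \<open>auto simp: dominates_def pos_mset_parts\<close>)
      then obtain K where K: "M = add_mset (SL m) (add_mset (SL n) K)" using obtain_pair_parts(1) by blast
      have m: "1 \<le> m" using pos(1) by (simp add: K pos_mset_def)
      let ?M' = "add_mset (SL (Suc m)) (add_mset (SL (n - 1)) K)"
      have "dominates ?M' N"
        using dom S' unfolding dominates_def K by (simp add: K)
      moreover have "mset_step M ?M'" unfolding K by (rule mset_step_ii[OF m S'(2)])
      moreover have "(?M', M) \<in> reduction_order"
      proof -
        obtain c where "n = m + c + 2" using S'(2) by (metis add.assoc add.commute le_Suc_ex)
        then show ?thesis by (simp add: K square_energy_def algebra_simps)
      qed
      ultimately show ?thesis by blast
    next
      case 2
      obtain m n S' where S': "slt M = add_mset m (add_mset n S')" "m + 2 \<le> n"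
        "\<And>k. deficit k (slt N) \<le> deficit k (add_mset (Suc m) (add_mset (n - 1) S'))"
        by (rule deficit_balancing_step[of "slt N" "slt M"])
          (use dom pos eq' eqs 2 in \<open>auto simp: dominates_def pos_mset_parts\<close>)
      then obtain K where K: "M = add_mset (SLT m) (add_mset (SLT n) K)" using obtain_pair_parts(2) by blast
      have m: "1 \<le> m" using pos(1) by (simp add: K pos_mset_def)
      let ?M' = "add_mset (SLT (Suc m)) (add_mset (SLT (n - 1)) K)"
      have "dominates ?M' N"
        using dom S' unfolding dominates_def K by (simp add: K)
      moreover have "mset_step M ?M'" unfolding K by (rule mset_step_i[OF m S'(2)])
      moreover have "(?M', M) \<in> reduction_order"
      proof -
        obtain c where "n = m + c + 2" using S'(2) by (metis add.assoc add.commute le_Suc_ex)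
        then show ?thesis by (simp add: K square_energy_def algebra_simps)
      qed
      ultimately show ?thesis by blast
    next
      case 3
      obtain m n S' where S': "sd \<mu> M = add_mset m (add_mset n S')" "0 < m" "m \<le> n"
        "\<And>k. trunc_sum k (sd \<mu> N) \<le> trunc_sum k (add_mset (m - 1) (add_mset (Suc n) S'))"
        by (rule trunc_sum_spreading_step[of "sd \<mu> N" "sd \<mu> M"])
          (use F pos eq3 3 in \<open>auto simp: pos_mset_parts\<close>)
      then obtain K where K: "M = add_mset (SD m \<mu>) (add_mset (SD n \<mu>) K)" using obtain_pair_parts(3) by blast
      then have SK: "S' = sd \<mu> K" using S'(1) by simp
      let ?M' = "add_mset (SD (Suc n) \<mu>) (D_mset (m - 1) \<mu> + K)"
      have F': "trunc_sum k (sd \<nu> N) \<le> trunc_sum k (sd \<nu> ?M')" for \<nu> k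
        using F[of k \<nu>] S'(4)[of k] by (auto simp: K SK split: if_splits)
      have "dominates ?M' N"
        using dom F' eq S'(2) unfolding dominates_def by (simp add: K)
      moreover have "mset_step M ?M'" unfolding K
        by (rule mset_step_v) (use S' in auto)
      moreover have "(?M', M) \<in> reduction_order"
      proof -
        have e: "sl ?M' = sl M" "slt ?M' = slt M" "dtotal ?M' = dtotal M"
          using S'(2) by (simp_all add: K)
        have "d_squares M < d_squares ?M'"
        proof -
          obtain a where "m = Suc a" using S'(2) by (metis gr0_conv_Suc)
          then show ?thesis using S'(3) by (simp add: K)
        qed
        moreover have "(M1, M) \<in> reduction_order" if "sl M1 = sl M" "slt M1 = slt M"
          "dtotal M1 = dtotal M" "d_squares M < d_squares M1" for M1
          using that d_squares_le[of M1] by (simp add: square_energy_def)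
        ultimately show ?thesis using e by blast
      qed
      ultimately show ?thesis by blast
    qed
  qed
qed

theorem dominates_imp_steps:
  assumes "dominates M N" "pos_mset M" "pos_mset N"
  shows "mset_step\<^sup>*\<^sup>* M N"
  using assms
proof (induction M rule: wf_induct_rule[OF wf_measures[of "[\<lambda>M. size (sl M), dtotal, square_energy]"]])
  case (1 M)
  show ?case
  proof (cases "M = N")
    case False
    have "size (sl N) \<le> size (sl M)"
      using deficit_le_imp_size_le[of "sl N" "sl M"] 1(2) unfolding dominates_def by blast
    then obtain M' where "mset_step M M'" "dominates M' N" "(M', M) \<in> reduction_order"
      using step_fewer_SL[OF 1(2-4)] step_equal_SL[OF 1(2-4) _ False] by (metis nat_less_le)
    then show ?thesis using 1 mset_step_pos by (meson converse_rtranclp_into_rtranclp)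
  qed simp
qed

lemma mset_step_imp_kronecker_steps:
  assumes "mset_step (mset as) N"
  shows "\<exists>bs. mset bs = N \<and> kronecker_step\<^sup>*\<^sup>* as bs"
proof -
  obtain P Q V K where *: "replacement P Q V" "mset as = mset P + K" "N = mset Q + K"
    using assms unfolding mset_step_def by blast
  obtain ks where "mset ks = K" using ex_mset by blast
  then have "kronecker_step as ([] @ P @ ks)" using * by (intro kronecker_step.permute) simp
  moreover have "kronecker_step ([] @ P @ ks) ([] @ Q @ ks)" using *(1) by (rule kronecker_step.replace)
  ultimately have "kronecker_step\<^sup>*\<^sup>* as ([] @ Q @ ks)" by simp
  moreover have "mset ([] @ Q @ ks) = N" using * \<open>mset ks = K\<close> by simp
  ultimately show ?thesis by blast
qed

theorem dominates_imp_kronecker_steps: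
  assumes "dominates (mset as) (mset bs)" "summands as" "summands bs"
  shows "kronecker_step\<^sup>*\<^sup>* as bs"
proof -
  have *: "\<exists>cs. mset cs = N \<and> kronecker_step\<^sup>*\<^sup>* as cs" if "mset_step\<^sup>*\<^sup>* (mset as) N" for N
    using that
  proof (induction rule: rtranclp_induct)
    case (step N N')
    then show ?case using mset_step_imp_kronecker_steps by (metis rtranclp_trans)
  qed blast
  have "mset_step\<^sup>*\<^sup>* (mset as) (mset bs)"
    by (rule dominates_imp_steps) (use assms in \<open>auto simp: pos_mset_def summands_def\<close>)
  from *[OF this] obtain cs where "mset cs = mset bs" "kronecker_step\<^sup>*\<^sup>* as cs" by blast
  then show ?thesis using kronecker_step.permute by (metis rtranclp.rtrancl_into_rtrancl)
qed

section \<open>Equivalence of pairs and closures of orbits\<close>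

text \<open>The inverse is carried as an explicit matrix of known size, so that products can be
  cancelled by rewriting.\<close>

definition mutual_inverse :: "nat \<Rightarrow> complex mat \<Rightarrow> complex mat \<Rightarrow> bool" where
  "mutual_inverse n S S' \<longleftrightarrow> S \<in> carrier_mat n n \<and> S' \<in> carrier_mat n n \<and> S * S' = 1\<^sub>m n \<and> S' * S = 1\<^sub>m n"

lemma mutual_inverse_sym: "mutual_inverse n S S' \<Longrightarrow> mutual_inverse n S' S"
  by (auto simp: mutual_inverse_def)

lemma invertible_mat_iff:
  assumes "S \<in> carrier_mat n n"
  shows "invertible_mat S \<longleftrightarrow> (\<exists>S'. mutual_inverse n S S')"
proof
  assume "invertible_mat S"
  then obtain S' where *: "S * S' = 1\<^sub>m n" "S' * S = 1\<^sub>m (dim_row S')"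
    using assms by (auto simp: invertible_mat_def inverts_mat_def)
  have "dim_col S' = n" using arg_cong[OF *(1), of dim_col] by simp
  moreover have "dim_row S' = n" using arg_cong[OF *(2), of dim_col] assms by simp
  ultimately have "S' \<in> carrier_mat n n" by auto
  then show "\<exists>S'. mutual_inverse n S S'" using assms * by (auto simp: mutual_inverse_def)
next
  assume "\<exists>S'. mutual_inverse n S S'"
  then show "invertible_mat S"
    by (auto simp: mutual_inverse_def invertible_mat_def inverts_mat_def)
qed

lemma mutual_inverse_of_det:
  assumes "S \<in> carrier_mat n n" "det S \<noteq> 0"
  shows "\<exists>S'. mutual_inverse n S S'"
  using det_non_zero_imp_unit[OF assms, of "()"]
  by (auto simp: Units_def ring_mat_def mutual_inverse_def)

lemma mutual_inverse_of_inj: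
  assumes "S \<in> carrier_mat n n"
    and "\<And>v. v \<in> carrier_vec n \<Longrightarrow> S *\<^sub>v v = 0\<^sub>v n \<Longrightarrow> v = 0\<^sub>v n"
  shows "\<exists>S'. mutual_inverse n S S'"
  by (rule mutual_inverse_of_det) (use assms det_0_iff_vec_prod_zero in blast)+

definition pairs :: "nat \<Rightarrow> nat \<Rightarrow> mat_pair set" where
  "pairs m n = carrier_mat m n \<times> carrier_mat m n"

lemma pairs_iff: "(A, B) \<in> pairs m n \<longleftrightarrow> A \<in> carrier_mat m n \<and> B \<in> carrier_mat m n"
  by (simp add: pairs_def)

lemma pairs_dims: "P \<in> pairs m n \<Longrightarrow> dim_row (fst P) = m \<and> dim_col (fst P) = n"
  by (auto simp: pairs_def)

definition act :: "complex mat \<Rightarrow> mat_pair \<Rightarrow> complex mat \<Rightarrow> mat_pair" where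
  "act S P R = (S * fst P * R, S * snd P * R)"

lemma act_in_pairs [intro]:
  "P \<in> pairs m n \<Longrightarrow> S \<in> carrier_mat m m \<Longrightarrow> R \<in> carrier_mat n n \<Longrightarrow> act S P R \<in> pairs m n"
  by (cases P) (auto simp: act_def pairs_def)

lemma pair_equiv_iff:
  assumes "P \<in> pairs m n"
  shows "pair_equiv P Q \<longleftrightarrow>
    (\<exists>S S' R R'. mutual_inverse m S S' \<and> mutual_inverse n R R' \<and> Q = act S P R)"
proof -
  have "pair_equiv P Q \<longleftrightarrow> (\<exists>S R. (S \<in> carrier_mat m m \<and> invertible_mat S) \<and>
      (R \<in> carrier_mat n n \<and> invertible_mat R) \<and> Q = act S P R)"
    using pairs_dims[OF assms] by (simp add: pair_equiv_def act_def conj_assoc)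
  also have "\<dots> \<longleftrightarrow> (\<exists>S R. (\<exists>S'. mutual_inverse m S S') \<and> (\<exists>R'. mutual_inverse n R R') \<and> Q = act S P R)"
  proof -
    have inv: "S \<in> carrier_mat k k \<and> invertible_mat S \<longleftrightarrow> (\<exists>S'. mutual_inverse k S S')" for S k
      using invertible_mat_iff[of S k] by (auto simp: mutual_inverse_def)
    show ?thesis by (simp only: inv)
  qed
  also have "\<dots> \<longleftrightarrow> (\<exists>S S' R R'. mutual_inverse m S S' \<and> mutual_inverse n R R' \<and> Q = act S P R)"
    by blast
  finally show ?thesis .
qed

lemma pair_equivI:
  "P \<in> pairs m n \<Longrightarrow> mutual_inverse m S S' \<Longrightarrow> mutual_inverse n R R' \<Longrightarrow> pair_equiv P (act S P R)"
  using pair_equiv_iff by blast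

lemma act_act:
  assumes "P \<in> pairs m n" "S \<in> carrier_mat m m" "T \<in> carrier_mat m m"
    "R \<in> carrier_mat n n" "U \<in> carrier_mat n n"
  shows "act T (act S P R) U = act (T * S) P (R * U)"
proof -
  have "T * (S * A * R) * U = T * S * A * (R * U)" if "A \<in> carrier_mat m n" for A
    using assms(2-5) that by (simp add: assoc_mult_mat[of _ m m _ n _ n] assoc_mult_mat[of _ m m _ m _ n]
        assoc_mult_mat[of _ m n _ n _ n])
  then show ?thesis using assms(1) by (cases P) (simp add: act_def pairs_def)
qed

lemma act_one: "P \<in> pairs m n \<Longrightarrow> act (1\<^sub>m m) P (1\<^sub>m n) = P"
  by (cases P) (auto simp: act_def pairs_def)

lemma mutual_inverse_one: "mutual_inverse n (1\<^sub>m n) (1\<^sub>m n)"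
  by (simp add: mutual_inverse_def)

lemma mutual_inverse_mult:
  assumes "mutual_inverse n S S'" "mutual_inverse n T T'"
  shows "mutual_inverse n (T * S) (S' * T')"
proof -
  have *: "A * B * (B' * A') = 1\<^sub>m n"
    if "A \<in> carrier_mat n n" "B \<in> carrier_mat n n" "A' \<in> carrier_mat n n" "B' \<in> carrier_mat n n"
      "B * B' = 1\<^sub>m n" "A * A' = 1\<^sub>m n" for A B A' B' :: "complex mat"
  proof -
    have "B * (B' * A') = B * B' * A'" by (rule assoc_mult_mat[symmetric]) (use that in auto)
    moreover have "A * B * (B' * A') = A * (B * (B' * A'))"
      by (rule assoc_mult_mat) (use that in auto)
    ultimately show ?thesis using that by simp
  qed
  show ?thesis using assms by (auto simp: mutual_inverse_def intro!: *)
qed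

lemma pair_equiv_in_pairs: "P \<in> pairs m n \<Longrightarrow> pair_equiv P Q \<Longrightarrow> Q \<in> pairs m n"
  by (auto simp: pair_equiv_iff mutual_inverse_def)

lemma pair_equiv_refl: "P \<in> pairs m n \<Longrightarrow> pair_equiv P P"
  using pair_equivI[OF _ mutual_inverse_one mutual_inverse_one] act_one by metis

lemma pair_equiv_sym:
  assumes "P \<in> pairs m n" "pair_equiv P Q"
  shows "pair_equiv Q P"
proof -
  obtain S S' R R' where *: "mutual_inverse m S S'" "mutual_inverse n R R'" "Q = act S P R"
    using assms pair_equiv_iff by blast
  then have "act S' Q R' = P"
    using act_act[OF assms(1), of S S' R R'] act_one[OF assms(1)] by (simp add: mutual_inverse_def)
  then show ?thesis
    using pair_equivI[OF pair_equiv_in_pairs[OF assms] mutual_inverse_sym[OF *(1)] mutual_inverse_sym[OF *(2)]]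
    by simp
qed

lemma pair_equiv_trans:
  assumes "P \<in> pairs m n" "pair_equiv P Q" "pair_equiv Q T"
  shows "pair_equiv P T"
proof -
  obtain S S' R R' where *: "mutual_inverse m S S'" "mutual_inverse n R R'" "Q = act S P R"
    using assms pair_equiv_iff by blast
  obtain U U' W W' where **: "mutual_inverse m U U'" "mutual_inverse n W W'" "T = act U Q W"
    using assms(3) pair_equiv_iff[OF pair_equiv_in_pairs[OF assms(1,2)]] by blast
  have "T = act (U * S) P (R * W)"
    using act_act[OF assms(1)] * ** by (simp add: mutual_inverse_def)
  then show ?thesis
    using pairs_dims pair_equivI[OF assms(1) mutual_inverse_mult[OF *(1) **(1)] mutual_inverse_mult[OF **(2) *(2)]]
    by simp
qed

lemma orbit_eq_iff:
  assumes "P \<in> pairs m n" "Q \<in> pairs m n"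
  shows "orbit P = orbit Q \<longleftrightarrow> pair_equiv P Q"
proof
  assume "orbit P = orbit Q"
  then show "pair_equiv P Q" using pair_equiv_refl[OF assms(2)] by (auto simp: orbit_def)
next
  assume "pair_equiv P Q"
  then show "orbit P = orbit Q"
    using assms by (auto simp: orbit_def intro: pair_equiv_trans pair_equiv_sym)
qed

section \<open>Limits and closures in the space of pairs of one size\<close>

lemma topspace_pair_space: "topspace (pair_space m n) = pairs m n"
  by (simp add: pair_space_def topspace_pullback_topology pairs_def)

text \<open>Stated for an arbitrary filter because it serves both sequences in an orbit and
  perturbations with \<epsilon> tending to 0. Requiring every member to have the fixed size keeps
  undefined entries out of play.\<close>

definition entries_tendsto :: "nat \<Rightarrow> nat \<Rightarrow> ('a \<Rightarrow> mat_pair) \<Rightarrow> mat_pair \<Rightarrow> 'a filter \<Rightarrow> bool" where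
  "entries_tendsto m n f P F \<longleftrightarrow> P \<in> pairs m n \<and> (\<forall>x. f x \<in> pairs m n) \<and>
    (\<forall>i<m. \<forall>j<n. ((\<lambda>x. fst (f x) $$ (i, j)) \<longlongrightarrow> fst P $$ (i, j)) F \<and>
                 ((\<lambda>x. snd (f x) $$ (i, j)) \<longlongrightarrow> snd P $$ (i, j)) F)"

lemma tendsto_fun_componentwise:
  fixes f :: "'a \<Rightarrow> 'b \<Rightarrow> 'c::topological_space"
  assumes "\<And>i. ((\<lambda>x. f x i) \<longlongrightarrow> l i) F"
  shows "(f \<longlongrightarrow> l) F"
proof -
  have "limitin (product_topology (\<lambda>i. euclidean) UNIV) f l F"
    unfolding limitin_componentwise using assms by simp
  then show ?thesis by (simp add: euclidean_product_topology)
qed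

lemma limitin_pair_space:
  assumes "entries_tendsto m n f P F"
  shows "limitin (pair_space m n) f P F"
  unfolding limitin_def
proof (intro conjI allI impI)
  show "P \<in> topspace (pair_space m n)" using assms by (simp add: topspace_pair_space entries_tendsto_def)
  fix U assume U: "openin (pair_space m n) U \<and> P \<in> U"
  let ?e = "\<lambda>(A, B). (entries m n A, entries m n B)"
  obtain W where W: "open W" "U = ?e -` W \<inter> (carrier_mat m n \<times> carrier_mat m n)"
    using U by (auto simp: pair_space_def openin_pullback_topology)
  have "((\<lambda>x. (entries m n (fst (f x)), entries m n (snd (f x)))) \<longlongrightarrow> (entries m n (fst P), entries m n (snd P))) F"
    by (intro tendsto_Pair tendsto_fun_componentwise)
      (use assms in \<open>auto simp: entries_def entries_tendsto_def\<close>)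
  moreover have "(entries m n (fst P), entries m n (snd P)) \<in> W"
    using U W by (auto simp: case_prod_unfold)
  ultimately have "\<forall>\<^sub>F x in F. (entries m n (fst (f x)), entries m n (snd (f x))) \<in> W"
    using W(1) topological_tendstoD by blast
  then show "\<forall>\<^sub>F x in F. f x \<in> U"
    by (rule eventually_mono) (use assms W in \<open>auto simp: case_prod_unfold entries_tendsto_def pairs_def\<close>)
qed

lemma closure_of_limit:
  assumes "entries_tendsto m n f P F" "F \<noteq> bot" "\<forall>\<^sub>F x in F. f x \<in> X"
  shows "P \<in> pair_space m n closure_of X"
  unfolding in_closure_of
proof (intro conjI allI impI)
  note lim = limitin_pair_space[OF assms(1)]
  then show "P \<in> topspace (pair_space m n)" by (simp add: limitin_def)
  fix T assume "P \<in> T \<and> openin (pair_space m n) T"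
  then have "\<forall>\<^sub>F x in F. f x \<in> T" using lim by (simp add: limitin_def)
  then have "\<forall>\<^sub>F x in F. f x \<in> X \<and> f x \<in> T" using assms(3) by (rule eventually_conj[rotated])
  then show "\<exists>y. y \<in> X \<and> y \<in> T" using eventually_happens'[OF assms(2)] by blast
qed

lemma closure_sequence:
  assumes "P \<in> pair_space m n closure_of X"
  obtains f where "entries_tendsto m n f P sequentially" "\<And>k. f k \<in> X"
proof -
  have P: "P \<in> pairs m n" using assms by (simp add: in_closure_of topspace_pair_space)
  have "\<exists>Q. Q \<in> X \<and> Q \<in> pairs m n \<and> (\<forall>i<m. \<forall>j<n.
      dist (fst Q $$ (i, j)) (fst P $$ (i, j)) < inverse (real (Suc k)) \<and>
      dist (snd Q $$ (i, j)) (snd P $$ (i, j)) < inverse (real (Suc k)))" for k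
  proof -
    let ?I = "{..<m} \<times> {..<n}"
    \<comment> \<open>A cylinder that restricts only finitely many coordinates, hence open in the
      product topology. Radii \<open>1/(k+1)\<close> then yield a sequence.\<close>
    define W :: "complex mat \<Rightarrow> (nat \<times> nat \<Rightarrow> complex) set" where "W = (\<lambda>A. {f. \<forall>p\<in>?I. f p \<in> {z. dist z (A $$ p) < inverse (real (Suc k))}})"
    have opW: "open (W A)" for A unfolding W_def by (intro product_topology_basis' open_Collect_less continuous_intros) auto
    let ?e = "\<lambda>(A, B). (entries m n A, entries m n B)"
    let ?U = "?e -` (W (fst P) \<times> W (snd P)) \<inter> (carrier_mat m n \<times> carrier_mat m n)"
    have "openin (pair_space m n) ?U"
      unfolding pair_space_def openin_pullback_topology using opW
      by (intro exI[of _ "W (fst P) \<times> W (snd P)"]) (simp add: open_Times)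
    moreover have "P \<in> ?U"
      using P by (auto simp: W_def entries_def pairs_def)
    moreover have "\<And>T. P \<in> T \<and> openin (pair_space m n) T \<Longrightarrow> \<exists>y. y \<in> X \<and> y \<in> T"
      using assms unfolding in_closure_of by (simp only: simp_thms)
    ultimately have "\<exists>Q. Q \<in> X \<and> Q \<in> ?U" by (metis (no_types, lifting))
    then obtain Q where "Q \<in> X" "Q \<in> ?U" by (elim exE conjE)
    then show ?thesis
      by (intro exI[of _ Q]) (auto simp: W_def entries_def pairs_def dist_commute)
  qed
  then obtain f where f: "\<And>k. f k \<in> X" "\<And>k. f k \<in> pairs m n"
    "\<And>k i j. i < m \<Longrightarrow> j < n \<Longrightarrow> dist (fst (f k) $$ (i, j)) (fst P $$ (i, j)) < inverse (real (Suc k))"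
    "\<And>k i j. i < m \<Longrightarrow> j < n \<Longrightarrow> dist (snd (f k) $$ (i, j)) (snd P $$ (i, j)) < inverse (real (Suc k))"
    by metis
  have lim: "(g \<longlongrightarrow> (l :: complex)) sequentially" if "\<And>k. dist (g k) l < inverse (real (Suc k))" for g l
  proof -
    have "((\<lambda>k. dist (g k) l) \<longlongrightarrow> 0) sequentially"
      by (rule tendsto_sandwich[OF _ _ tendsto_const LIMSEQ_inverse_real_of_nat])
        (use that less_imp_le in \<open>auto intro!: always_eventually\<close>)
    then show ?thesis using tendsto_dist_iff by blast
  qed
  have "entries_tendsto m n f P sequentially"
    unfolding entries_tendsto_def using P f by (auto intro!: lim)
  then show thesis using that f(1) by blast
qed

lemma entries_tendsto_act:
  assumes f: "entries_tendsto m n f P F" and S: "S \<in> carrier_mat m m" and R: "R \<in> carrier_mat n n"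
  shows "entries_tendsto m n (\<lambda>x. act S (f x) R) (act S P R) F"
proof -
  have *: "((\<lambda>x. (S * g x * R) $$ (i, j)) \<longlongrightarrow> (S * A * R) $$ (i, j)) F"
    if "i < m" "j < n" "\<And>x. g x \<in> carrier_mat m n" "A \<in> carrier_mat m n"
      "\<And>i j. i < m \<Longrightarrow> j < n \<Longrightarrow> ((\<lambda>x. g x $$ (i, j)) \<longlongrightarrow> A $$ (i, j)) F" for g A i j
  proof -
    have e: "(S * B * R) $$ (i, j) = (\<Sum>b<n. (\<Sum>a<m. S $$ (i, a) * B $$ (a, b)) * R $$ (b, j))"
      if "B \<in> carrier_mat m n" for B
      using that \<open>i < m\<close> \<open>j < n\<close> S R
      by (simp add: scalar_prod_def atLeast0LessThan del: assoc_mult_mat)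
    show ?thesis unfolding e[OF that(3)] e[OF that(4)]
      by (intro tendsto_intros that(5)) auto
  qed
  have c: "S * A * R \<in> carrier_mat m n" if "A \<in> carrier_mat m n" for A using S R that by auto
  show ?thesis using assms unfolding entries_tendsto_def
    by (auto simp: act_def pairs_def mem_Times_iff simp del: index_mult_mat assoc_mult_mat intro!: * c)
qed

text \<open>Multiplication by fixed invertible matrices is continuous and maps the orbit into
  itself, hence also its closure. Inclusion of a whole orbit in a closure thus reduces to membership
  of one representative.\<close>

lemma closure_act:
  assumes "P \<in> pair_space m n closure_of orbit Q" "Q \<in> pairs m n"
    "mutual_inverse m S S'" "mutual_inverse n R R'"
  shows "act S P R \<in> pair_space m n closure_of orbit Q"
proof -
  obtain f where f: "entries_tendsto m n f P sequentially" "\<And>k. f k \<in> orbit Q"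
    using closure_sequence[OF assms(1)] by blast
  have "act S (f k) R \<in> orbit Q" for k
    using f(2)[of k] pair_equiv_trans[OF assms(2)] pair_equivI[OF _ assms(3,4), of "f k"]
      pair_equiv_in_pairs[OF assms(2)] by (auto simp: orbit_def)
  moreover have "entries_tendsto m n (\<lambda>k. act S (f k) R) (act S P R) sequentially"
    using assms(3,4) by (intro entries_tendsto_act f(1)) (auto simp: mutual_inverse_def)
  ultimately show ?thesis
    by (intro closure_of_limit[of m n _ _ sequentially]) auto
qed

lemma orbit_le_iff:
  assumes "P \<in> pairs m n" "Q \<in> pairs m n"
  shows "orbit_le P Q \<longleftrightarrow> P \<in> pair_space m n closure_of orbit Q"
proof -
  have "orbit P \<subseteq> pair_space m n closure_of orbit Q" if "P \<in> pair_space m n closure_of orbit Q"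
    using closure_act[OF that assms(2)] assms(1) by (auto simp: orbit_def pair_equiv_iff)
  moreover have "P \<in> orbit P" using pair_equiv_refl[OF assms(1)] by (simp add: orbit_def)
  ultimately show ?thesis
    using pairs_dims[OF assms(2)] unfolding orbit_le_def by auto
qed

lemma orbit_le_in_pairs:
  assumes "P \<in> pairs m n" "Q \<in> pairs m' n'" "orbit_le P Q"
  shows "m = m' \<and> n = n'"
proof -
  have "P \<in> orbit P" using pair_equiv_refl[OF assms(1)] by (simp add: orbit_def)
  then have "P \<in> pair_space m' n' closure_of orbit Q"
    using assms(3) pairs_dims[OF assms(2)] unfolding orbit_le_def by auto
  then have "P \<in> pairs m' n'" by (simp add: in_closure_of topspace_pair_space)
  then show ?thesis using assms(1) by (auto simp: pairs_def)
qed

lemma orbit_le_trans: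
  assumes "P \<in> pairs m n" "Q \<in> pairs m n" "T \<in> pairs m n" "orbit_le P Q" "orbit_le Q T"
  shows "orbit_le P T"
proof -
  have "P \<in> pair_space m n closure_of orbit Q" using assms orbit_le_iff by blast
  moreover have "orbit Q \<subseteq> pair_space m n closure_of orbit T"
    using assms(5) pairs_dims[OF assms(3)] by (simp add: orbit_le_def)
  ultimately have "P \<in> pair_space m n closure_of (pair_space m n closure_of orbit T)"
    using closure_of_mono by blast
  then show ?thesis using orbit_le_iff[OF assms(1,3)] by simp
qed

lemma orbit_le_of_equiv: "P \<in> pairs m n \<Longrightarrow> pair_equiv P Q \<Longrightarrow> orbit_le P Q"
proof -
  assume a: "P \<in> pairs m n" "pair_equiv P Q"
  have "P \<in> pair_space m n closure_of orbit Q"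
    by (rule closure_of_limit[of m n "\<lambda>_. P" _ sequentially])
      (use a pair_equiv_sym in \<open>auto simp: entries_tendsto_def orbit_def\<close>)
  then show "orbit_le P Q" using orbit_le_iff a pair_equiv_in_pairs by blast
qed

section \<open>Direct sums and transposes of pairs\<close>

definition oplus :: "mat_pair \<Rightarrow> mat_pair \<Rightarrow> mat_pair" where
  "oplus P Q = (diag_block (fst P) (fst Q), diag_block (snd P) (snd Q))"

lemma diag_block_carrier [intro]:
  "A \<in> carrier_mat m n \<Longrightarrow> B \<in> carrier_mat p q \<Longrightarrow> diag_block A B \<in> carrier_mat (m + p) (n + q)"
  by (auto simp: diag_block_def)

lemma oplus_in_pairs [intro]:
  "P \<in> pairs m n \<Longrightarrow> Q \<in> pairs p q \<Longrightarrow> oplus P Q \<in> pairs (m + p) (n + q)"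
  by (auto simp: pairs_def oplus_def)

lemma diag_block_mult:
  assumes "A \<in> carrier_mat m n" "A' \<in> carrier_mat n k" "B \<in> carrier_mat p q" "B' \<in> carrier_mat q r"
  shows "diag_block A B * diag_block A' B' = diag_block (A * A') (B * B')"
proof -
  have "diag_block A B * diag_block A' B' =
    four_block_mat A (0\<^sub>m m q) (0\<^sub>m p n) B * four_block_mat A' (0\<^sub>m n r) (0\<^sub>m q k) B'"
    using assms by (simp add: diag_block_def)
  also have "\<dots> = four_block_mat (A * A' + 0\<^sub>m m q * 0\<^sub>m q k) (A * 0\<^sub>m n r + 0\<^sub>m m q * B')
      (0\<^sub>m p n * A' + B * 0\<^sub>m q k) (0\<^sub>m p n * 0\<^sub>m n r + B * B')"
    by (rule mult_four_block_mat) (use assms in auto)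
  also have "\<dots> = diag_block (A * A') (B * B')"
    using assms by (simp add: diag_block_def)
  finally show ?thesis .
qed

lemma diag_block_one: "diag_block (1\<^sub>m m) (1\<^sub>m n) = 1\<^sub>m (m + n)"
  by (rule eq_matI) (auto simp: diag_block_def)

lemma mutual_inverse_diag_block:
  assumes "mutual_inverse m S S'" "mutual_inverse n T T'"
  shows "mutual_inverse (m + n) (diag_block S T) (diag_block S' T')"
  using assms unfolding mutual_inverse_def
  by (auto simp: diag_block_mult[of _ m m _ m _ n n _ n] diag_block_one)

lemma act_oplus:
  assumes "P \<in> pairs m n" "Q \<in> pairs p q" "S \<in> carrier_mat m m" "R \<in> carrier_mat n n"
    "T \<in> carrier_mat p p" "U \<in> carrier_mat q q"
  shows "act (diag_block S T) (oplus P Q) (diag_block R U) = oplus (act S P R) (act T Q U)"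
proof -
  have "diag_block S T * diag_block A B * diag_block R U = diag_block (S * A * R) (T * B * U)"
    if "A \<in> carrier_mat m n" "B \<in> carrier_mat p q" for A B
    using assms that
    by (simp add: diag_block_mult[of _ m m _ n _ p p _ q] diag_block_mult[of _ m n _ n _ p q _ q]
        del: assoc_mult_mat)
  then show ?thesis using assms
    by (cases P; cases Q) (simp add: act_def oplus_def pairs_iff del: assoc_mult_mat)
qed

lemma pair_equiv_oplus:
  assumes "P \<in> pairs m n" "Q \<in> pairs p q" "pair_equiv P P'" "pair_equiv Q Q'"
  shows "pair_equiv (oplus P Q) (oplus P' Q')"
proof -
  obtain S S' R R' where *: "mutual_inverse m S S'" "mutual_inverse n R R'" "P' = act S P R"
    using assms pair_equiv_iff by blast
  obtain T T' U U' where **: "mutual_inverse p T T'" "mutual_inverse q U U'" "Q' = act T Q U"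
    using assms pair_equiv_iff by blast
  have "oplus P' Q' = act (diag_block S T) (oplus P Q) (diag_block R U)"
    using act_oplus[OF assms(1,2)] * ** by (simp add: mutual_inverse_def)
  then show ?thesis
    using pair_equivI[OF oplus_in_pairs[OF assms(1,2)] mutual_inverse_diag_block[OF *(1) **(1)]
      mutual_inverse_diag_block[OF *(2) **(2)]] by simp
qed

section \<open>Permutation of direct summands\<close>

definition swap_mat :: "nat \<Rightarrow> nat \<Rightarrow> complex mat" where
  "swap_mat m n = four_block_mat (0\<^sub>m m n) (1\<^sub>m m) (1\<^sub>m n) (0\<^sub>m n m)"

lemma swap_mat_carrier: "swap_mat m n \<in> carrier_mat (m + n) (m + n)"
  by (rule carrier_matI) (simp_all add: swap_mat_def)

lemma swap_mat_mult: "swap_mat m n * swap_mat n m = 1\<^sub>m (m + n)"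
proof -
  have "swap_mat m n * swap_mat n m = four_block_mat (0\<^sub>m m n * 0\<^sub>m n m + 1\<^sub>m m * 1\<^sub>m m)
      (0\<^sub>m m n * 1\<^sub>m n + 1\<^sub>m m * 0\<^sub>m m n) (1\<^sub>m n * 0\<^sub>m n m + 0\<^sub>m n m * 1\<^sub>m m) (1\<^sub>m n * 1\<^sub>m n + 0\<^sub>m n m * 0\<^sub>m m n)"
    unfolding swap_mat_def by (rule mult_four_block_mat) auto
  also have "\<dots> = diag_block (1\<^sub>m m) (1\<^sub>m n)" by (simp add: diag_block_def)
  finally show ?thesis by (simp add: diag_block_one)
qed

lemma mutual_inverse_swap_mat: "mutual_inverse (m + n) (swap_mat m n) (swap_mat n m)"
  using swap_mat_mult[of m n] swap_mat_mult[of n m] swap_mat_carrier[of m n] swap_mat_carrier[of n m]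
  by (simp add: mutual_inverse_def add.commute)

lemma diag_block_swap:
  assumes "A \<in> carrier_mat m n" "B \<in> carrier_mat p q"
  shows "swap_mat p m * diag_block A B * swap_mat n q = diag_block B A"
proof -
  have "swap_mat p m * diag_block A B = four_block_mat (0\<^sub>m p m) (1\<^sub>m p) (1\<^sub>m m) (0\<^sub>m m p)
      * four_block_mat A (0\<^sub>m m q) (0\<^sub>m p n) B"
    using assms by (simp add: diag_block_def swap_mat_def)
  also have "\<dots> = four_block_mat (0\<^sub>m p m * A + 1\<^sub>m p * 0\<^sub>m p n) (0\<^sub>m p m * 0\<^sub>m m q + 1\<^sub>m p * B)
      (1\<^sub>m m * A + 0\<^sub>m m p * 0\<^sub>m p n) (1\<^sub>m m * 0\<^sub>m m q + 0\<^sub>m m p * B)"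
    by (rule mult_four_block_mat) (use assms in auto)
  also have "\<dots> = four_block_mat (0\<^sub>m p n) B A (0\<^sub>m m q)"
    using assms by simp
  finally have "swap_mat p m * diag_block A B * swap_mat n q =
      four_block_mat (0\<^sub>m p n) B A (0\<^sub>m m q) * four_block_mat (0\<^sub>m n q) (1\<^sub>m n) (1\<^sub>m q) (0\<^sub>m q n)"
    by (simp add: swap_mat_def)
  also have "\<dots> = four_block_mat (0\<^sub>m p n * 0\<^sub>m n q + B * 1\<^sub>m q) (0\<^sub>m p n * 1\<^sub>m n + B * 0\<^sub>m q n)
      (A * 0\<^sub>m n q + 0\<^sub>m m q * 1\<^sub>m q) (A * 1\<^sub>m n + 0\<^sub>m m q * 0\<^sub>m q n)"
    by (rule mult_four_block_mat) (use assms in auto)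
  also have "\<dots> = diag_block B A"
    using assms by (simp add: diag_block_def)
  finally show ?thesis .
qed

lemma oplus_commute:
  assumes "P \<in> pairs m n" "Q \<in> pairs p q"
  shows "pair_equiv (oplus P Q) (oplus Q P)"
proof -
  have "oplus Q P = act (swap_mat p m) (oplus P Q) (swap_mat n q)"
    using assms by (auto simp: act_def oplus_def pairs_def diag_block_swap)
  then show ?thesis
    using pair_equivI[OF oplus_in_pairs[OF assms], of "swap_mat p m" "swap_mat m p" "swap_mat n q" "swap_mat q n"]
      mutual_inverse_swap_mat[of p m] mutual_inverse_swap_mat[of n q]
    by (simp add: add.commute)
qed

fun nrows :: "summand \<Rightarrow> nat" where
  "nrows (SL n) = n - 1" | "nrows (SLT n) = n" | "nrows (SD n \<mu>) = n"

fun ncols :: "summand \<Rightarrow> nat" where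
  "ncols (SL n) = n" | "ncols (SLT n) = n - 1" | "ncols (SD n \<mu>) = n"

definition total_rows :: "summand list \<Rightarrow> nat" where
  "total_rows ss = sum_list (map nrows ss)"

definition total_cols :: "summand list \<Rightarrow> nat" where
  "total_cols ss = sum_list (map ncols ss)"

lemma total_simps [simp]:
  "total_rows [] = 0" "total_rows (s # ss) = nrows s + total_rows ss"
  "total_rows (xs @ ys) = total_rows xs + total_rows ys"
  "total_cols [] = 0" "total_cols (s # ss) = ncols s + total_cols ss"
  "total_cols (xs @ ys) = total_cols xs + total_cols ys"
  by (simp_all add: total_rows_def total_cols_def)

lemma L_mat_carrier: "L_mat n \<in> carrier_mat (n - 1) n" and R_mat_carrier: "R_mat n \<in> carrier_mat (n - 1) n"
  by (simp_all add: L_mat_def R_mat_def)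

lemma summand_pair_in_pairs: "summand_pair s \<in> pairs (nrows s) (ncols s)"
  by (cases s rule: summand_pair.cases) (auto simp: pairs_def L_mat_carrier R_mat_carrier simp del: One_nat_def)

lemma kronecker_pair_Nil: "kronecker_pair [] = (0\<^sub>m 0 0, 0\<^sub>m 0 0)"
  by (simp add: kronecker_pair_def)

lemma kronecker_pair_Cons: "kronecker_pair (s # ss) = oplus (summand_pair s) (kronecker_pair ss)"
  by (simp add: kronecker_pair_def oplus_def diag_block_def Let_def)

lemma kronecker_pair_append: "kronecker_pair (xs @ ys) = oplus (kronecker_pair xs) (kronecker_pair ys)"
  by (simp add: kronecker_pair_def oplus_def diag_block_def diag_block_mat_append Let_def)

lemma kronecker_pair_singleton: "kronecker_pair [s] = summand_pair s"
  by (simp add: kronecker_pair_def del: diag_block_mat.simps)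

lemma kronecker_pair_in_pairs: "kronecker_pair ss \<in> pairs (total_rows ss) (total_cols ss)"
  by (induction ss)
    (auto simp: kronecker_pair_Nil kronecker_pair_Cons pairs_iff intro: summand_pair_in_pairs)

lemma kronecker_pair_permute:
  "mset xs = mset ys \<Longrightarrow> pair_equiv (kronecker_pair xs) (kronecker_pair ys)"
proof (induction xs arbitrary: ys)
  case Nil
  then show ?case using pair_equiv_refl[OF kronecker_pair_in_pairs] by simp
next
  case (Cons s xs)
  then obtain us vs where ys: "ys = us @ s # vs" by (metis list.set_intros(1) mset_eq_setD split_list)
  have P: "kronecker_pair zs \<in> pairs (total_rows zs) (total_cols zs)" for zs
    by (rule kronecker_pair_in_pairs)
  note s = summand_pair_in_pairs[of s]
  have "pair_equiv (kronecker_pair xs) (kronecker_pair (us @ vs))"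
    using Cons ys by simp
  then have 1: "pair_equiv (kronecker_pair (s # xs)) (kronecker_pair (s # us @ vs))"
    unfolding kronecker_pair_Cons using pair_equiv_oplus[OF s P pair_equiv_refl[OF s]] by blast
  \<comment> \<open>The head is moved past \<open>us\<close> as one commutation of two direct
    summands.\<close>
  have "pair_equiv (kronecker_pair ([s] @ us)) (kronecker_pair (us @ [s]))"
    unfolding kronecker_pair_append by (rule oplus_commute[OF P P])
  then have 2: "pair_equiv (kronecker_pair (([s] @ us) @ vs)) (kronecker_pair ((us @ [s]) @ vs))"
    unfolding kronecker_pair_append[of _ vs] using pair_equiv_oplus[OF P P _ pair_equiv_refl[OF P]] by blast
  show ?case using pair_equiv_trans[OF P 1] 2 ys by simp
qed

lemma entries_tendsto_const: "P \<in> pairs m n \<Longrightarrow> entries_tendsto m n (\<lambda>_. P) P F"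
  by (simp add: entries_tendsto_def)

lemma entries_tendsto_oplus:
  assumes "entries_tendsto m n f P F" "entries_tendsto p q g Q F"
  shows "entries_tendsto (m + p) (n + q) (\<lambda>x. oplus (f x) (g x)) (oplus P Q) F"
proof -
  have *: "((\<lambda>x. diag_block (f x) (g x) $$ (i, j)) \<longlongrightarrow> diag_block A B $$ (i, j)) F"
    if "i < m + p" "j < n + q" "\<And>x. f x \<in> carrier_mat m n" "\<And>x. g x \<in> carrier_mat p q"
      "A \<in> carrier_mat m n" "B \<in> carrier_mat p q"
      "\<And>i j. i < m \<Longrightarrow> j < n \<Longrightarrow> ((\<lambda>x. f x $$ (i, j)) \<longlongrightarrow> A $$ (i, j)) F"
      "\<And>i j. i < p \<Longrightarrow> j < q \<Longrightarrow> ((\<lambda>x. g x $$ (i, j)) \<longlongrightarrow> B $$ (i, j)) F"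
    for i j A B and f g :: "'a \<Rightarrow> complex mat"
  proof -
    have e: "diag_block A B $$ (i, j) = (if i < m then if j < n then A $$ (i, j) else 0
        else if j < n then 0 else B $$ (i - m, j - n))"
      if "A \<in> carrier_mat m n" "B \<in> carrier_mat p q" for A B
      using that \<open>i < m + p\<close> \<open>j < n + q\<close> by (auto simp: diag_block_def)
    have "((\<lambda>x. if i < m then if j < n then f x $$ (i, j) else 0
        else if j < n then 0 else g x $$ (i - m, j - n)) \<longlongrightarrow> (if i < m then if j < n then A $$ (i, j) else 0
        else if j < n then 0 else B $$ (i - m, j - n))) F"
      using that by auto
    then show ?thesis using that by (simp only: e)
  qed
  show ?thesis using assms unfolding entries_tendsto_def
    by (auto simp: oplus_def mem_Times_iff pairs_def intro!: *)
qed

lemma orbit_le_of_perturbation: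
  assumes lim: "entries_tendsto m n V P (at 0)" and eq: "\<And>\<epsilon>. (\<epsilon> :: complex) \<noteq> 0 \<Longrightarrow> pair_equiv (V \<epsilon>) Q"
  shows "orbit_le P Q \<and> Q \<in> pairs m n"
proof -
  have V: "V \<epsilon> \<in> pairs m n" for \<epsilon> using lim by (simp add: entries_tendsto_def)
  have Q: "Q \<in> pairs m n" using pair_equiv_in_pairs[OF V eq[of 1]] by simp
  have "P \<in> pair_space m n closure_of orbit Q"
  proof (rule closure_of_limit[OF lim])
    show "\<forall>\<^sub>F \<epsilon> in at 0. V \<epsilon> \<in> orbit Q"
      unfolding eventually_at by (rule exI[of _ 1]) (use eq pair_equiv_sym[OF V] in \<open>auto simp: orbit_def\<close>)
  qed simp
  moreover have "P \<in> pairs m n" using lim by (simp add: entries_tendsto_def)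
  ultimately show ?thesis using orbit_le_iff[OF _ Q] Q by simp
qed

section \<open>Transposition of pairs\<close>

definition transpose_pair :: "mat_pair \<Rightarrow> mat_pair" where
  "transpose_pair P = ((fst P)\<^sup>T, (snd P)\<^sup>T)"

lemma transpose_pair_in_pairs [intro]: "P \<in> pairs m n \<Longrightarrow> transpose_pair P \<in> pairs n m"
  by (auto simp: pairs_def transpose_pair_def)

lemma transpose_pair_oplus:
  "P \<in> pairs m n \<Longrightarrow> Q \<in> pairs p q \<Longrightarrow> transpose_pair (oplus P Q) = oplus (transpose_pair P) (transpose_pair Q)"
  by (auto simp: transpose_pair_def oplus_def diag_block_def pairs_def
      transpose_four_block_mat[of _ m n _ q _ p])

lemma mutual_inverse_transpose:
  assumes "mutual_inverse n S S'"
  shows "mutual_inverse n S\<^sup>T S'\<^sup>T"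
proof -
  have S: "S \<in> carrier_mat n n" "S' \<in> carrier_mat n n" using assms by (auto simp: mutual_inverse_def)
  have "S\<^sup>T * S'\<^sup>T = 1\<^sub>m n" "S'\<^sup>T * S\<^sup>T = 1\<^sub>m n"
    unfolding transpose_mult[OF S, symmetric] transpose_mult[OF S(2,1), symmetric]
    using assms by (simp_all add: mutual_inverse_def transpose_one)
  then show ?thesis using S by (simp add: mutual_inverse_def)
qed

lemma transpose_pair_act:
  assumes "P \<in> pairs m n" "S \<in> carrier_mat m m" "R \<in> carrier_mat n n"
  shows "transpose_pair (act S P R) = act R\<^sup>T (transpose_pair P) S\<^sup>T"
proof -
  have "(S * A * R)\<^sup>T = R\<^sup>T * A\<^sup>T * S\<^sup>T" if "A \<in> carrier_mat m n" for A
  proof -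
    have "(S * A * R)\<^sup>T = R\<^sup>T * (S * A)\<^sup>T" by (rule transpose_mult) (use that assms in auto)
    also have "(S * A)\<^sup>T = A\<^sup>T * S\<^sup>T" by (rule transpose_mult) (use that assms in auto)
    also have "R\<^sup>T * (A\<^sup>T * S\<^sup>T) = R\<^sup>T * A\<^sup>T * S\<^sup>T"
      by (rule assoc_mult_mat[symmetric, of _ n n _ m _ m]) (use that assms in auto)
    finally show ?thesis .
  qed
  then show ?thesis using assms
    by (cases P) (simp add: act_def transpose_pair_def pairs_iff del: assoc_mult_mat)
qed

lemma pair_equiv_transpose:
  assumes "P \<in> pairs m n" "pair_equiv P Q"
  shows "pair_equiv (transpose_pair P) (transpose_pair Q)"
proof -
  obtain S S' R R' where *: "mutual_inverse m S S'" "mutual_inverse n R R'" "Q = act S P R"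
    using assms pair_equiv_iff by blast
  then have "transpose_pair Q = act R\<^sup>T (transpose_pair P) S\<^sup>T"
    using transpose_pair_act[OF assms(1)] by (simp add: mutual_inverse_def)
  then show ?thesis
    using pair_equivI[OF transpose_pair_in_pairs[OF assms(1)] mutual_inverse_transpose[OF *(2)]
      mutual_inverse_transpose[OF *(1)]] by simp
qed

lemma entries_tendsto_transpose:
  "entries_tendsto m n f P F \<Longrightarrow> entries_tendsto n m (\<lambda>x. transpose_pair (f x)) (transpose_pair P) F"
proof -
  assume f: "entries_tendsto m n f P F"
  have e: "fst (transpose_pair Q) $$ (i, j) = fst Q $$ (j, i)" "snd (transpose_pair Q) $$ (i, j) = snd Q $$ (j, i)"
    if "Q \<in> pairs m n" "i < n" "j < m" for Q i j
    using that by (auto simp: pairs_def transpose_pair_def)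
  have P: "P \<in> pairs m n" "\<And>x. f x \<in> pairs m n" using f by (auto simp: entries_tendsto_def)
  show ?thesis unfolding entries_tendsto_def
  proof (intro conjI allI impI)
    fix i j assume ij: "i < n" "j < m"
    show "((\<lambda>x. fst (transpose_pair (f x)) $$ (i, j)) \<longlongrightarrow> fst (transpose_pair P) $$ (i, j)) F"
      "((\<lambda>x. snd (transpose_pair (f x)) $$ (i, j)) \<longlongrightarrow> snd (transpose_pair P) $$ (i, j)) F"
      unfolding e[OF P(1) ij] e[OF P(2) ij] using f ij by (auto simp: entries_tendsto_def)
  qed (use P in auto)
qed

lemma orbit_le_transpose:
  assumes P: "P \<in> pairs m n" and Q: "Q \<in> pairs m n" and le: "orbit_le P Q"
  shows "orbit_le (transpose_pair P) (transpose_pair Q)"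
proof -
  obtain f where f: "entries_tendsto m n f P sequentially" "\<And>k. f k \<in> orbit Q"
    using closure_sequence le orbit_le_iff[OF P Q] by blast
  have "transpose_pair P \<in> pair_space n m closure_of orbit (transpose_pair Q)"
    by (rule closure_of_limit[OF entries_tendsto_transpose[OF f(1)]])
      (use f(2) pair_equiv_transpose[OF Q] in \<open>auto simp: orbit_def\<close>)
  then show ?thesis using orbit_le_iff P Q by blast
qed

fun dual :: "summand \<Rightarrow> summand" where
  "dual (SL n) = SLT n" | "dual (SLT n) = SL n" | "dual (SD n \<mu>) = SD n \<mu>"

text \<open>The reversal permutation. It conjugates the transpose of a Jordan block back to the
  Jordan block, which makes the eigenvalue summands self-dual.\<close>

definition flip_mat :: "nat \<Rightarrow> complex mat" where
  "flip_mat n = mat n n (\<lambda>(i, j). if i + j + 1 = n then 1 else 0)"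

lemma flip_mat_carrier [simp]: "flip_mat n \<in> carrier_mat n n"
  by (simp add: flip_mat_def)

lemma dim_flip_mat [simp]: "dim_row (flip_mat n) = n" "dim_col (flip_mat n) = n"
  by (simp_all add: flip_mat_def)

lemma flip_mat_mult_left:
  assumes "A \<in> carrier_mat n k"
  shows "flip_mat n * A = mat n k (\<lambda>(i, j). A $$ (n - 1 - i, j))"
proof (rule eq_matI)
  fix i j assume ij: "i < dim_row (mat n k (\<lambda>(i, j). A $$ (n - 1 - i, j)))"
    "j < dim_col (mat n k (\<lambda>(i, j). A $$ (n - 1 - i, j)))"
  then have "(flip_mat n * A) $$ (i, j) = (\<Sum>a<n. (if a = n - 1 - i then 1 else 0) * A $$ (a, j))"
    using assms by (auto simp: flip_mat_def scalar_prod_def atLeast0LessThan intro!: sum.cong)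
  then show "(flip_mat n * A) $$ (i, j) = mat n k (\<lambda>(i, j). A $$ (n - 1 - i, j)) $$ (i, j)"
    using ij by (simp add: if_distrib[of "\<lambda>x. x * _"] cong: if_cong)
qed (use assms in auto)

lemma flip_mat_transpose: "(flip_mat n)\<^sup>T = flip_mat n"
  by (rule eq_matI) (auto simp: flip_mat_def add.commute)

lemma flip_mat_mult_right:
  assumes "A \<in> carrier_mat k n"
  shows "A * flip_mat n = mat k n (\<lambda>(i, j). A $$ (i, n - 1 - j))"
proof -
  have "(A * flip_mat n)\<^sup>T = flip_mat n * A\<^sup>T"
    using assms flip_mat_transpose[of n] by (metis flip_mat_carrier transpose_mult)
  also have "\<dots> = mat n k (\<lambda>(i, j). A\<^sup>T $$ (n - 1 - i, j))"
    by (rule flip_mat_mult_left) (use assms in simp)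
  finally have "A * flip_mat n = (mat n k (\<lambda>(i, j). A\<^sup>T $$ (n - 1 - i, j)))\<^sup>T"
    by (metis transpose_transpose)
  also have "\<dots> = mat k n (\<lambda>(i, j). A $$ (i, n - 1 - j))"
    using assms by (intro eq_matI) auto
  finally show ?thesis .
qed

lemma mutual_inverse_flip_mat: "mutual_inverse n (flip_mat n) (flip_mat n)"
proof -
  have "flip_mat n * flip_mat n = 1\<^sub>m n"
    by (subst flip_mat_mult_left[OF flip_mat_carrier], rule eq_matI) (auto simp: flip_mat_def)
  then show ?thesis by (simp add: mutual_inverse_def)
qed

lemma flip_jordan_block: "flip_mat n * (jordan_block n a)\<^sup>T * flip_mat n = jordan_block n a"
  by (subst flip_mat_mult_left[of _ _ n], simp, subst flip_mat_mult_right[of _ n], simp)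
    (rule eq_matI, auto simp: jordan_block_index)

lemma flip_one: "flip_mat n * 1\<^sub>m n * flip_mat n = 1\<^sub>m n"
  using mutual_inverse_flip_mat[of n] right_mult_one_mat[OF flip_mat_carrier]
  by (simp add: mutual_inverse_def del: assoc_mult_mat)

lemma dual_equiv: "pair_equiv (transpose_pair (summand_pair s)) (summand_pair (dual s))"
proof (cases s rule: summand_pair.cases)
  case (1 n)
  then show ?thesis
    using pair_equiv_refl[OF transpose_pair_in_pairs[OF summand_pair_in_pairs[of s]]]
    by (simp add: transpose_pair_def)
next
  case (2 n)
  then show ?thesis
    using pair_equiv_refl[OF transpose_pair_in_pairs[OF summand_pair_in_pairs[of s]]]
    by (simp add: transpose_pair_def)
next
  case (3 n a)
  have "summand_pair s = act (flip_mat n) (transpose_pair (summand_pair s)) (flip_mat n)"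
    using flip_jordan_block[of n a] flip_one[of n] by (simp add: 3 act_def transpose_pair_def)
  then show ?thesis
    using pair_equivI[OF transpose_pair_in_pairs[OF summand_pair_in_pairs[of s]],
        of "flip_mat n" "flip_mat n" "flip_mat n" "flip_mat n"] mutual_inverse_flip_mat[of n]
    by (simp add: 3)
next
  case (4 n)
  have "summand_pair s = act (flip_mat n) (transpose_pair (summand_pair s)) (flip_mat n)"
    using flip_jordan_block[of n 0] flip_one[of n] by (simp add: 4 act_def transpose_pair_def)
  then show ?thesis
    using pair_equivI[OF transpose_pair_in_pairs[OF summand_pair_in_pairs[of s]],
        of "flip_mat n" "flip_mat n" "flip_mat n" "flip_mat n"] mutual_inverse_flip_mat[of n]
    by (simp add: 4)
qed

lemma transpose_kronecker_pair:
  "pair_equiv (transpose_pair (kronecker_pair ss)) (kronecker_pair (map dual ss))"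
proof (induction ss)
  case Nil
  have "transpose_pair (kronecker_pair []) = kronecker_pair []"
    by (simp add: kronecker_pair_Nil transpose_pair_def)
  then show ?case using pair_equiv_refl[OF kronecker_pair_in_pairs[of "[]"]] by simp
next
  case (Cons s ss)
  have "transpose_pair (kronecker_pair (s # ss)) =
      oplus (transpose_pair (summand_pair s)) (transpose_pair (kronecker_pair ss))"
    unfolding kronecker_pair_Cons by (rule transpose_pair_oplus[OF summand_pair_in_pairs kronecker_pair_in_pairs])
  then show ?case
    using pair_equiv_oplus[OF transpose_pair_in_pairs[OF summand_pair_in_pairs]
      transpose_pair_in_pairs[OF kronecker_pair_in_pairs] dual_equiv Cons.IH]
    by (simp add: kronecker_pair_Cons)
qed

section \<open>Semicontinuity of solution spaces\<close>

lemma vec_nonzero_entry: "v \<in> carrier_vec n \<Longrightarrow> v \<noteq> 0\<^sub>v n \<Longrightarrow> \<exists>i<n. v $ i \<noteq> 0"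
  by (rule ccontr) (auto simp: vec_eq_iff)

lemma nontrivial_solution:
  fixes M :: "'j \<Rightarrow> 'i \<Rightarrow> complex"
  assumes "finite I" "finite J" "card J < card I"
  shows "\<exists>x. (\<exists>i\<in>I. x i \<noteq> 0) \<and> (\<forall>j\<in>J. (\<Sum>i\<in>I. M j i * x i) = 0)"
proof -
  define N where "N = card I"
  obtain g where g: "bij_betw g {..<card J} J"
    using ex_bij_betw_nat_finite[OF assms(2)] by (auto simp: atLeast0LessThan)
  obtain h where h: "bij_betw h {..<N} I"
    using ex_bij_betw_nat_finite[OF assms(1)] by (auto simp: atLeast0LessThan N_def)
  \<comment> \<open>The system is padded with zero rows to a square matrix. Since
    \<open>card J < N\<close>, the last row is zero and the determinant vanishes.\<close>
  define A where "A = mat N N (\<lambda>(r, c). if r < card J then M (g r) (h c) else 0)"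
  have A: "A \<in> carrier_mat N N" by (simp add: A_def)
  have N: "card J \<le> N - 1" "N - 1 < N" using assms(3) by (auto simp: N_def)
  have "det A\<^sup>T = 0"
  proof -
    have "A\<^sup>T *\<^sub>v unit_vec N (N - 1) = 0\<^sub>v N"
      by (rule eq_vecI) (use N in \<open>auto simp: A_def\<close>)
    moreover have "unit_vec N (N - 1) \<noteq> (0\<^sub>v N :: complex vec)"
      using N by simp
    moreover have "A\<^sup>T \<in> carrier_mat N N" using A by simp
    ultimately show ?thesis using det_0_iff_vec_prod_zero[of "A\<^sup>T" N] unit_vec_carrier by blast
  qed
  then have "det A = 0" using det_transpose[OF A] by simp
  then obtain v where v: "v \<in> carrier_vec N" "v \<noteq> 0\<^sub>v N" "A *\<^sub>v v = 0\<^sub>v N"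
    using det_0_iff_vec_prod_zero[OF A] by blast
  define x where "x = (\<lambda>i. v $ (inv_into {..<N} h i))"
  have xh: "x (h c) = v $ c" if "c < N" for c
    using h that by (simp add: x_def bij_betw_inv_into_left)
  obtain c where c: "c < N" "v $ c \<noteq> 0"
    using vec_nonzero_entry[OF v(1,2)] by blast
  have "h c \<in> I" using bij_betwE[OF h] c(1) by blast
  then have "\<exists>i\<in>I. x i \<noteq> 0" using xh[OF c(1)] c(2) by (intro bexI[of _ "h c"]) simp_all
  moreover have "(\<Sum>i\<in>I. M j i * x i) = 0" if "j \<in> J" for j
  proof -
    have "j \<in> g ` {..<card J}" using that by (simp only: bij_betw_imp_surj_on[OF g])
    then obtain r where r: "r < card J" "j = g r" by blast
    have "(\<Sum>i\<in>I. M j i * x i) = (\<Sum>c<N. M j (h c) * x (h c))"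
      by (rule sum.reindex_bij_betw[OF h, symmetric])
    also have "\<dots> = (A *\<^sub>v v) $ r"
      using r N v(1) xh by (auto simp: A_def scalar_prod_def atLeast0LessThan intro!: sum.cong)
    finally show ?thesis using v(3) r N by simp
  qed
  ultimately show ?thesis by blast
qed

definition solutions :: "nat \<Rightarrow> nat \<Rightarrow> complex mat \<Rightarrow> complex mat \<Rightarrow> mat_pair \<Rightarrow> complex mat set" where
  "solutions n k X Y P = {V \<in> carrier_mat n k. fst P * V * X = snd P * V * Y}"

text \<open>A set of matrix positions that are coordinates on the solution space, so that its
  cardinality is the dimension of that space.\<close>
definition coordinates ::
  "nat \<Rightarrow> nat \<Rightarrow> complex mat \<Rightarrow> complex mat \<Rightarrow> mat_pair \<Rightarrow> (nat \<times> nat) set \<Rightarrow> bool" where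
  "coordinates n k X Y P Z \<longleftrightarrow> Z \<subseteq> {..<n} \<times> {..<k} \<and>
    (\<forall>V\<in>solutions n k X Y P. (\<forall>z\<in>Z. V $$ z = 0) \<longrightarrow> V = 0\<^sub>m n k) \<and>
    (\<forall>z\<in>Z. \<exists>W\<in>solutions n k X Y P. \<forall>z'\<in>Z. W $$ z' = (if z' = z then 1 else 0))"

text \<open>The coefficient of the unknown \<open>V $$ (a, j)\<close> in the entry
  \<open>(r, c)\<close> of \<open>A * V * X - B * V * Y\<close>, so that \<open>solutions\<close>
  becomes the kernel of an ordinary linear system.\<close>

definition equation_coeff ::
  "complex mat \<Rightarrow> complex mat \<Rightarrow> mat_pair \<Rightarrow> nat \<times> nat \<Rightarrow> nat \<times> nat \<Rightarrow> complex" where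
  "equation_coeff X Y P = (\<lambda>(r, c) (a, j). fst P $$ (r, a) * X $$ (j, c) - snd P $$ (r, a) * Y $$ (j, c))"

lemma solutions_iff:
  assumes P: "P \<in> pairs m n" and X: "X \<in> carrier_mat k l" and Y: "Y \<in> carrier_mat k l"
  shows "V \<in> solutions n k X Y P \<longleftrightarrow> V \<in> carrier_mat n k \<and>
    (\<forall>e\<in>{..<m} \<times> {..<l}. (\<Sum>z\<in>{..<n} \<times> {..<k}. equation_coeff X Y P e z * V $$ z) = 0)"
proof (cases "V \<in> carrier_mat n k")
  case V: True
  have e: "(A * V * T) $$ (r, c) = (\<Sum>a<n. \<Sum>j<k. A $$ (r, a) * T $$ (j, c) * V $$ (a, j))"
    if "A \<in> carrier_mat m n" "T \<in> carrier_mat k l" "r < m" "c < l" for A T r c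
  proof -
    have "(A * V * T) $$ (r, c) = (\<Sum>j<k. (\<Sum>a<n. A $$ (r, a) * V $$ (a, j)) * T $$ (j, c))"
      using that V by (simp add: scalar_prod_def atLeast0LessThan del: assoc_mult_mat)
    also have "\<dots> = (\<Sum>j<k. \<Sum>a<n. A $$ (r, a) * T $$ (j, c) * V $$ (a, j))"
      unfolding sum_distrib_right by (intro sum.cong) (auto simp: mult.assoc mult.commute)
    finally show ?thesis by (subst sum.swap)
  qed
  obtain A B where AB: "P = (A, B)" "A \<in> carrier_mat m n" "B \<in> carrier_mat m n"
    using P by (auto simp: pairs_def)
  have "(A * V * X) $$ (r, c) - (B * V * Y) $$ (r, c)
      = (\<Sum>z\<in>{..<n} \<times> {..<k}. equation_coeff X Y P (r, c) z * V $$ z)" if "r < m" "c < l" for r c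
    unfolding e[OF AB(2) X that] e[OF AB(3) Y that] sum.cartesian_product sum_subtractf[symmetric]
    by (intro sum.cong) (auto simp: equation_coeff_def AB(1) left_diff_distrib)
  note d = this
  have *: "(A * V * X) $$ (r, c) = (B * V * Y) $$ (r, c) \<longleftrightarrow>
      (\<Sum>z\<in>{..<n} \<times> {..<k}. equation_coeff X Y P (r, c) z * V $$ z) = 0" if "r < m" "c < l" for r c
    by (subst eq_iff_diff_eq_0[of "(A * V * X) $$ (r, c)"], subst d[OF that], rule refl)
  have d: "A * V * X \<in> carrier_mat m l" "B * V * Y \<in> carrier_mat m l" using AB V X Y by auto
  have "A * V * X = B * V * Y \<longleftrightarrow> (\<forall>r<m. \<forall>c<l. (A * V * X) $$ (r, c) = (B * V * Y) $$ (r, c))"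
  proof
    assume "\<forall>r<m. \<forall>c<l. (A * V * X) $$ (r, c) = (B * V * Y) $$ (r, c)"
    then show "A * V * X = B * V * Y"
      by (intro eq_matI) (simp_all only: carrier_matD[OF d(1)] carrier_matD[OF d(2)] simp_thms)
  qed simp
  then show ?thesis using V by (auto simp: solutions_def AB(1) *)
qed (auto simp: solutions_def)

lemma solutions_combination:
  assumes "P \<in> pairs m n" "X \<in> carrier_mat k l" "Y \<in> carrier_mat k l"
    and "\<And>i. i \<in> I \<Longrightarrow> W i \<in> solutions n k X Y P"
  shows "mat n k (\<lambda>z. \<Sum>i\<in>I. x i * W i $$ z) \<in> solutions n k X Y P"
  unfolding solutions_iff[OF assms(1-3)]
proof (intro conjI ballI)
  fix e assume e: "e \<in> {..<m} \<times> {..<l}"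
  let ?c = "equation_coeff X Y P e"
  have "(\<Sum>z\<in>{..<n} \<times> {..<k}. ?c z * mat n k (\<lambda>z. \<Sum>i\<in>I. x i * W i $$ z) $$ z)
      = (\<Sum>z\<in>{..<n} \<times> {..<k}. \<Sum>i\<in>I. x i * (?c z * W i $$ z))"
    by (intro sum.cong) (auto simp: sum_distrib_left mult.left_commute)
  also have "\<dots> = (\<Sum>i\<in>I. x i * (\<Sum>z\<in>{..<n} \<times> {..<k}. ?c z * W i $$ z))"
    unfolding sum_distrib_left by (rule sum.swap)
  also have "\<dots> = 0"
    using assms(4) e solutions_iff[OF assms(1-3)] by (intro sum.neutral) auto
  finally show "(\<Sum>z\<in>{..<n} \<times> {..<k}. ?c z * mat n k (\<lambda>z. \<Sum>i\<in>I. x i * W i $$ z) $$ z) = 0" .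
qed simp

text \<open>In \<open>S * A * R * (R' * W) * X\<close> the product \<open>R * R'\<close> cancels and
  \<open>S\<close> factors out on the left, because \<open>X\<close> and \<open>Y\<close> act from
  the other side.\<close>

lemma solutions_act:
  assumes P: "P \<in> pairs m n" and X: "X \<in> carrier_mat k l" and Y: "Y \<in> carrier_mat k l"
    and S: "S \<in> carrier_mat m m" and R: "mutual_inverse n R R'"
    and W: "W \<in> solutions n k X Y P"
  shows "R' * W \<in> solutions n k X Y (act S P R)"
proof -
  obtain A B where AB: "P = (A, B)" "A \<in> carrier_mat m n" "B \<in> carrier_mat m n"
    using P by (auto simp: pairs_def)
  have Wc: "W \<in> carrier_mat n k" "A * W * X = B * W * Y" using W by (auto simp: solutions_def AB)
  have Rc: "R \<in> carrier_mat n n" "R' \<in> carrier_mat n n" "R * R' = 1\<^sub>m n"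
    using R by (auto simp: mutual_inverse_def)
  have e: "S * C * R * (R' * W) * T = S * (C * W * T)"
    if C: "C \<in> carrier_mat m n" and T: "T \<in> carrier_mat k l" for C T
  proof -
    have "R * (R' * W) = R * R' * W" by (rule assoc_mult_mat[symmetric]) (use Rc Wc in auto)
    then have "R * (R' * W) = W" using Rc Wc by simp
    moreover have "S * C * R * (R' * W) = S * C * (R * (R' * W))"
      by (rule assoc_mult_mat) (use C S Rc Wc in auto)
    ultimately have "S * C * R * (R' * W) * T = S * C * W * T" by simp
    also have "S * C * W = S * (C * W)" by (rule assoc_mult_mat) (use C S Wc in auto)
    also have "S * (C * W) * T = S * (C * W * T)" by (rule assoc_mult_mat) (use C S Wc T in auto)
    finally show ?thesis .
  qed
  show ?thesis
    using e[OF AB(2) X] e[OF AB(3) Y] Wc Rc by (simp add: solutions_def act_def AB(1) del: assoc_mult_mat)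
qed

text \<open>The Gram matrix of the system, augmented by the coordinates in \<open>Z\<close>; it is singular exactly
  when some nonzero solution vanishes on \<open>Z\<close>. Positions \<open>(a, j)\<close> are numbered \<open>a * k + j\<close>.\<close>
definition gram_mat ::
  "nat \<Rightarrow> nat \<Rightarrow> nat \<Rightarrow> nat \<Rightarrow> complex mat \<Rightarrow> complex mat \<Rightarrow> (nat \<times> nat) set \<Rightarrow> mat_pair \<Rightarrow> complex mat" where
  "gram_mat m n k l X Y Z P = mat (n * k) (n * k) (\<lambda>(p, q).
    (\<Sum>e\<in>{..<m} \<times> {..<l}. cnj (equation_coeff X Y P e (p div k, p mod k)) *
      equation_coeff X Y P e (q div k, q mod k))
    + (if p = q \<and> (p div k, p mod k) \<in> Z then 1 else 0))"

lemma gram_mat_carrier: "gram_mat m n k l X Y Z P \<in> carrier_mat (n * k) (n * k)"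
  by (simp add: gram_mat_def)

lemma bij_betw_div_mod: "bij_betw (\<lambda>p. (p div k, p mod k)) {..<n * k} ({..<n} \<times> {..<k :: nat})"
proof (rule bij_betw_byWitness[where f' = "\<lambda>(a, j). a * k + j"])
  show "(\<lambda>(a, j). a * k + j) ` ({..<n} \<times> {..<k}) \<subseteq> {..<n * k}"
  proof clarsimp
    fix a j assume "a < n" "j < k"
    then have "a * k + j < Suc a * k" by simp
    also have "\<dots> \<le> n * k" using \<open>a < n\<close> by (intro mult_le_mono1) simp
    finally show "a * k + j < n * k" .
  qed
  show "(\<lambda>p. (p div k, p mod k)) ` {..<n * k} \<subseteq> {..<n} \<times> {..<k}"
  proof clarsimp
    fix p assume "p < n * k"
    moreover from this have "0 < k" by (cases k) auto
    ultimately show "p div k < n \<and> p mod k < k" by (simp add: less_mult_imp_div_less)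
  qed
qed auto

lemma gram_mat_det:
  assumes P: "P \<in> pairs m n" and X: "X \<in> carrier_mat k l" and Y: "Y \<in> carrier_mat k l"
  shows "det (gram_mat m n k l X Y Z P) = 0 \<longleftrightarrow>
    (\<exists>V\<in>solutions n k X Y P. (\<forall>z\<in>Z \<inter> {..<n} \<times> {..<k}. V $$ z = 0) \<and> V \<noteq> 0\<^sub>m n k)"
proof -
  let ?N = "n * k" and ?G = "gram_mat m n k l X Y Z P" and ?d = "\<lambda>p. (p div k, p mod k)"
  let ?E = "{..<m} \<times> {..<l}" and ?I = "{..<n} \<times> {..<k}"
  let ?c = "equation_coeff X Y P"
  note bij = bij_betw_div_mod[of k n]
  have reindex: "(\<Sum>p<?N. f (?d p)) = (\<Sum>z\<in>?I. f z)" for f :: "nat \<times> nat \<Rightarrow> complex"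
    by (rule sum.reindex_bij_betw[OF bij])
  have G: "(?G *\<^sub>v v) $ p = (\<Sum>e\<in>?E. cnj (?c e (?d p)) * (\<Sum>q<?N. ?c e (?d q) * v $ q))
      + (if ?d p \<in> Z then v $ p else 0)" if v: "v \<in> carrier_vec ?N" and p: "p < ?N" for v p
  proof -
    have "(?G *\<^sub>v v) $ p = (\<Sum>q<?N. (\<Sum>e\<in>?E. cnj (?c e (?d p)) * ?c e (?d q)) * v $ q
        + (if q = p then if ?d p \<in> Z then v $ p else 0 else 0))"
      using v p by (auto simp: gram_mat_def scalar_prod_def atLeast0LessThan distrib_right intro!: sum.cong)
    also have "\<dots> = (\<Sum>q<?N. (\<Sum>e\<in>?E. cnj (?c e (?d p)) * ?c e (?d q)) * v $ q)
        + (if ?d p \<in> Z then v $ p else 0)"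
      using p by (simp add: sum.distrib)
    also have "(\<Sum>q<?N. (\<Sum>e\<in>?E. cnj (?c e (?d p)) * ?c e (?d q)) * v $ q)
        = (\<Sum>e\<in>?E. cnj (?c e (?d p)) * (\<Sum>q<?N. ?c e (?d q) * v $ q))"
      unfolding sum_distrib_left sum_distrib_right by (subst sum.swap) (simp add: mult.assoc)
    finally show ?thesis .
  qed
  show ?thesis
  proof
    assume "det ?G = 0"
    then obtain v where v: "v \<in> carrier_vec ?N" "v \<noteq> 0\<^sub>v ?N" "?G *\<^sub>v v = 0\<^sub>v ?N"
      using det_0_iff_vec_prod_zero[OF gram_mat_carrier] by blast
    define s where "s = (\<lambda>e. \<Sum>q<?N. ?c e (?d q) * v $ q)"
    \<comment> \<open>Pairing \<open>?G *\<^sub>v v = 0\<close> with \<open>v\<close> gives the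
      squared norm of the residual plus the squared norm of the entries on \<open>Z\<close>; both
      are zero. In this way a rank condition becomes the nonvanishing of one determinant, which is
      continuous.\<close>
    have "0 = (\<Sum>p<?N. cnj (v $ p) * (?G *\<^sub>v v) $ p)" using v by simp
    also have "\<dots> = (\<Sum>p<?N. \<Sum>e\<in>?E. cnj (?c e (?d p) * v $ p) * s e)
        + (\<Sum>p<?N. if ?d p \<in> Z then cnj (v $ p) * v $ p else 0)"
      unfolding sum.distrib[symmetric]
      by (rule sum.cong) (auto simp: G[OF v(1)] s_def distrib_left sum_distrib_left mult_ac)
    also have "(\<Sum>p<?N. \<Sum>e\<in>?E. cnj (?c e (?d p) * v $ p) * s e) = (\<Sum>e\<in>?E. cnj (s e) * s e)"
      by (subst sum.swap) (simp add: s_def sum_distrib_right)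
    finally have "complex_of_real ((\<Sum>e\<in>?E. (cmod (s e))\<^sup>2) + (\<Sum>p<?N. if ?d p \<in> Z then (cmod (v $ p))\<^sup>2 else 0)) = 0"
      by (simp add: complex_norm_square mult.commute if_distrib[of complex_of_real] cong: if_cong del: of_real_power)
    then have z: "(\<Sum>e\<in>?E. (cmod (s e))\<^sup>2) + (\<Sum>p<?N. if ?d p \<in> Z then (cmod (v $ p))\<^sup>2 else 0) = 0"
      by (simp only: of_real_eq_0_iff)
    have nn: "0 \<le> (\<Sum>e\<in>?E. (cmod (s e))\<^sup>2)" "0 \<le> (\<Sum>p<?N. if ?d p \<in> Z then (cmod (v $ p))\<^sup>2 else 0)"
      by (auto intro!: sum_nonneg)
    then have "(\<Sum>e\<in>?E. (cmod (s e))\<^sup>2) = 0" "(\<Sum>p<?N. if ?d p \<in> Z then (cmod (v $ p))\<^sup>2 else 0) = 0"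
      using z by linarith+
    then have s0: "\<forall>e\<in>?E. s e = 0" and v0: "\<And>p. p < ?N \<Longrightarrow> ?d p \<in> Z \<Longrightarrow> v $ p = 0"
      by (auto simp: sum_nonneg_eq_0_iff split: if_splits)
    define V where "V = mat n k (\<lambda>(a, j). v $ (a * k + j))"
    have Vd: "V $$ (?d p) = v $ p" if "p < ?N" for p
      using bij_betwE[OF bij] that by (auto simp: V_def)
    have "V \<in> solutions n k X Y P"
      unfolding solutions_iff[OF P X Y]
    proof (intro conjI ballI)
      fix e assume "e \<in> ?E"
      have "(\<Sum>z\<in>?I. ?c e z * V $$ z) = (\<Sum>p<?N. ?c e (?d p) * V $$ (?d p))"
        by (rule reindex[symmetric])
      also have "\<dots> = s e" unfolding s_def by (rule sum.cong) (auto simp: Vd)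
      finally show "(\<Sum>z\<in>?I. ?c e z * V $$ z) = 0" using s0 \<open>e \<in> ?E\<close> by simp
    qed (simp add: V_def)
    moreover have "\<forall>z\<in>Z \<inter> ?I. V $$ z = 0"
    proof
      fix z assume "z \<in> Z \<inter> ?I"
      then have "z \<in> ?d ` {..<?N}" by (simp only: bij_betw_imp_surj_on[OF bij] IntD2)
      then obtain p where "p < ?N" "z = ?d p" by blast
      then show "V $$ z = 0" using Vd v0 \<open>z \<in> Z \<inter> ?I\<close> by simp
    qed
    moreover have "V \<noteq> 0\<^sub>m n k"
    proof
      assume "V = 0\<^sub>m n k"
      then have "v $ p = 0" if "p < ?N" for p
        using Vd[OF that] bij_betwE[OF bij] that by auto
      then show False using vec_nonzero_entry[OF v(1,2)] by blast
    qed
    ultimately show "\<exists>V\<in>solutions n k X Y P. (\<forall>z\<in>Z \<inter> ?I. V $$ z = 0) \<and> V \<noteq> 0\<^sub>m n k" by blast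
  next
    assume "\<exists>V\<in>solutions n k X Y P. (\<forall>z\<in>Z \<inter> ?I. V $$ z = 0) \<and> V \<noteq> 0\<^sub>m n k"
    then obtain V where V: "V \<in> carrier_mat n k" "\<And>z. z \<in> Z \<Longrightarrow> z \<in> ?I \<Longrightarrow> V $$ z = 0" "V \<noteq> 0\<^sub>m n k"
      "\<And>e. e \<in> ?E \<Longrightarrow> (\<Sum>z\<in>?I. ?c e z * V $$ z) = 0"
      using solutions_iff[OF P X Y] by auto
    define v where "v = vec ?N (\<lambda>p. V $$ (?d p))"
    have v: "v \<in> carrier_vec ?N" by (simp add: v_def)
    have "?G *\<^sub>v v = 0\<^sub>v ?N"
    proof (rule eq_vecI)
      fix p assume "p < dim_vec (0\<^sub>v ?N :: complex vec)"
      then have p: "p < ?N" by simp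
      have "(\<Sum>q<?N. ?c e (?d q) * v $ q) = 0" if "e \<in> ?E" for e
        using V(4)[OF that] reindex[of "\<lambda>z. ?c e z * V $$ z"] by (simp add: v_def)
      moreover have "?d p \<in> Z \<Longrightarrow> v $ p = 0"
        using V(2) p bij_betwE[OF bij] by (auto simp: v_def)
      ultimately show "(?G *\<^sub>v v) $ p = 0\<^sub>v ?N $ p" using G[OF v p] p by simp
    qed (simp add: gram_mat_def)
    moreover have "v \<noteq> 0\<^sub>v ?N"
    proof
      assume v0: "v = 0\<^sub>v ?N"
      have "V = 0\<^sub>m n k"
      proof (rule eq_matI)
        fix a j assume "a < dim_row (0\<^sub>m n k :: complex mat)" "j < dim_col (0\<^sub>m n k :: complex mat)"
        then have "(a, j) \<in> ?I" by simp
        then have "(a, j) \<in> ?d ` {..<?N}" by (simp only: bij_betw_imp_surj_on[OF bij])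
        then obtain p where "p < ?N" "(a, j) = ?d p" by blast
        then show "V $$ (a, j) = 0\<^sub>m n k $$ (a, j)"
          using arg_cong[OF v0, of "\<lambda>v. v $ p"] \<open>(a, j) \<in> ?I\<close> by (simp add: v_def)
      qed (use V(1) in auto)
      then show False using V(3) by simp
    qed
    ultimately show "det ?G = 0" using det_0_iff_vec_prod_zero[OF gram_mat_carrier] v by blast
  qed
qed

lemma tendsto_det:
  assumes "\<And>x. M x \<in> carrier_mat N N" "A \<in> carrier_mat N N"
    and "\<And>i j. i < N \<Longrightarrow> j < N \<Longrightarrow> ((\<lambda>x. M x $$ (i, j)) \<longlongrightarrow> (A $$ (i, j) :: complex)) F"
  shows "((\<lambda>x. det (M x)) \<longlongrightarrow> det A) F"
  unfolding det_def'[OF assms(1)] det_def'[OF assms(2)]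
  by (intro tendsto_intros assms(3)) (auto simp: permutes_in_image)

lemma tendsto_gram_mat:
  assumes f: "entries_tendsto m n f P F" and X: "X \<in> carrier_mat k l" and Y: "Y \<in> carrier_mat k l"
  shows "((\<lambda>x. det (gram_mat m n k l X Y Z (f x))) \<longlongrightarrow> det (gram_mat m n k l X Y Z P)) F"
proof (rule tendsto_det[OF gram_mat_carrier gram_mat_carrier])
  fix i j assume ij: "i < n * k" "j < n * k"
  have c: "((\<lambda>x. equation_coeff X Y (f x) e (p div k, p mod k))
      \<longlongrightarrow> equation_coeff X Y P e (p div k, p mod k)) F" if e: "e \<in> {..<m} \<times> {..<l}" and p: "p < n * k" for e p
  proof -
    have p: "p div k < n" using p by (simp add: less_mult_imp_div_less)
    obtain r c where e: "e = (r, c)" "r < m" using e by (cases e) auto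
    have "((\<lambda>x. fst (f x) $$ (r, p div k)) \<longlongrightarrow> fst P $$ (r, p div k)) F"
      "((\<lambda>x. snd (f x) $$ (r, p div k)) \<longlongrightarrow> snd P $$ (r, p div k)) F"
      using f e(2) p unfolding entries_tendsto_def by blast+
    then show ?thesis unfolding equation_coeff_def e(1) prod.case by (intro tendsto_intros)
  qed
  show "((\<lambda>x. gram_mat m n k l X Y Z (f x) $$ (i, j)) \<longlongrightarrow> gram_mat m n k l X Y Z P $$ (i, j)) F"
    unfolding gram_mat_def using ij by (auto intro!: tendsto_intros c)
qed

text \<open>The Gram determinant with coordinates \<open>Z\<close> is nonzero at \<open>P\<close>,
  hence at some pair of the orbit of \<open>Q\<close> close to \<open>P\<close>. At that pair no
  nonzero solution vanishes on \<open>Z\<close>, whereas more than \<open>card Z\<close> independent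
  solutions would have a nonzero combination that does.\<close>

theorem coordinates_semicontinuous:
  assumes P: "P \<in> pairs m n" and Q: "Q \<in> pairs m n" and le: "orbit_le P Q"
    and X: "X \<in> carrier_mat k l" and Y: "Y \<in> carrier_mat k l"
    and Z: "coordinates n k X Y P Z" and Z': "coordinates n k X Y Q Z'"
  shows "card Z' \<le> card Z"
proof (rule ccontr)
  assume "\<not> card Z' \<le> card Z"
  have "finite ({..<n} \<times> {..<k})" by simp
  then have fin: "finite Z" "finite Z'"
    using Z Z' unfolding coordinates_def by (meson finite_subset)+
  have ZI: "Z \<inter> {..<n} \<times> {..<k} = Z" using Z by (auto simp: coordinates_def)
  obtain f where f: "entries_tendsto m n f P sequentially" "\<And>i. f i \<in> orbit Q"
    using closure_sequence le orbit_le_iff[OF P Q] by blast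
  have "det (gram_mat m n k l X Y Z P) \<noteq> 0"
    unfolding gram_mat_det[OF P X Y] ZI using Z unfolding coordinates_def by blast
  then have "\<forall>\<^sub>F i in sequentially. det (gram_mat m n k l X Y Z (f i)) \<noteq> 0"
    using tendsto_gram_mat[OF f(1) X Y] by (rule tendsto_imp_eventually_ne[rotated])
  then obtain i where i: "det (gram_mat m n k l X Y Z (f i)) \<noteq> 0"
    by (meson eventually_happens' sequentially_bot)
  obtain S S' R R' where R: "mutual_inverse m S S'" "mutual_inverse n R R'" "f i = act S Q R"
    using f(2)[of i] pair_equiv_iff[OF Q] by (auto simp: orbit_def)
  have Sc: "S \<in> carrier_mat m m" and Rc: "R \<in> carrier_mat n n" "R' \<in> carrier_mat n n" "R * R' = 1\<^sub>m n"
    using R by (auto simp: mutual_inverse_def)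
  have fi: "f i \<in> pairs m n" using R Q Sc Rc by auto
  have "\<forall>z\<in>Z'. \<exists>W\<in>solutions n k X Y Q. \<forall>z'\<in>Z'. W $$ z' = (if z' = z then 1 else 0)"
    using Z' by (simp add: coordinates_def)
  then obtain W where W: "\<And>z. z \<in> Z' \<Longrightarrow> W z \<in> solutions n k X Y Q"
    "\<And>z z'. z \<in> Z' \<Longrightarrow> z' \<in> Z' \<Longrightarrow> W z $$ z' = (if z' = z then 1 else 0)"
    by metis
  \<comment> \<open>\<open>R'\<close> transports the solutions dual to \<open>Z'\<close> from
    \<open>Q\<close> to \<open>f i\<close>. Vanishing on \<open>Z\<close> is a homogeneous system
    with fewer equations than unknowns.\<close>
  obtain x where x: "\<exists>z\<in>Z'. x z \<noteq> 0" "\<forall>z0\<in>Z. (\<Sum>z\<in>Z'. (R' * W z) $$ z0 * x z) = 0"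
    using nontrivial_solution[OF fin(2,1), of "\<lambda>z0 z. (R' * W z) $$ z0"] \<open>\<not> card Z' \<le> card Z\<close> by auto
  define U where "U = mat n k (\<lambda>z0. \<Sum>z\<in>Z'. x z * W z $$ z0)"
  have U: "U \<in> solutions n k X Y Q"
    unfolding U_def by (rule solutions_combination[OF Q X Y W(1)])
  then have Uc: "U \<in> carrier_mat n k" by (simp add: solutions_def)
  have "R' * U \<in> solutions n k X Y (f i)"
    unfolding R(3) by (rule solutions_act[OF Q X Y Sc R(2) U])
  moreover have "(R' * U) $$ z0 = 0" if "z0 \<in> Z" for z0
  proof -
    have "z0 \<in> {..<n} \<times> {..<k}" using Z that unfolding coordinates_def by blast
    then obtain a j where z0: "z0 = (a, j)" "a < n" "j < k" by blast
    have Wc: "W z \<in> carrier_mat n k" if "z \<in> Z'" for z using W(1)[OF that] by (simp add: solutions_def)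
    have "(R' * U) $$ z0 = (\<Sum>b<n. \<Sum>z\<in>Z'. R' $$ (a, b) * (W z $$ (b, j)) * x z)"
      using z0 Rc by (simp add: U_def scalar_prod_def atLeast0LessThan sum_distrib_left mult_ac)
    also have "\<dots> = (\<Sum>z\<in>Z'. (R' * W z) $$ z0 * x z)"
    proof (subst sum.swap, intro sum.cong refl)
      fix z assume "z \<in> Z'"
      note Wz = carrier_matD[OF Wc[OF this]]
      show "(\<Sum>b<n. R' $$ (a, b) * W z $$ (b, j) * x z) = (R' * W z) $$ z0 * x z"
        using z0 Rc Wz by (simp add: scalar_prod_def atLeast0LessThan sum_distrib_right)
    qed
    finally show ?thesis using x(2) that by simp
  qed
  ultimately have "R' * U = 0\<^sub>m n k"
    using i unfolding gram_mat_det[OF fi X Y] ZI by blast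
  \<comment> \<open>Undoing the transport gives \<open>U = 0\<close>, although the entries of
    \<open>U\<close> on \<open>Z'\<close> are the coefficients \<open>x\<close>, not all of which
    are zero.\<close>
  then have "R * (R' * U) = 0\<^sub>m n k" using Rc by simp
  moreover have "R * (R' * U) = R * R' * U" by (rule assoc_mult_mat[symmetric]) (use Rc Uc in auto)
  ultimately have "U = 0\<^sub>m n k" using Rc Uc by simp
  moreover obtain z where z: "z \<in> Z'" "x z \<noteq> 0" using x(1) by blast
  moreover have "U $$ z = x z"
  proof -
    have "z \<in> {..<n} \<times> {..<k}" using Z' z by (auto simp: coordinates_def)
    then have "U $$ z = (\<Sum>z'\<in>Z'. x z' * W z' $$ z)" by (auto simp: U_def)
    also have "\<dots> = (\<Sum>z'\<in>Z'. if z = z' then x z' else 0)" by (rule sum.cong) (use W(2) z in auto)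
    also have "\<dots> = x z" using fin z by simp
    finally show ?thesis .
  qed
  moreover have "z \<in> {..<n} \<times> {..<k}" using Z' z by (auto simp: coordinates_def)
  ultimately show False by auto
qed

section \<open>Solution spaces of direct sums\<close>

lemma append_rows_index:
  assumes "A \<in> carrier_mat m k" "B \<in> carrier_mat n k" "i < m + n" "j < k"
  shows "(A @\<^sub>r B) $$ (i, j) = (if i < m then A $$ (i, j) else B $$ (i - m, j))"
  using assms by (simp add: append_rows_def)

lemma append_rows_eq_iff:
  assumes "A \<in> carrier_mat m k" "A' \<in> carrier_mat m k" "B \<in> carrier_mat n k" "B' \<in> carrier_mat n k"
  shows "A @\<^sub>r B = A' @\<^sub>r B' \<longleftrightarrow> A = A' \<and> B = B'"
proof
  assume eq: "A @\<^sub>r B = A' @\<^sub>r B'"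
  have "A $$ (i, j) = A' $$ (i, j)" if "i < m" "j < k" for i j
    using arg_cong[OF eq, of "\<lambda>M. M $$ (i, j)"] that
    by (simp add: append_rows_index[OF assms(1,3)] append_rows_index[OF assms(2,4)])
  moreover have "B $$ (i, j) = B' $$ (i, j)" if "i < n" "j < k" for i j
    using arg_cong[OF eq, of "\<lambda>M. M $$ (i + m, j)"] that
    by (simp add: append_rows_index[OF assms(1,3)] append_rows_index[OF assms(2,4)])
  ultimately show "A = A' \<and> B = B'" using assms by auto
qed simp

lemma append_rows_split:
  assumes "V \<in> carrier_mat (n + q) k"
  shows "V = mat n k (\<lambda>(i, j). V $$ (i, j)) @\<^sub>r mat q k (\<lambda>(i, j). V $$ (i + n, j))"
  using assms by (intro eq_matI) (auto simp: append_rows_def)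

lemma diag_block_mult_append_rows:
  assumes "A \<in> carrier_mat m n" "B \<in> carrier_mat p q" "V \<in> carrier_mat n k" "W \<in> carrier_mat q k"
  shows "diag_block A B * (V @\<^sub>r W) = (A * V) @\<^sub>r (B * W)"
proof -
  have "diag_block A B * (V @\<^sub>r W) =
      four_block_mat A (0\<^sub>m m q) (0\<^sub>m p n) B * four_block_mat V (0\<^sub>m n 0) W (0\<^sub>m q 0)"
    using assms by (simp add: diag_block_def append_rows_def)
  also have "\<dots> = four_block_mat (A * V + 0\<^sub>m m q * W) (A * 0\<^sub>m n 0 + 0\<^sub>m m q * 0\<^sub>m q 0)
      (0\<^sub>m p n * V + B * W) (0\<^sub>m p n * 0\<^sub>m n 0 + B * 0\<^sub>m q 0)"
    by (rule mult_four_block_mat) (use assms in auto)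
  also have "\<dots> = (A * V) @\<^sub>r (B * W)"
    using assms by (simp add: append_rows_def)
  finally show ?thesis .
qed

lemma append_rows_mult:
  assumes "V \<in> carrier_mat n k" "W \<in> carrier_mat q k" "X \<in> carrier_mat k l"
  shows "(V @\<^sub>r W) * X = (V * X) @\<^sub>r (W * X :: complex mat)"
proof (rule eq_matI)
  fix i j assume "i < dim_row ((V * X) @\<^sub>r (W * X))" "j < dim_col ((V * X) @\<^sub>r (W * X))"
  then have ij: "i < n + q" "j < l" using assms by (auto simp: append_rows_def)
  have "((V @\<^sub>r W) * X) $$ (i, j) = (\<Sum>a<k. (V @\<^sub>r W) $$ (i, a) * X $$ (a, j))"
    using assms ij by (simp add: append_rows_def scalar_prod_def atLeast0LessThan)
  also have "\<dots> = (\<Sum>a<k. (if i < n then V $$ (i, a) else W $$ (i - n, a)) * X $$ (a, j))"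
    by (rule sum.cong) (use append_rows_index[OF assms(1,2) ij(1)] in auto)
  also have "\<dots> = ((V * X) @\<^sub>r (W * X)) $$ (i, j)"
    using assms ij by (simp add: append_rows_def scalar_prod_def atLeast0LessThan)
  finally show "((V @\<^sub>r W) * X) $$ (i, j) = ((V * X) @\<^sub>r (W * X)) $$ (i, j)" .
qed (use assms in \<open>auto simp: append_rows_def\<close>)

lemma solutions_oplus:
  assumes P: "P \<in> pairs m n" and Q: "Q \<in> pairs p q"
    and X: "X \<in> carrier_mat k l" and Y: "Y \<in> carrier_mat k l"
    and V: "V \<in> carrier_mat n k" and W: "W \<in> carrier_mat q k"
  shows "V @\<^sub>r W \<in> solutions (n + q) k X Y (oplus P Q)
    \<longleftrightarrow> V \<in> solutions n k X Y P \<and> W \<in> solutions q k X Y Q"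
proof -
  obtain A B where AB: "P = (A, B)" "A \<in> carrier_mat m n" "B \<in> carrier_mat m n"
    using P by (auto simp: pairs_def)
  obtain C D where CD: "Q = (C, D)" "C \<in> carrier_mat p q" "D \<in> carrier_mat p q"
    using Q by (auto simp: pairs_def)
  have e: "diag_block E F * (V @\<^sub>r W) * T = (E * V * T) @\<^sub>r (F * W * T)"
    if "E \<in> carrier_mat m n" "F \<in> carrier_mat p q" "T \<in> carrier_mat k l" for E F T
  proof -
    have "diag_block E F * (V @\<^sub>r W) = (E * V) @\<^sub>r (F * W)"
      by (rule diag_block_mult_append_rows[OF that(1,2) V W])
    moreover have "((E * V) @\<^sub>r (F * W)) * T = (E * V * T) @\<^sub>r (F * W * T)"
      by (rule append_rows_mult) (use that V W in auto)
    ultimately show ?thesis by simp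
  qed
  have c: "E * V * T \<in> carrier_mat m l" "F * W * T \<in> carrier_mat p l"
    if "E \<in> carrier_mat m n" "F \<in> carrier_mat p q" "T \<in> carrier_mat k l" for E F T
    using that V W by auto
  show ?thesis
    unfolding solutions_def AB(1) CD(1) oplus_def fst_conv snd_conv mem_Collect_eq
      e[OF AB(2) CD(2) X] e[OF AB(3) CD(3) Y]
      append_rows_eq_iff[OF c(1)[OF AB(2) CD(2) X] c(1)[OF AB(3) CD(3) Y] c(2)[OF AB(2) CD(2) X] c(2)[OF AB(3) CD(3) Y]]
    using V W by auto
qed

lemma coordinates_oplus:
  assumes P: "P \<in> pairs m n" and Q: "Q \<in> pairs p q"
    and X: "X \<in> carrier_mat k l" and Y: "Y \<in> carrier_mat k l"
    and ZP: "coordinates n k X Y P Z" and ZQ: "coordinates q k X Y Q Z'"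
  shows "\<exists>Z''. coordinates (n + q) k X Y (oplus P Q) Z'' \<and> card Z'' = card Z + card Z'"
proof -
  note so = solutions_oplus[OF P Q X Y]
  \<comment> \<open>The positions of the second summand lie below the \<open>n\<close> rows of the
    first.\<close>
  define sh where "sh = (\<lambda>(i, j). (i + n, j :: nat))"
  define Z'' where "Z'' = Z \<union> sh ` Z'"
  have sub: "Z \<subseteq> {..<n} \<times> {..<k}" "Z' \<subseteq> {..<q} \<times> {..<k}"
    using ZP ZQ by (auto simp: coordinates_def)
  have fin: "finite Z" "finite Z'" using sub finite_subset by blast+
  have inj: "inj_on sh Z'" by (auto simp: inj_on_def sh_def)
  have "Z \<inter> sh ` Z' = {}" using sub by (auto simp: sh_def)
  then have "card Z'' = card Z + card Z'"
    unfolding Z''_def using fin inj by (simp add: card_Un_disjoint card_image)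
  moreover have "coordinates (n + q) k X Y (oplus P Q) Z''"
    unfolding coordinates_def
  proof (intro conjI ballI impI)
    show "Z'' \<subseteq> {..<n + q} \<times> {..<k}"
      using sub by (fastforce simp: Z''_def sh_def)
  next
    fix V assume V: "V \<in> solutions (n + q) k X Y (oplus P Q)" and 0: "\<forall>z\<in>Z''. V $$ z = 0"
    define V1 V2 where "V1 = mat n k (\<lambda>(i, j). V $$ (i, j))" and "V2 = mat q k (\<lambda>(i, j). V $$ (i + n, j))"
    have Vc: "V \<in> carrier_mat (n + q) k" using V by (simp add: solutions_def)
    have c: "V1 \<in> carrier_mat n k" "V2 \<in> carrier_mat q k" by (simp_all add: V1_def V2_def)
    have VV: "V = V1 @\<^sub>r V2" unfolding V1_def V2_def by (rule append_rows_split[OF Vc])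
    have s: "V1 \<in> solutions n k X Y P" "V2 \<in> solutions q k X Y Q"
      using V so[OF c] VV by auto
    have "\<forall>z\<in>Z. V1 $$ z = 0" using 0 sub by (auto simp: V1_def Z''_def)
    moreover have "\<forall>z\<in>Z'. V2 $$ z = 0" using 0 sub by (fastforce simp: V2_def Z''_def sh_def)
    ultimately have "V1 = 0\<^sub>m n k" "V2 = 0\<^sub>m q k" using ZP ZQ s unfolding coordinates_def by blast+
    then show "V = 0\<^sub>m (n + q) k" unfolding VV by (intro eq_matI) (auto simp: append_rows_def)
  next
    fix z assume "z \<in> Z''"
    then consider "z \<in> Z" | z' where "z' \<in> Z'" "z = sh z'" by (auto simp: Z''_def)
    then show "\<exists>W\<in>solutions (n + q) k X Y (oplus P Q). \<forall>z'\<in>Z''. W $$ z' = (if z' = z then 1 else 0)"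
    proof cases
      case 1
      then obtain W where W: "W \<in> solutions n k X Y P" "\<And>z'. z' \<in> Z \<Longrightarrow> W $$ z' = (if z' = z then 1 else 0)"
        using ZP unfolding coordinates_def by blast
      then have Wc: "W \<in> carrier_mat n k" by (simp add: solutions_def)
      have 0: "0\<^sub>m q k \<in> solutions q k X Y Q"
        using Q X Y by (auto simp: solutions_def pairs_def)
      have "W @\<^sub>r 0\<^sub>m q k \<in> solutions (n + q) k X Y (oplus P Q)" using so[OF Wc] W 0 by simp
      moreover have "(W @\<^sub>r 0\<^sub>m q k) $$ z' = (if z' = z then 1 else 0)" if z': "z' \<in> Z''" for z'
      proof (cases "z' \<in> Z")
        case True
        then obtain i j where "z' = (i, j)" "i < n" "j < k" using sub by (cases z') auto
        then show ?thesis using W(2)[OF True] append_rows_index[OF Wc, of "0\<^sub>m q k" q i j] by simp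
      next
        case False
        then obtain i j where ij: "z' = (i + n, j)" "(i, j) \<in> Z'" using z' by (auto simp: Z''_def sh_def)
        then have "z' \<noteq> z" "i < q" "j < k" using 1 sub by auto
        then show ?thesis using ij append_rows_index[OF Wc, of "0\<^sub>m q k" q "i + n" j] by simp
      qed
      ultimately show ?thesis by blast
    next
      case 2
      then obtain W where W: "W \<in> solutions q k X Y Q" "\<And>y. y \<in> Z' \<Longrightarrow> W $$ y = (if y = z' then 1 else 0)"
        using ZQ unfolding coordinates_def by blast
      then have Wc: "W \<in> carrier_mat q k" by (simp add: solutions_def)
      have 0: "0\<^sub>m n k \<in> solutions n k X Y P"
        using P X Y by (auto simp: solutions_def pairs_def)
      have "0\<^sub>m n k @\<^sub>r W \<in> solutions (n + q) k X Y (oplus P Q)" using so[OF _ Wc] W 0 by simp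
      moreover have "(0\<^sub>m n k @\<^sub>r W) $$ y = (if y = z then 1 else 0)" if y: "y \<in> Z''" for y
      proof (cases "y \<in> Z")
        case True
        then obtain i j where ij: "y = (i, j)" "i < n" "j < k" using sub by (cases y) auto
        then have "y \<noteq> z" using 2 by (auto simp: sh_def split: prod.splits)
        then show ?thesis using ij append_rows_index[OF zero_carrier_mat Wc, of i n j] by simp
      next
        case False
        then obtain i j where ij: "y = (i + n, j)" "(i, j) \<in> Z'" using y by (auto simp: Z''_def sh_def)
        then have "i < q" "j < k" using sub by auto
        moreover have "y = z \<longleftrightarrow> (i, j) = z'" using ij 2 by (auto simp: sh_def split: prod.splits)
        ultimately show ?thesis
          using ij W(2)[OF ij(2)] append_rows_index[OF zero_carrier_mat Wc, of "i + n" n j] by simp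
      qed
      ultimately show ?thesis by blast
    qed
  qed
  ultimately show ?thesis by blast
qed

lemma coordinates_kronecker_pair:
  assumes X: "X \<in> carrier_mat k l" and Y: "Y \<in> carrier_mat k l"
    and "\<And>s. s \<in> set ss \<Longrightarrow> \<exists>Z. coordinates (ncols s) k X Y (summand_pair s) Z \<and> card Z = f s"
  shows "\<exists>Z. coordinates (total_cols ss) k X Y (kronecker_pair ss) Z \<and> card Z = sum_list (map f ss)"
  using assms(3)
proof (induction ss)
  case Nil
  have "coordinates 0 k X Y (kronecker_pair []) {}"
    by (auto simp: coordinates_def solutions_def)
  then show ?case by (intro exI[of _ "{}"]) simp
next
  case (Cons s ss)
  obtain Z where Z: "coordinates (ncols s) k X Y (summand_pair s) Z" "card Z = f s"
    using Cons.prems[of s] by auto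
  obtain Z' where Z': "coordinates (total_cols ss) k X Y (kronecker_pair ss) Z'" "card Z' = sum_list (map f ss)"
    using Cons by auto
  show ?case
    using coordinates_oplus[OF summand_pair_in_pairs kronecker_pair_in_pairs X Y Z(1) Z'(1)] Z(2) Z'(2)
    by (simp add: kronecker_pair_Cons)
qed

section \<open>Entries of products with the canonical matrices\<close>

lemma L_mat_mult:
  assumes "V \<in> carrier_mat n k"
  shows "L_mat n * V = mat (n - 1) k (\<lambda>(i, j). V $$ (i, j))"
  by (rule eq_matI) (use assms in \<open>auto simp: L_mat_def scalar_prod_def if_distrib[of "\<lambda>x. x * _"] cong: if_cong\<close>)

lemma R_mat_mult:
  assumes "V \<in> carrier_mat n k"
  shows "R_mat n * V = mat (n - 1) k (\<lambda>(i, j). V $$ (Suc i, j))"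
  by (rule eq_matI) (use assms in \<open>auto simp: R_mat_def scalar_prod_def if_distrib[of "\<lambda>x. x * _"] cong: if_cong\<close>)

lemma L_mat_transpose_mult:
  assumes "V \<in> carrier_mat (n - 1) k"
  shows "(L_mat n)\<^sup>T * V = mat n k (\<lambda>(i, j). if i < n - 1 then V $$ (i, j) else 0)"
  by (rule eq_matI) (use assms in \<open>auto simp: L_mat_def scalar_prod_def if_distrib[of "\<lambda>x. x * _"] cong: if_cong\<close>)

lemma R_mat_transpose_mult:
  assumes "V \<in> carrier_mat (n - 1) k"
  shows "(R_mat n)\<^sup>T * V = mat n k (\<lambda>(i, j). if i = 0 then 0 else V $$ (i - 1, j))"
proof (rule eq_matI)
  fix i j assume "i < dim_row (mat n k (\<lambda>(i, j). if i = 0 then 0 else V $$ (i - 1, j)))"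
    "j < dim_col (mat n k (\<lambda>(i, j). if i = 0 then 0 else V $$ (i - 1, j)))"
  then have ij: "i < n" "j < k" by simp_all
  then have "((R_mat n)\<^sup>T * V) $$ (i, j) = (\<Sum>a<n - 1. if i = Suc a then V $$ (a, j) else 0)"
    using assms by (auto simp: R_mat_def scalar_prod_def atLeast0LessThan intro!: sum.cong)
  also have "\<dots> = (\<Sum>a<n - 1. if a = i - 1 then if i = 0 then 0 else V $$ (i - 1, j) else 0)"
    by (rule sum.cong) auto
  also have "\<dots> = (if i = 0 then 0 else V $$ (i - 1, j))" using ij by auto
  finally show "((R_mat n)\<^sup>T * V) $$ (i, j) = mat n k (\<lambda>(i, j). if i = 0 then 0 else V $$ (i - 1, j)) $$ (i, j)"
    using ij by simp
qed (use assms in \<open>auto simp: R_mat_def\<close>)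

lemma jordan_block_mult:
  fixes V :: "complex mat"
  assumes "V \<in> carrier_mat n k"
  shows "jordan_block n a * V = mat n k (\<lambda>(i, j). a * V $$ (i, j) + (if Suc i < n then V $$ (Suc i, j) else 0))"
proof (rule eq_matI)
  fix i j assume "i < dim_row (mat n k (\<lambda>(i, j). a * V $$ (i, j) + (if Suc i < n then V $$ (Suc i, j) else 0)))"
    "j < dim_col (mat n k (\<lambda>(i, j). a * V $$ (i, j) + (if Suc i < n then V $$ (Suc i, j) else 0)))"
  then have ij: "i < n" "j < k" by simp_all
  then have "(jordan_block n a * V) $$ (i, j) =
      (\<Sum>b<n. (if b = i then a * V $$ (i, j) else 0) + (if b = Suc i then V $$ (Suc i, j) else 0))"
    using assms by (auto simp: jordan_block_def scalar_prod_def atLeast0LessThan intro!: sum.cong)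
  also have "\<dots> = a * V $$ (i, j) + (if Suc i < n then V $$ (Suc i, j) else 0)"
    using ij by (simp add: sum.distrib)
  finally show "(jordan_block n a * V) $$ (i, j) =
      mat n k (\<lambda>(i, j). a * V $$ (i, j) + (if Suc i < n then V $$ (Suc i, j) else 0)) $$ (i, j)"
    using ij by simp
qed (use assms in auto)

lemma mult_L_mat:
  assumes "V \<in> carrier_mat n k"
  shows "V * L_mat (Suc k) = mat n (Suc k) (\<lambda>(i, j). if j < k then V $$ (i, j) else 0)"
  by (rule eq_matI) (use assms in \<open>auto simp: L_mat_def scalar_prod_def if_distrib[of "\<lambda>x. _ * x"] cong: if_cong\<close>)

lemma mult_R_mat:
  assumes "V \<in> carrier_mat n k"
  shows "V * R_mat (Suc k) = mat n (Suc k) (\<lambda>(i, j). if j = 0 then 0 else V $$ (i, j - 1))"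
proof -
  have "(V * R_mat (Suc k))\<^sup>T = (R_mat (Suc k))\<^sup>T * V\<^sup>T"
    by (rule transpose_mult[OF assms]) (use R_mat_carrier[of "Suc k"] in simp)
  also have "\<dots> = mat (Suc k) n (\<lambda>(i, j). if i = 0 then 0 else V\<^sup>T $$ (i - 1, j))"
    by (rule R_mat_transpose_mult) (use assms in simp)
  finally have "V * R_mat (Suc k) = (mat (Suc k) n (\<lambda>(i, j). if i = 0 then 0 else V\<^sup>T $$ (i - 1, j)))\<^sup>T"
    by (metis transpose_transpose)
  also have "\<dots> = mat n (Suc k) (\<lambda>(i, j). if j = 0 then 0 else V $$ (i, j - 1))"
    using assms by (intro eq_matI) auto
  finally show ?thesis .
qed

lemma mult_jordan_block:
  fixes V :: "complex mat"
  assumes "V \<in> carrier_mat n k"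
  shows "V * jordan_block k a = mat n k (\<lambda>(i, j). a * V $$ (i, j) + (if j = 0 then 0 else V $$ (i, j - 1)))"
proof (rule eq_matI)
  fix i j assume "i < dim_row (mat n k (\<lambda>(i, j). a * V $$ (i, j) + (if j = 0 then 0 else V $$ (i, j - 1))))"
    "j < dim_col (mat n k (\<lambda>(i, j). a * V $$ (i, j) + (if j = 0 then 0 else V $$ (i, j - 1))))"
  then have ij: "i < n" "j < k" by simp_all
  then have "(V * jordan_block k a) $$ (i, j) =
      (\<Sum>b<k. (if b = j then a * V $$ (i, j) else 0) + (if Suc b = j then V $$ (i, j - 1) else 0))"
    using assms by (auto simp: jordan_block_def scalar_prod_def atLeast0LessThan intro!: sum.cong)
  also have "\<dots> = a * V $$ (i, j) + (if j = 0 then 0 else V $$ (i, j - 1))"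
    using ij by (cases j) (simp_all add: sum.distrib)
  finally show "(V * jordan_block k a) $$ (i, j) =
      mat n k (\<lambda>(i, j). a * V $$ (i, j) + (if j = 0 then 0 else V $$ (i, j - 1))) $$ (i, j)"
    using ij by simp
qed (use assms in auto)

section \<open>Solution spaces of Kronecker pairs\<close>

text \<open>One dimension is read off from the matrix itself, so each formula rewrites under a
  single dimension equation.\<close>

lemmas product_entries =
  L_mat_mult[OF carrier_matI[OF _ refl]] R_mat_mult[OF carrier_matI[OF _ refl]]
  L_mat_transpose_mult[OF carrier_matI[OF _ refl]] R_mat_transpose_mult[OF carrier_matI[OF _ refl]]
  jordan_block_mult[OF carrier_matI[OF _ refl]] mult_L_mat[OF carrier_matI[OF refl]]
  mult_R_mat[OF carrier_matI[OF refl]] mult_jordan_block[OF carrier_matI[OF refl]]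

lemma mat_eq_iff: "mat a b f = mat a b g \<longleftrightarrow> (\<forall>i<a. \<forall>j<b. f (i, j) = g (i, j))"
proof
  assume eq: "mat a b f = mat a b g"
  show "\<forall>i<a. \<forall>j<b. f (i, j) = g (i, j)"
  proof (intro allI impI)
    fix i j assume "i < a" "j < b"
    then show "f (i, j) = g (i, j)" using arg_cong[OF eq, of "\<lambda>M. M $$ (i, j)"] by simp
  qed
qed (auto intro: eq_matI)

lemma eq_mat_iff:
  assumes "dim_row A = a" "dim_col A = b"
  shows "A = mat a b g \<longleftrightarrow> (\<forall>i<a. \<forall>j<b. A $$ (i, j) = g (i, j))"
    and "mat a b g = A \<longleftrightarrow> (\<forall>i<a. \<forall>j<b. g (i, j) = A $$ (i, j))"
proof -
  have A: "A = mat a b (\<lambda>z. A $$ z)" using assms by (intro eq_matI) auto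
  show "A = mat a b g \<longleftrightarrow> (\<forall>i<a. \<forall>j<b. A $$ (i, j) = g (i, j))"
    by (subst A) (rule mat_eq_iff)
  show "mat a b g = A \<longleftrightarrow> (\<forall>i<a. \<forall>j<b. g (i, j) = A $$ (i, j))"
    by (subst A) (rule mat_eq_iff)
qed

lemma coordinatesI:
  assumes "Z \<subseteq> {..<n} \<times> {..<k}"
    and "\<And>V i j. V \<in> solutions n k X Y P \<Longrightarrow> (\<And>z. z \<in> Z \<Longrightarrow> V $$ z = 0) \<Longrightarrow> i < n \<Longrightarrow> j < k \<Longrightarrow> V $$ (i, j) = 0"
    and "\<And>z. z \<in> Z \<Longrightarrow> mat n k (W z) \<in> solutions n k X Y P"
    and "\<And>z z'. z \<in> Z \<Longrightarrow> z' \<in> Z \<Longrightarrow> W z z' = (if z' = z then 1 else 0)"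
  shows "coordinates n k X Y P Z"
  unfolding coordinates_def
proof (intro conjI ballI impI)
  fix V assume V: "V \<in> solutions n k X Y P" "\<forall>z\<in>Z. V $$ z = 0"
  then have "V \<in> carrier_mat n k" by (simp add: solutions_def)
  then show "V = 0\<^sub>m n k" using assms(2)[OF V(1)] V(2) by (intro eq_matI) auto
next
  fix z assume z: "z \<in> Z"
  have "mat n k (W z) $$ z' = (if z' = z then 1 else 0)" if "z' \<in> Z" for z'
    using assms(1) assms(4)[OF z that] that by (cases z') auto
  then show "\<exists>U\<in>solutions n k X Y P. \<forall>z'\<in>Z. U $$ z' = (if z' = z then 1 else 0)"
    using assms(3)[OF z] by blast
qed (use assms(1) in auto)

lemma coordinates_emptyI:
  assumes "\<And>V i j. V \<in> solutions n k X Y P \<Longrightarrow> i < n \<Longrightarrow> j < k \<Longrightarrow> V $$ (i, j) = 0"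
  shows "coordinates n k X Y P {}"
  by (rule coordinatesI[where W = "\<lambda>_ _. 0"]) (use assms in auto)

lemma solutions_conv:
  assumes "V \<in> carrier_mat n k \<Longrightarrow> dim_row V = n \<Longrightarrow> dim_col V = k \<Longrightarrow> (fst P * V * X = snd P * V * Y) = C"
  shows "V \<in> solutions n k X Y P \<longleftrightarrow> V \<in> carrier_mat n k \<and> C"
  using assms by (auto simp: solutions_def)

section \<open>Dimensions for the indecomposable summands\<close>

context
  fixes k :: nat
begin

private abbreviation "Chain_sols s \<equiv> solutions (ncols s) k (L_mat (Suc k)) (R_mat (Suc k)) (summand_pair s)"

text \<open>In terms of the columns \<open>v_0, ..., v_(k-1)\<close> of \<open>V\<close> the system
  reads \<open>A v_0 = 0\<close>, \<open>A v_j = B v_(j-1)\<close>, \<open>B v_(k-1) = 0\<close>.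
  This says that the polynomial vector with coefficients \<open>v_j\<close>, of degree less than
  \<open>k\<close>, is annihilated by the pencil \<open>A - x B\<close>.\<close>

lemma chain_sols_iff:
  "V \<in> Chain_sols (SL n) \<longleftrightarrow> V \<in> carrier_mat n k \<and> (\<forall>i<n - 1. \<forall>j<Suc k.
    (if j < k then V $$ (i, j) else 0) = (if j = 0 then 0 else V $$ (Suc i, j - 1)))"
  "V \<in> Chain_sols (SLT n) \<longleftrightarrow> V \<in> carrier_mat (n - 1) k \<and> (\<forall>i<n. \<forall>j<Suc k.
    (if j < k then if i < n - 1 then V $$ (i, j) else 0 else 0) =
    (if j = 0 then 0 else if i = 0 then 0 else V $$ (i - 1, j - 1)))"
  "V \<in> Chain_sols (SD n (Fin a)) \<longleftrightarrow> V \<in> carrier_mat n k \<and> (\<forall>i<n. \<forall>j<Suc k.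
    (if j < k then V $$ (i, j) else 0) = (if j = 0 then 0 else
      a * V $$ (i, j - 1) + (if Suc i < n then V $$ (Suc i, j - 1) else 0)))"
  "V \<in> Chain_sols (SD n Infty) \<longleftrightarrow> V \<in> carrier_mat n k \<and> (\<forall>i<n. \<forall>j<Suc k.
    (if j < k then if Suc i < n then V $$ (Suc i, j) else 0 else 0) = (if j = 0 then 0 else V $$ (i, j - 1)))"
  by (simp_all only: ncols.simps summand_pair.simps fst_conv snd_conv)
    (rule solutions_conv, simp add: product_entries mat_eq_iff eq_mat_iff cong: if_cong del: assoc_mult_mat split del: if_split)+

lemma antidiagonal:
  assumes "\<And>i j. i < n - 1 \<Longrightarrow> Suc j < k \<Longrightarrow> V $$ (i, Suc j) = V $$ (Suc i, j)"
    and "i + t < n" "t \<le> j" "j < k"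
  shows "V $$ (i, j) = (V $$ (i + t, j - t) :: complex)"
  using assms(2,3)
proof (induction t)
  case (Suc t)
  have "j - t = Suc (j - Suc t)" using Suc.prems by simp
  then show ?case using Suc assms(1)[of "i + t" "j - Suc t"] assms(4) by simp
qed simp

text \<open>For \<open>L_n\<close> a solution is constant on antidiagonals and vanishes in the first
  column above the last row and in the last column below the first row. The antidiagonals
  \<open>n - 1 \<le> i + j < k\<close> survive, each represented by its entry in the last row. The
  pencils of the other summands annihilate no nonzero polynomial vector.\<close>

lemma coordinates_chain:
  assumes "1 \<le> summand_index s"
  shows "\<exists>Z. coordinates (ncols s) k (L_mat (Suc k)) (R_mat (Suc k)) (summand_pair s) Z
    \<and> card Z = (case s of SL n \<Rightarrow> Suc k - n | _ \<Rightarrow> 0)"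
proof (cases s rule: summand_pair.cases)
  case (1 n)
  have n: "1 \<le> n" using assms by (simp add: 1)
  let ?Z = "{n - 1} \<times> {..<Suc k - n}"
  have "coordinates (ncols s) k (L_mat (Suc k)) (R_mat (Suc k)) (summand_pair s) ?Z"
  proof (rule coordinatesI[where W = "\<lambda>z (i, j). if i + j = n - 1 + snd z then 1 else 0"])
    fix V i j assume V: "V \<in> Chain_sols s" "\<And>z. z \<in> ?Z \<Longrightarrow> V $$ z = 0" and ij: "i < ncols s" "j < k"
    have eq: "(if j < k then V $$ (i, j) else 0) = (if j = 0 then 0 else V $$ (Suc i, j - 1))"
      if "i < n - 1" "j < Suc k" for i j using V(1) that unfolding 1 chain_sols_iff by blast
    note ad = antidiagonal[of n V, where i = i and j = j]
    have step: "V $$ (i, Suc j) = V $$ (Suc i, j)" if "i < n - 1" "Suc j < k" for i j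
      using eq[of i "Suc j"] that by simp
    have first: "V $$ (i, 0) = 0" if "i < n - 1" "0 < k" for i
      using eq[of i 0] that by simp
    have last: "V $$ (Suc i, k - 1) = 0" if "i < n - 1" "0 < k" for i
      using eq[of i k] that by simp
    consider "i + j < n - 1" | "n - 1 \<le> i + j" "i + j - (n - 1) < Suc k - n" | "n - 1 \<le> i + j" "k \<le> i + j"
      using n by linarith
    then show "V $$ (i, j) = 0"
    proof cases
      case 1
      then show ?thesis using antidiagonal[of n V i j j] step first ij by simp
    next
      case 2
      have "V $$ (i, j) = V $$ (i + (n - 1 - i), j - (n - 1 - i))"
        by (rule antidiagonal[of n]) (use step ij 2 n \<open>s = SL n\<close> in auto)
      also have "\<dots> = V $$ (n - 1, i + j - (n - 1))"
        using ij 2 n \<open>s = SL n\<close> by (intro arg_cong[where f = "\<lambda>z. V $$ z"]) auto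
      also have "\<dots> = 0" using 2 by (intro V(2)) auto
      finally show ?thesis .
    next
      case 3
      \<comment> \<open>The row in which the antidiagonal through \<open>(i, j)\<close> meets the
        last column.\<close>
      let ?i = "i + j - (k - 1)"
      have "V $$ (?i, k - 1) = V $$ (?i + (k - 1 - j), k - 1 - (k - 1 - j))"
        by (rule antidiagonal[of n]) (use step ij 3 \<open>s = SL n\<close> in auto)
      also have "\<dots> = V $$ (i, j)"
        using ij 3 by (intro arg_cong[where f = "\<lambda>z. V $$ z"]) auto
      finally have "V $$ (i, j) = V $$ (?i, k - 1)" by simp
      also have "?i = Suc (i + j - k)" using 3 ij by linarith
      also have "V $$ (Suc (i + j - k), k - 1) = 0" by (rule last) (use 3 ij \<open>s = SL n\<close> in auto)
      finally show ?thesis .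
    qed
  next
    fix z assume "z \<in> ?Z"
    then obtain e where e: "z = (n - 1, e)" "e < Suc k - n" by auto
    show "mat (ncols s) k (\<lambda>(i, j). if i + j = n - 1 + snd z then 1 else 0) \<in> Chain_sols s"
      unfolding 1 chain_sols_iff using e n by auto
  qed (use 1 n in \<open>auto split: if_splits\<close>)
  moreover have "card ?Z = Suc k - n" by simp
  ultimately show ?thesis using 1 by (intro exI[of _ ?Z]) simp
next
  case (2 n)
  have "coordinates (ncols s) k (L_mat (Suc k)) (R_mat (Suc k)) (summand_pair s) {}"
  proof (rule coordinates_emptyI)
    fix V i j assume V: "V \<in> Chain_sols s" and ij: "i < ncols s" "j < k"
    have eq: "(if j < k then if i < n - 1 then V $$ (i, j) else 0 else 0) =
      (if j = 0 then 0 else if i = 0 then 0 else V $$ (i - 1, j - 1))"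
      if "i < n" "j < Suc k" for i j using V that unfolding 2 chain_sols_iff by blast
    have "i < n - 1" using ij 2 by simp
    then show "V $$ (i, j) = 0" using ij(2)
    proof (induction i arbitrary: j)
      case 0
      then show ?case using eq[of 0 j] by simp
    next
      case (Suc i)
      then show ?case using eq[of "Suc i" j] by (cases j) simp_all
    qed
  qed
  then show ?thesis using 2 by (intro exI[of _ "{}"]) simp
next
  case (3 n a)
  have "coordinates (ncols s) k (L_mat (Suc k)) (R_mat (Suc k)) (summand_pair s) {}"
  proof (rule coordinates_emptyI)
    fix V i j assume V: "V \<in> Chain_sols s" and ij: "i < ncols s" "j < k"
    have eq: "(if j < k then V $$ (i, j) else 0) = (if j = 0 then 0 else
      a * V $$ (i, j - 1) + (if Suc i < n then V $$ (Suc i, j - 1) else 0))"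
      if "i < n" "j < Suc k" for i j using V that unfolding 3 chain_sols_iff by blast
    have "i < n" using ij 3 by simp
    then show "V $$ (i, j) = 0" using ij(2)
    proof (induction j arbitrary: i)
      case 0
      then show ?case using eq[of i 0] by simp
    next
      case (Suc j)
      then show ?case using eq[of i "Suc j"] by simp
    qed
  qed
  then show ?thesis using 3 by (intro exI[of _ "{}"]) simp
next
  case (4 n)
  have "coordinates (ncols s) k (L_mat (Suc k)) (R_mat (Suc k)) (summand_pair s) {}"
  proof (rule coordinates_emptyI)
    fix V i j assume V: "V \<in> Chain_sols s" and ij: "i < ncols s" "j < k"
    have eq: "(if j < k then if Suc i < n then V $$ (Suc i, j) else 0 else 0) = (if j = 0 then 0 else V $$ (i, j - 1))"
      if "i < n" "j < Suc k" for i j using V that unfolding 4 chain_sols_iff by blast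
    have "i < n" using ij 4 by simp
    then show "V $$ (i, j) = 0" using ij(2)
    proof (induction "n - i" arbitrary: i j rule: less_induct)
      case less
      have "V $$ (Suc i, Suc j) = 0" if "Suc i < n" "Suc j < k"
        by (rule less.hyps) (use that less.prems in auto)
      then show ?case using eq[of i "Suc j"] less.prems by (simp split: if_splits)
    qed
  qed
  then show ?thesis using 4 by (intro exI[of _ "{}"]) simp
qed

text \<open>The eigenvalue conditions \<open>A V J = B V\<close> with \<open>J = J_k(a)\<close>, and \<open>A V = B V J\<close> with \<open>J = J_k(0)\<close>
  for the eigenvalue \<open>\<infinity>\<close>.\<close>
private abbreviation "Eigen_sols a s \<equiv> solutions (ncols s) k (jordan_block k a) (1\<^sub>m k) (summand_pair s)"

private abbreviation "Eigen_sols_inf s \<equiv> solutions (ncols s) k (1\<^sub>m k) (jordan_block k 0) (summand_pair s)"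

lemma eigen_sols_iff:
  "V \<in> Eigen_sols a (SL n) \<longleftrightarrow> V \<in> carrier_mat n k \<and> (\<forall>i<n - 1. \<forall>j<k.
    a * V $$ (i, j) + (if j = 0 then 0 else V $$ (i, j - 1)) = V $$ (Suc i, j))"
  "V \<in> Eigen_sols a (SLT n) \<longleftrightarrow> V \<in> carrier_mat (n - 1) k \<and> (\<forall>i<n. \<forall>j<k.
    a * (if i < n - 1 then V $$ (i, j) else 0) + (if j = 0 then 0 else if i < n - 1 then V $$ (i, j - 1) else 0)
    = (if i = 0 then 0 else V $$ (i - 1, j)))"
  "V \<in> Eigen_sols a (SD n (Fin b)) \<longleftrightarrow> V \<in> carrier_mat n k \<and> (\<forall>i<n. \<forall>j<k.
    a * V $$ (i, j) + (if j = 0 then 0 else V $$ (i, j - 1))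
    = b * V $$ (i, j) + (if Suc i < n then V $$ (Suc i, j) else 0))"
  "V \<in> Eigen_sols a (SD n Infty) \<longleftrightarrow> V \<in> carrier_mat n k \<and> (\<forall>i<n. \<forall>j<k.
    a * (if Suc i < n then V $$ (Suc i, j) else 0) + (if j = 0 then 0 else if Suc i < n then V $$ (Suc i, j - 1) else 0)
    = V $$ (i, j))"
  by (simp_all only: ncols.simps summand_pair.simps fst_conv snd_conv)
    (rule solutions_conv, simp add: product_entries mat_eq_iff eq_mat_iff cong: if_cong del: assoc_mult_mat split del: if_split)+

lemma eigen_sols_inf_iff:
  "V \<in> Eigen_sols_inf (SL n) \<longleftrightarrow> V \<in> carrier_mat n k \<and> (\<forall>i<n - 1. \<forall>j<k.
    V $$ (i, j) = (if j = 0 then 0 else V $$ (Suc i, j - 1)))"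
  "V \<in> Eigen_sols_inf (SLT n) \<longleftrightarrow> V \<in> carrier_mat (n - 1) k \<and> (\<forall>i<n. \<forall>j<k.
    (if i < n - 1 then V $$ (i, j) else 0) = (if j = 0 then 0 else if i = 0 then 0 else V $$ (i - 1, j - 1)))"
  "V \<in> Eigen_sols_inf (SD n (Fin b)) \<longleftrightarrow> V \<in> carrier_mat n k \<and> (\<forall>i<n. \<forall>j<k.
    V $$ (i, j) = (if j = 0 then 0 else b * V $$ (i, j - 1) + (if Suc i < n then V $$ (Suc i, j - 1) else 0)))"
  "V \<in> Eigen_sols_inf (SD n Infty) \<longleftrightarrow> V \<in> carrier_mat n k \<and> (\<forall>i<n. \<forall>j<k.
    (if Suc i < n then V $$ (Suc i, j) else 0) = (if j = 0 then 0 else V $$ (i, j - 1)))"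
  by (simp_all only: ncols.simps summand_pair.simps fst_conv snd_conv)
    (rule solutions_conv, simp add: product_entries mat_eq_iff eq_mat_iff cong: if_cong del: assoc_mult_mat split del: if_split)+

text \<open>The solutions intertwine two nilpotent Jordan blocks: they are constant along diagonals
  and determined by the first row. An entry of that row vanishes when its diagonal reaches the last
  row before the last column, which leaves the final \<open>min n k\<close> entries free.\<close>

lemma coordinates_diagonal:
  assumes n: "1 \<le> n"
    and sol: "\<And>V. V \<in> solutions n k X Y P \<longleftrightarrow> V \<in> carrier_mat n k \<and> (\<forall>i<n. \<forall>j<k.
      (if Suc i < n then V $$ (Suc i, j) else 0) = (if j = 0 then 0 else V $$ (i, j - 1)))"
  shows "\<exists>Z. coordinates n k X Y P Z \<and> card Z = min n k"
proof -
  let ?Z = "{0} \<times> {k - min n k..<k}"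
  have "coordinates n k X Y P ?Z"
  proof (rule coordinatesI[where W = "\<lambda>z (i, j). if j = i + snd z then 1 else 0"])
    fix V i j assume V: "V \<in> solutions n k X Y P" "\<And>z. z \<in> ?Z \<Longrightarrow> V $$ z = 0" and ij: "i < n" "j < k"
    have eq: "(if Suc i < n then V $$ (Suc i, j) else 0) = (if j = 0 then 0 else V $$ (i, j - 1))"
      if "i < n" "j < k" for i j using V(1) that unfolding sol by blast
    have down: "V $$ (i, j + i) = V $$ (0, j)" if "i < n" "j + i < k" for i j
      using that
    proof (induction i)
      case (Suc i)
      then show ?case using eq[of i "j + Suc i"] by simp
    qed simp
    have row0: "V $$ (0, j) = 0" if "j < k" for j
    proof (cases "k - min n k \<le> j")
      case True
      then show ?thesis using that by (intro V(2)) auto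
    next
      case False
      then have "V $$ (n - 1, j + (n - 1)) = V $$ (0, j)" using n by (intro down) auto
      moreover have "V $$ (n - 1, j + (n - 1)) = 0" using eq[of "n - 1" "j + n"] False n by simp
      ultimately show ?thesis by simp
    qed
    show "V $$ (i, j) = 0" using ij
    proof (induction i arbitrary: j)
      case 0
      then show ?case using row0 by simp
    next
      case (Suc i)
      then show ?case using eq[of i j] Suc.IH[of "j - 1"] by (cases j) simp_all
    qed
  next
    fix z assume "z \<in> ?Z"
    then obtain e where e: "z = (0, e)" "k - min n k \<le> e" "e < k" by auto
    show "mat n k (\<lambda>(i, j). if j = i + snd z then 1 else 0) \<in> solutions n k X Y P"
      unfolding sol using e by auto
  qed (use n in \<open>auto split: if_splits\<close>)
  moreover have "card ?Z = min n k" by simp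
  ultimately show ?thesis by blast
qed

text \<open>Row \<open>i\<close> of \<open>V\<close> is read as a polynomial in \<open>y\<close>
  modulo \<open>y^k\<close>, on which \<open>J_k(a)\<close> acts as multiplication by
  \<open>a + y\<close>. For \<open>L_n\<close> row \<open>i + 1\<close> is \<open>a + y\<close>
  times row \<open>i\<close>, so the first row is free. Among the other summands only Jordan blocks
  at \<open>a\<close> itself contribute, through \<open>coordinates_diagonal\<close>.\<close>

lemma coordinates_eigen:
  assumes "1 \<le> summand_index s"
  shows "\<exists>Z. coordinates (ncols s) k (jordan_block k a) (1\<^sub>m k) (summand_pair s) Z
    \<and> card Z = (case s of SL n \<Rightarrow> k | SLT n \<Rightarrow> 0 | SD n \<mu> \<Rightarrow> if \<mu> = Fin a then min n k else 0)"
proof (cases s rule: summand_pair.cases)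
  case (1 n)
  have n: "1 \<le> n" using assms by (simp add: 1)
  let ?Z = "{0} \<times> {..<k}"
  have "coordinates (ncols s) k (jordan_block k a) (1\<^sub>m k) (summand_pair s) ?Z"
  proof (rule coordinatesI[where W = "\<lambda>z (i, j). coeff ([:a, 1:] ^ i * monom 1 (snd z)) j"])
    fix V i j assume V: "V \<in> Eigen_sols a s" "\<And>z. z \<in> ?Z \<Longrightarrow> V $$ z = 0" and ij: "i < ncols s" "j < k"
    have eq: "a * V $$ (i, j) + (if j = 0 then 0 else V $$ (i, j - 1)) = V $$ (Suc i, j)"
      if "i < n - 1" "j < k" for i j using V(1) that unfolding 1 eigen_sols_iff by blast
    have "i < n" using ij 1 by simp
    then show "V $$ (i, j) = 0" using ij(2)
    proof (induction i arbitrary: j)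
      case 0
      then show ?case using V(2) by auto
    next
      case (Suc i)
      then show ?case using eq[of i j] by (simp add: less_diff_conv split: if_splits)
    qed
  next
    fix z assume "z \<in> ?Z"
    have c: "coeff ([:a, 1:] * q) j = a * coeff q j + (if j = 0 then 0 else coeff q (j - 1))" for q j
      by (cases j) simp_all
    show "mat (ncols s) k (\<lambda>(i, j). coeff ([:a, 1:] ^ i * monom 1 (snd z)) j) \<in> Eigen_sols a s"
      unfolding 1 eigen_sols_iff by (auto simp: c mult.assoc simp del: mult_pCons_left)
  qed (use 1 n in \<open>auto split: if_splits\<close>)
  moreover have "card ?Z = k" by simp
  ultimately show ?thesis using 1 by (intro exI[of _ ?Z]) simp
next
  case (2 n)
  have "coordinates (ncols s) k (jordan_block k a) (1\<^sub>m k) (summand_pair s) {}"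
  proof (rule coordinates_emptyI)
    fix V i j assume V: "V \<in> Eigen_sols a s" and ij: "i < ncols s" "j < k"
    have eq: "a * (if i < n - 1 then V $$ (i, j) else 0) + (if j = 0 then 0 else if i < n - 1 then V $$ (i, j - 1) else 0)
      = (if i = 0 then 0 else V $$ (i - 1, j))"
      if "i < n" "j < k" for i j using V that unfolding 2 eigen_sols_iff by blast
    have "i < n - 1" using ij 2 by simp
    then show "V $$ (i, j) = 0" using ij(2)
    proof (induction "n - i" arbitrary: i j rule: less_induct)
      case less
      have "V $$ (Suc i, j) = 0" if "Suc i < n - 1" "j < k" for j
        by (rule less.hyps) (use that less.prems in auto)
      then show ?case using eq[of "Suc i" j] less.prems by (simp add: less_diff_conv split: if_splits)
    qed
  qed
  then show ?thesis using 2 by (intro exI[of _ "{}"]) simp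
next
  case (3 n b)
  have n: "1 \<le> n" using assms by (simp add: 3)
  show ?thesis
  proof (cases "b = a")
    case True
    have "V \<in> solutions n k (jordan_block k a) (1\<^sub>m k) (summand_pair s) \<longleftrightarrow> V \<in> carrier_mat n k \<and>
      (\<forall>i<n. \<forall>j<k. (if Suc i < n then V $$ (Suc i, j) else 0) = (if j = 0 then 0 else V $$ (i, j - 1)))" for V
      using eigen_sols_iff(3)[where a = a and b = a and n = n and V = V] unfolding 3 True ncols.simps add_left_cancel
      by (metis (no_types, lifting))
    from coordinates_diagonal[OF n this] show ?thesis by (simp add: 3 True)
  next
    case False
    have "coordinates (ncols s) k (jordan_block k a) (1\<^sub>m k) (summand_pair s) {}"
    proof (rule coordinates_emptyI)
      fix V i j assume V: "V \<in> Eigen_sols a s" and ij: "i < ncols s" "j < k"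
      have eq: "a * V $$ (i, j) + (if j = 0 then 0 else V $$ (i, j - 1))
        = b * V $$ (i, j) + (if Suc i < n then V $$ (Suc i, j) else 0)"
        if "i < n" "j < k" for i j using V that unfolding 3 eigen_sols_iff by blast
      \<comment> \<open>As \<open>b - a\<close> is invertible, the entries vanish column by column
        and, within a column, from the bottom upwards.\<close>
      have "\<forall>i<n. V $$ (i, j) = 0" using ij(2)
      proof (induction j)
        case 0
        show ?case
        proof (intro allI impI)
          fix i assume "i < n"
          then show "V $$ (i, 0) = 0"
          proof (induction "n - i" arbitrary: i rule: less_induct)
            case less
            have "V $$ (Suc i, 0) = 0" if "Suc i < n"
              by (rule less.hyps) (use that less.prems in auto)
            then show ?case using eq[of i 0] less.prems 0 False by (simp split: if_splits)
          qed
        qed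
      next
        case (Suc j)
        show ?case
        proof (intro allI impI)
          fix i assume "i < n"
          then show "V $$ (i, Suc j) = 0"
          proof (induction "n - i" arbitrary: i rule: less_induct)
            case less
            have "V $$ (Suc i, Suc j) = 0" if "Suc i < n"
              by (rule less.hyps) (use that less.prems in auto)
            then show ?case using eq[of i "Suc j"] less.prems Suc False by (simp split: if_splits)
          qed
        qed
      qed
      then show "V $$ (i, j) = 0" using ij 3 by simp
    qed
    then show ?thesis using 3 False by (intro exI[of _ "{}"]) simp
  qed
next
  case (4 n)
  have "coordinates (ncols s) k (jordan_block k a) (1\<^sub>m k) (summand_pair s) {}"
  proof (rule coordinates_emptyI)
    fix V i j assume V: "V \<in> Eigen_sols a s" and ij: "i < ncols s" "j < k"
    have eq: "a * (if Suc i < n then V $$ (Suc i, j) else 0) + (if j = 0 then 0 else if Suc i < n then V $$ (Suc i, j - 1) else 0)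
      = V $$ (i, j)" if "i < n" "j < k" for i j using V that unfolding 4 eigen_sols_iff by blast
    have "i < n" using ij 4 by simp
    then show "V $$ (i, j) = 0" using ij(2)
    proof (induction "n - i" arbitrary: i j rule: less_induct)
      case less
      have "V $$ (Suc i, j) = 0" if "Suc i < n" "j < k" for j
        by (rule less.hyps) (use that less.prems in auto)
      then show ?case using eq[of i j] less.prems by (simp split: if_splits)
    qed
  qed
  then show ?thesis using 4 by (intro exI[of _ "{}"]) simp
qed

text \<open>Now multiplication by \<open>y\<close> stands on the side of the second matrix: for
  \<open>L_n\<close> row \<open>i\<close> is \<open>y\<close> times row \<open>i + 1\<close>, so the
  last row is the free one.\<close>

lemma coordinates_eigen_inf:
  assumes "1 \<le> summand_index s"
  shows "\<exists>Z. coordinates (ncols s) k (1\<^sub>m k) (jordan_block k 0) (summand_pair s) Z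
    \<and> card Z = (case s of SL n \<Rightarrow> k | SLT n \<Rightarrow> 0 | SD n \<mu> \<Rightarrow> if \<mu> = Infty then min n k else 0)"
proof (cases s rule: summand_pair.cases)
  case (1 n)
  have n: "1 \<le> n" using assms by (simp add: 1)
  let ?Z = "{n - 1} \<times> {..<k}"
  have "coordinates (ncols s) k (1\<^sub>m k) (jordan_block k 0) (summand_pair s) ?Z"
  proof (rule coordinatesI[where W = "\<lambda>z (i, j). if i + j = n - 1 + snd z then 1 else 0"])
    fix V i j assume V: "V \<in> Eigen_sols_inf s" "\<And>z. z \<in> ?Z \<Longrightarrow> V $$ z = 0" and ij: "i < ncols s" "j < k"
    have eq: "V $$ (i, j) = (if j = 0 then 0 else V $$ (Suc i, j - 1))"
      if "i < n - 1" "j < k" for i j using V(1) that unfolding 1 eigen_sols_inf_iff by blast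
    have "i < n" using ij 1 by simp
    then show "V $$ (i, j) = 0" using ij(2)
    proof (induction j arbitrary: i)
      case 0
      then show ?case using V(2) eq[of i 0] by (cases "i = n - 1") auto
    next
      case (Suc j)
      then show ?case using V(2) eq[of i "Suc j"] by (cases "i = n - 1") auto
    qed
  next
    fix z assume "z \<in> ?Z"
    then obtain e where e: "z = (n - 1, e)" "e < k" by auto
    show "mat (ncols s) k (\<lambda>(i, j). if i + j = n - 1 + snd z then 1 else 0) \<in> Eigen_sols_inf s"
      unfolding 1 eigen_sols_inf_iff using e n by auto
  qed (use 1 n in \<open>auto split: if_splits\<close>)
  moreover have "card ?Z = k" by simp
  ultimately show ?thesis using 1 by (intro exI[of _ ?Z]) simp
next
  case (2 n)
  have "coordinates (ncols s) k (1\<^sub>m k) (jordan_block k 0) (summand_pair s) {}"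
  proof (rule coordinates_emptyI)
    fix V i j assume V: "V \<in> Eigen_sols_inf s" and ij: "i < ncols s" "j < k"
    have eq: "(if i < n - 1 then V $$ (i, j) else 0) = (if j = 0 then 0 else if i = 0 then 0 else V $$ (i - 1, j - 1))"
      if "i < n" "j < k" for i j using V that unfolding 2 eigen_sols_inf_iff by blast
    have "i < n - 1" using ij 2 by simp
    then show "V $$ (i, j) = 0" using ij(2)
    proof (induction i arbitrary: j)
      case 0
      then show ?case using eq[of 0 j] by simp
    next
      case (Suc i)
      then show ?case using eq[of "Suc i" j] by (cases j) simp_all
    qed
  qed
  then show ?thesis using 2 by (intro exI[of _ "{}"]) simp
next
  case (3 n b)
  have "coordinates (ncols s) k (1\<^sub>m k) (jordan_block k 0) (summand_pair s) {}"
  proof (rule coordinates_emptyI)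
    fix V i j assume V: "V \<in> Eigen_sols_inf s" and ij: "i < ncols s" "j < k"
    have eq: "V $$ (i, j) = (if j = 0 then 0 else b * V $$ (i, j - 1) + (if Suc i < n then V $$ (Suc i, j - 1) else 0))"
      if "i < n" "j < k" for i j using V that unfolding 3 eigen_sols_inf_iff by blast
    have "i < n" using ij 3 by simp
    then show "V $$ (i, j) = 0" using ij(2)
    proof (induction j arbitrary: i)
      case 0
      then show ?case using eq[of i 0] by simp
    next
      case (Suc j)
      then show ?case using eq[of i "Suc j"] by simp
    qed
  qed
  then show ?thesis using 3 by (intro exI[of _ "{}"]) simp
next
  case (4 n)
  have n: "1 \<le> n" using assms by (simp add: 4)
  show ?thesis
    using coordinates_diagonal[OF n, of "1\<^sub>m k" "jordan_block k 0" "summand_pair s"]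
      eigen_sols_inf_iff(4)[of _ n] by (simp add: 4)
qed

end

section \<open>From dimensions to the numerical conditions\<close>

lemma sum_list_deficit:
  "sum_list (map (\<lambda>s. case s of SL n \<Rightarrow> Suc k - n | _ \<Rightarrow> 0) ss) = deficit k (sl (mset ss))"
proof (induction ss)
  case (Cons s ss)
  then show ?case by (cases s) simp_all
qed simp

lemma sum_list_eigen:
  "sum_list (map (\<lambda>s. case s of SL n \<Rightarrow> k | SLT n \<Rightarrow> 0 | SD n \<nu> \<Rightarrow> if \<nu> = \<mu> then min n k else 0) ss)
    = k * size (sl (mset ss)) + trunc_sum k (sd \<mu> (mset ss))"
proof (induction ss)
  case (Cons s ss)
  then show ?case by (cases s) simp_all
qed simp

lemma orbit_le_sizes:
  assumes "orbit_le (kronecker_pair as) (kronecker_pair bs)"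
  shows "total_rows as = total_rows bs" "total_cols as = total_cols bs"
  using orbit_le_in_pairs[OF kronecker_pair_in_pairs kronecker_pair_in_pairs assms] by auto

lemma orbit_le_coordinates:
  assumes le: "orbit_le (kronecker_pair as) (kronecker_pair bs)"
    and X: "X \<in> carrier_mat k l" and Y: "Y \<in> carrier_mat k l" and ss: "summands as" "summands bs"
    and coord: "\<And>s. 1 \<le> summand_index s \<Longrightarrow> \<exists>Z. coordinates (ncols s) k X Y (summand_pair s) Z \<and> card Z = f s"
  shows "sum_list (map f bs) \<le> sum_list (map f as)"
proof -
  have as: "kronecker_pair as \<in> pairs (total_rows bs) (total_cols bs)"
    using kronecker_pair_in_pairs[of as] orbit_le_sizes[OF le] by simp
  obtain Z where Z: "coordinates (total_cols bs) k X Y (kronecker_pair as) Z" "card Z = sum_list (map f as)"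
    using coordinates_kronecker_pair[OF X Y, of as f] coord ss(1) orbit_le_sizes[OF le]
    unfolding summands_def by auto
  obtain Z' where Z': "coordinates (total_cols bs) k X Y (kronecker_pair bs) Z'" "card Z' = sum_list (map f bs)"
    using coordinates_kronecker_pair[OF X Y, of bs f] coord ss(2) unfolding summands_def by auto
  show ?thesis
    using coordinates_semicontinuous[OF as kronecker_pair_in_pairs le X Y Z(1) Z'(1)] Z(2) Z'(2) by simp
qed

lemma orbit_le_deficit:
  assumes "orbit_le (kronecker_pair as) (kronecker_pair bs)" "summands as" "summands bs"
  shows "deficit k (sl (mset bs)) \<le> deficit k (sl (mset as))"
  using orbit_le_coordinates[OF assms(1) _ _ assms(2,3) coordinates_chain] L_mat_carrier[of "Suc k"] R_mat_carrier[of "Suc k"]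
  unfolding sum_list_deficit by simp

lemma sl_dual: "sl (mset (map dual ss)) = slt (mset ss)"
proof (induction ss)
  case (Cons s ss)
  then show ?case by (cases s) simp_all
qed simp

text \<open>Transposition is a homeomorphism that carries orbits to orbits, and \<open>dual\<close>
  gives the canonical form of the transposed pair. The inequalities for \<open>L\<close>-summands
  thereby become those for \<open>L^T\<close>-summands.\<close>

lemma orbit_le_dual:
  assumes "orbit_le (kronecker_pair as) (kronecker_pair bs)"
  shows "orbit_le (kronecker_pair (map dual as)) (kronecker_pair (map dual bs))"
proof -
  let ?A = "kronecker_pair as" and ?B = "kronecker_pair bs"
  note sizes = orbit_le_sizes[OF assms]
  have A: "?A \<in> pairs (total_rows bs) (total_cols bs)" and B: "?B \<in> pairs (total_rows bs) (total_cols bs)"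
    using kronecker_pair_in_pairs[of as] kronecker_pair_in_pairs[of bs] sizes by simp_all
  note At = transpose_pair_in_pairs[OF A] and Bt = transpose_pair_in_pairs[OF B]
  have "orbit_le (transpose_pair ?A) (transpose_pair ?B)" by (rule orbit_le_transpose[OF A B assms])
  moreover have dA: "pair_equiv (kronecker_pair (map dual as)) (transpose_pair ?A)"
    by (rule pair_equiv_sym[OF At transpose_kronecker_pair])
  moreover have Ad: "kronecker_pair (map dual as) \<in> pairs (total_cols bs) (total_rows bs)"
    by (rule pair_equiv_in_pairs[OF At transpose_kronecker_pair])
  moreover have "orbit_le (transpose_pair ?B) (kronecker_pair (map dual bs))"
    by (rule orbit_le_of_equiv[OF Bt transpose_kronecker_pair])
  moreover have Bd: "kronecker_pair (map dual bs) \<in> pairs (total_cols bs) (total_rows bs)"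
    by (rule pair_equiv_in_pairs[OF Bt transpose_kronecker_pair])
  ultimately show ?thesis
    using orbit_le_trans[OF Ad At Bd] orbit_le_trans[OF At Bt Bd] orbit_le_of_equiv[OF Ad dA] by blast
qed

lemma orbit_le_eigen:
  assumes "orbit_le (kronecker_pair as) (kronecker_pair bs)" "summands as" "summands bs"
  shows "k * size (sl (mset bs)) + trunc_sum k (sd \<mu> (mset bs)) \<le> k * size (sl (mset as)) + trunc_sum k (sd \<mu> (mset as))"
proof (cases \<mu>)
  case (Fin a)
  show ?thesis
    using orbit_le_coordinates[OF assms(1) _ _ assms(2,3) coordinates_eigen[of _ k a], of k]
    unfolding sum_list_eigen Fin by simp
next
  case Infty
  show ?thesis
    using orbit_le_coordinates[OF assms(1) _ _ assms(2,3) coordinates_eigen_inf[of _ k], of k]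
    unfolding sum_list_eigen Infty by simp
qed

text \<open>\<open>L_n\<close> lacks one row and \<open>L_n^T\<close> lacks one column, so their
  numbers correct the row and column counts. Equality of sizes then gives the last two conditions of
  \<open>dominates\<close>.\<close>

lemma total_eq:
  assumes "summands ss"
  shows "total_rows ss + size (sl (mset ss)) = sum_mset (sl (mset ss)) + sum_mset (slt (mset ss)) + dtotal (mset ss)"
    and "total_cols ss + size (slt (mset ss)) = sum_mset (sl (mset ss)) + sum_mset (slt (mset ss)) + dtotal (mset ss)"
proof -
  have "total_rows ss + size (sl (mset ss)) = sum_mset (sl (mset ss)) + sum_mset (slt (mset ss)) + dtotal (mset ss)
    \<and> total_cols ss + size (slt (mset ss)) = sum_mset (sl (mset ss)) + sum_mset (slt (mset ss)) + dtotal (mset ss)"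
    using assms
  proof (induction ss)
    case (Cons s ss)
    then show ?case by (cases s) (auto simp: summands_def)
  qed simp
  then show "total_rows ss + size (sl (mset ss)) = sum_mset (sl (mset ss)) + sum_mset (slt (mset ss)) + dtotal (mset ss)"
    and "total_cols ss + size (slt (mset ss)) = sum_mset (sl (mset ss)) + sum_mset (slt (mset ss)) + dtotal (mset ss)"
    by auto
qed

theorem orbit_le_imp_dominates:
  assumes "orbit_le (kronecker_pair as) (kronecker_pair bs)" "summands as" "summands bs"
  shows "dominates (mset as) (mset bs)"
proof -
  have "summands (map dual ss)" if "summands ss" for ss
  proof -
    have "summand_index (dual s) = summand_index s" for s by (cases s) simp_all
    then show ?thesis using that by (simp add: summands_def)
  qed
  then have "deficit k (slt (mset bs)) \<le> deficit k (slt (mset as))" for k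
    using orbit_le_deficit[OF orbit_le_dual[OF assms(1)], of k] assms(2,3) unfolding sl_dual by simp
  then show ?thesis
    unfolding dominates_def
    using orbit_le_deficit[OF assms] orbit_le_eigen[OF assms] orbit_le_sizes[OF assms(1)]
      total_eq[OF assms(2)] total_eq[OF assms(3)] by simp
qed

section \<open>Canonical forms from polynomial homomorphisms\<close>

text \<open>The image of column \<open>j\<close> of \<open>A\<close> under the linear map that sends
  the basis vector \<open>i\<close> to \<open>g i\<close>.\<close>

definition comb :: "complex mat \<Rightarrow> (nat \<Rightarrow> complex poly) \<Rightarrow> nat \<Rightarrow> complex poly" where
  "comb A g j = (\<Sum>i<dim_row A. Polynomial.smult (A $$ (i, j)) (g i))"

text \<open>Polynomial description of a homomorphism from the pair to an indecomposable pair: the \<open>i\<close>-th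
  basis vector of the codomain is sent to \<open>g i\<close>. The target \<open>(L_c^T, R_c^T)\<close> is the inclusion and the
  multiplication by \<open>x\<close> from polynomials of degree \<open>< c - 1\<close> to those of degree \<open>< c\<close>; the target
  \<open>(I, J_c(a))\<close> is \<open>\<complex>[y]/y\<^sup>c\<close> with the identity and the multiplication by \<open>x = a + y\<close>.\<close>
fun poly_hom :: "mat_pair \<Rightarrow> summand \<Rightarrow> (nat \<Rightarrow> complex poly) \<Rightarrow> bool" where
  "poly_hom (A, B) (SLT c) g \<longleftrightarrow> (\<forall>j<dim_col A. comb B g j = pCons 0 (comb A g j) \<and>
     (\<forall>t\<ge>c - 1. coeff (comb A g j) t = 0))"
| "poly_hom (A, B) (SD c (Fin a)) g \<longleftrightarrow> (\<forall>j<dim_col A. \<forall>t<c.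
     coeff (comb B g j) t = coeff (Polynomial.smult a (comb A g j) + pCons 0 (comb A g j)) t)"
| "poly_hom (A, B) (SD c Infty) g \<longleftrightarrow> (\<forall>j<dim_col A. \<forall>t<c.
     coeff (comb A g j) t = coeff (pCons 0 (comb B g j)) t)"
| "poly_hom P (SL c) g \<longleftrightarrow> False"

definition hom_mats :: "mat_pair \<Rightarrow> nat \<Rightarrow> nat \<Rightarrow> mat_pair \<Rightarrow> nat \<Rightarrow> nat \<Rightarrow> complex mat \<Rightarrow> complex mat \<Rightarrow> bool" where
  "hom_mats P M N Q r c S T \<longleftrightarrow> S \<in> carrier_mat r M \<and> T \<in> carrier_mat c N \<and>
    S * fst P = fst Q * T \<and> S * snd P = snd Q * T"

lemma coeff_comb: "coeff (comb A g j) t = (\<Sum>i<dim_row A. coeff (g i) t * A $$ (i, j))"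
  by (simp add: comb_def coeff_sum mult.commute)

lemma mat_coeff_mult:
  assumes "A \<in> carrier_mat M N"
  shows "mat r M (\<lambda>(s, i). coeff (g i) (\<sigma> s)) * A = mat r N (\<lambda>(s, j). coeff (comb A g j) (\<sigma> s))"
  by (rule eq_matI) (use assms in \<open>auto simp: coeff_comb scalar_prod_def atLeast0LessThan\<close>)

text \<open>\<open>S\<close> lists the coefficients of the \<open>g i\<close>, and \<open>T\<close>
  those of the images of columns under the member that corresponds to the identity or the inclusion
  in the target. Jordan targets list coefficients from the highest degree down: their Jordan blocks
  are upper triangular, whereas multiplication by \<open>y\<close> raises degrees.\<close>

lemma poly_hom_mats:
  assumes P: "P \<in> pairs M N" and h: "poly_hom P t g"
  shows "\<exists>S T. hom_mats P M N (summand_pair t) (nrows t) (ncols t) S T \<and>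
    (\<forall>u. S *\<^sub>v vec M u = 0\<^sub>v (nrows t) \<longrightarrow> (\<forall>s<summand_index t. (\<Sum>i<M. u i * coeff (g i) s) = 0))"
proof -
  obtain A B where AB: "P = (A, B)" "A \<in> carrier_mat M N" "B \<in> carrier_mat M N"
    using P by (auto simp: pairs_def)
  have dA: "dim_col A = N" using AB by simp
  have ker: "(\<Sum>i<M. u i * coeff (g i) (\<sigma> s)) = 0"
    if "mat r M (\<lambda>(s, i). coeff (g i) (\<sigma> s)) *\<^sub>v vec M u = 0\<^sub>v r" "s < r" for r \<sigma> u s
    using arg_cong[OF that(1), of "\<lambda>v. v $ s"] that(2)
    by (simp add: scalar_prod_def atLeast0LessThan mult.commute)
  have rev: "\<exists>s'<c. c - 1 - s' = s" if "s < c" for s c :: nat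
    using that by (intro exI[of _ "c - 1 - s"]) auto
  show ?thesis
  proof (cases t rule: summand_pair.cases)
    case (1 c)
    then show ?thesis using h AB(1) by simp
  next
    case (2 c)
    define S where "S = mat c M (\<lambda>(s, i). coeff (g i) s)"
    define T where "T = mat (c - 1) N (\<lambda>(s, j). coeff (comb A g j) s)"
    have hom: "comb B g j = pCons 0 (comb A g j)" "\<And>t. c - 1 \<le> t \<Longrightarrow> coeff (comb A g j) t = 0" if "j < N" for j
      using h that dA unfolding AB(1) 2 poly_hom.simps by auto
    have Tc: "T \<in> carrier_mat (c - 1) N" by (simp add: T_def)
    have "S * A = (L_mat c)\<^sup>T * T"
      unfolding L_mat_transpose_mult[OF Tc] S_def mat_coeff_mult[OF AB(2)]
      by (rule eq_matI) (auto simp: T_def hom)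
    moreover have "S * B = (R_mat c)\<^sup>T * T"
      unfolding R_mat_transpose_mult[OF Tc] S_def mat_coeff_mult[OF AB(3)]
      by (rule eq_matI) (auto simp: T_def hom coeff_pCons split: nat.split)
    ultimately have "hom_mats P M N (summand_pair t) (nrows t) (ncols t) S T"
      by (simp add: hom_mats_def 2 AB(1) S_def T_def)
    then show ?thesis using ker[of c "\<lambda>s. s"] 2 by (auto simp: S_def intro!: exI)
  next
    case (3 c a)
    define S where "S = mat c M (\<lambda>(s, i). coeff (g i) (c - 1 - s))"
    define T where "T = mat c N (\<lambda>(s, j). coeff (comb A g j) (c - 1 - s))"
    have hom: "coeff (comb B g j) t = coeff (Polynomial.smult a (comb A g j) + pCons 0 (comb A g j)) t"
      if "j < N" "t < c" for j t
      using h that dA unfolding AB(1) 3 poly_hom.simps by auto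
    have Tc: "T \<in> carrier_mat c N" by (simp add: T_def)
    have "S * A = 1\<^sub>m c * T"
      unfolding S_def mat_coeff_mult[OF AB(2)] left_mult_one_mat[OF Tc] by (simp add: T_def)
    moreover have "S * B = jordan_block c a * T"
      unfolding jordan_block_mult[OF Tc] S_def mat_coeff_mult[OF AB(3)]
    proof (rule eq_matI)
      fix s j
      assume "s < dim_row (mat c N (\<lambda>(i, j). a * T $$ (i, j) + (if Suc i < c then T $$ (Suc i, j) else 0)))"
        and "j < dim_col (mat c N (\<lambda>(i, j). a * T $$ (i, j) + (if Suc i < c then T $$ (Suc i, j) else 0)))"
      then have sj: "s < c" "j < N" by simp_all
      have "coeff (pCons 0 (comb A g j)) (c - 1 - s) = (if Suc s < c then T $$ (Suc s, j) else 0)"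
      proof (cases "Suc s < c")
        case True
        then have "c - 1 - s = Suc (c - 1 - Suc s)" by simp
        then show ?thesis using True sj by (simp add: T_def)
      next
        case False
        then have "c - 1 - s = 0" using sj by simp
        then show ?thesis using False by simp
      qed
      then show "mat c N (\<lambda>(s, j). coeff (comb B g j) (c - 1 - s)) $$ (s, j) =
          mat c N (\<lambda>(i, j). a * T $$ (i, j) + (if Suc i < c then T $$ (Suc i, j) else 0)) $$ (s, j)"
        using sj hom[of j "c - 1 - s"] by (simp add: T_def)
    qed simp_all
    ultimately have "hom_mats P M N (summand_pair t) (nrows t) (ncols t) S T"
      by (simp add: hom_mats_def 3 AB(1) S_def T_def)
    moreover have "\<forall>s<summand_index t. (\<Sum>i<M. u i * coeff (g i) s) = 0" if "S *\<^sub>v vec M u = 0\<^sub>v (nrows t)" for u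
    proof (intro allI impI)
      fix s assume "s < summand_index t"
      then obtain s' where "s' < c" "c - 1 - s' = s" using rev[of s c] 3 by auto
      then show "(\<Sum>i<M. u i * coeff (g i) s) = 0"
        using ker[of c "\<lambda>s. c - 1 - s" u s'] that 3 by (simp add: S_def)
    qed
    ultimately show ?thesis by blast
  next
    case (4 c)
    define S where "S = mat c M (\<lambda>(s, i). coeff (g i) (c - 1 - s))"
    define T where "T = mat c N (\<lambda>(s, j). coeff (comb B g j) (c - 1 - s))"
    have hom: "coeff (comb A g j) t = coeff (pCons 0 (comb B g j)) t"
      if "j < N" "t < c" for j t
      using h that dA unfolding AB(1) 4 poly_hom.simps by auto
    have Tc: "T \<in> carrier_mat c N" by (simp add: T_def)
    have "S * B = 1\<^sub>m c * T"
      unfolding S_def mat_coeff_mult[OF AB(3)] left_mult_one_mat[OF Tc] by (simp add: T_def)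
    moreover have "S * A = jordan_block c 0 * T"
      unfolding jordan_block_mult[OF Tc] S_def mat_coeff_mult[OF AB(2)]
    proof (rule eq_matI)
      fix s j
      assume "s < dim_row (mat c N (\<lambda>(i, j). 0 * T $$ (i, j) + (if Suc i < c then T $$ (Suc i, j) else 0)))"
        and "j < dim_col (mat c N (\<lambda>(i, j). 0 * T $$ (i, j) + (if Suc i < c then T $$ (Suc i, j) else 0)))"
      then have sj: "s < c" "j < N" by simp_all
      have "coeff (pCons 0 (comb B g j)) (c - 1 - s) = (if Suc s < c then T $$ (Suc s, j) else 0)"
      proof (cases "Suc s < c")
        case True
        then have "c - 1 - s = Suc (c - 1 - Suc s)" by simp
        then show ?thesis using True sj by (simp add: T_def)
      next
        case False
        then have "c - 1 - s = 0" using sj by simp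
        then show ?thesis using False by simp
      qed
      then show "mat c N (\<lambda>(s, j). coeff (comb A g j) (c - 1 - s)) $$ (s, j) =
          mat c N (\<lambda>(i, j). 0 * T $$ (i, j) + (if Suc i < c then T $$ (Suc i, j) else 0)) $$ (s, j)"
        using sj hom[of j "c - 1 - s"] by simp
    qed simp_all
    ultimately have "hom_mats P M N (summand_pair t) (nrows t) (ncols t) S T"
      by (simp add: hom_mats_def 4 AB(1) S_def T_def)
    moreover have "\<forall>s<summand_index t. (\<Sum>i<M. u i * coeff (g i) s) = 0" if "S *\<^sub>v vec M u = 0\<^sub>v (nrows t)" for u
    proof (intro allI impI)
      fix s assume "s < summand_index t"
      then obtain s' where "s' < c" "c - 1 - s' = s" using rev[of s c] 4 by auto
      then show "(\<Sum>i<M. u i * coeff (g i) s) = 0"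
        using ker[of c "\<lambda>s. c - 1 - s" u s'] that 4 by (simp add: S_def)
    qed
    ultimately show ?thesis by blast
  qed
qed

lemma hom_mats_oplus:
  assumes P: "P \<in> pairs M N" and Q: "Q \<in> pairs r c" and Q': "Q' \<in> pairs r' c'"
    and S: "hom_mats P M N Q r c S T" and S': "hom_mats P M N Q' r' c' S' T'"
  shows "hom_mats P M N (oplus Q Q') (r + r') (c + c') (S @\<^sub>r S') (T @\<^sub>r T')"
proof -
  have c: "S \<in> carrier_mat r M" "T \<in> carrier_mat c N" "S' \<in> carrier_mat r' M" "T' \<in> carrier_mat c' N"
    using S S' by (auto simp: hom_mats_def)
  have *: "(S @\<^sub>r S') * A = diag_block K K' * (T @\<^sub>r T')"
    if "A \<in> carrier_mat M N" "K \<in> carrier_mat r c" "K' \<in> carrier_mat r' c'" "S * A = K * T" "S' * A = K' * T'"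
    for A K K'
    using append_rows_mult[OF c(1,3) that(1)] diag_block_mult_append_rows[OF that(2,3) c(2,4)] that(4,5) by simp
  have d: "fst P \<in> carrier_mat M N" "snd P \<in> carrier_mat M N" "fst Q \<in> carrier_mat r c" "snd Q \<in> carrier_mat r c"
    "fst Q' \<in> carrier_mat r' c'" "snd Q' \<in> carrier_mat r' c'"
    using P Q Q' by (auto simp: pairs_def)
  show ?thesis
    unfolding hom_mats_def oplus_def fst_conv snd_conv
    using *[OF d(1,3,5)] *[OF d(2,4,6)] S S' c by (simp add: hom_mats_def)
qed

lemma append_rows_ker:
  assumes "S \<in> carrier_mat r M" "S' \<in> carrier_mat r' M" "u \<in> carrier_vec M"
    and "(S @\<^sub>r S') *\<^sub>v u = (0\<^sub>v (r + r') :: complex vec)"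
  shows "S *\<^sub>v u = 0\<^sub>v r" "S' *\<^sub>v u = 0\<^sub>v r'"
proof -
  have d: "dim_row (S @\<^sub>r S') = r + r'" "dim_col (S @\<^sub>r S') = M" using assms by (auto simp: append_rows_def)
  have e: "(\<Sum>a<M. (S @\<^sub>r S') $$ (i, a) * u $ a) = 0" if "i < r + r'" for i
    using arg_cong[OF assms(4), of "\<lambda>v. v $ i"] that assms(3) d
    by (simp add: scalar_prod_def atLeast0LessThan)
  show "S *\<^sub>v u = 0\<^sub>v r"
  proof (rule eq_vecI)
    fix i assume "i < dim_vec (0\<^sub>v r :: complex vec)"
    then have i: "i < r" by simp
    have "(\<Sum>a<M. S $$ (i, a) * u $ a) = (\<Sum>a<M. (S @\<^sub>r S') $$ (i, a) * u $ a)"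
      by (rule sum.cong) (use append_rows_index[OF assms(1,2)] i in auto)
    then show "(S *\<^sub>v u) $ i = 0\<^sub>v r $ i"
      using e[of i] i assms by (simp add: scalar_prod_def atLeast0LessThan)
  qed (use assms in auto)
  show "S' *\<^sub>v u = 0\<^sub>v r'"
  proof (rule eq_vecI)
    fix i assume "i < dim_vec (0\<^sub>v r' :: complex vec)"
    then have i: "i < r'" by simp
    have "(\<Sum>a<M. S' $$ (i, a) * u $ a) = (\<Sum>a<M. (S @\<^sub>r S') $$ (r + i, a) * u $ a)"
      by (rule sum.cong) (use append_rows_index[OF assms(1,2)] i in auto)
    then show "(S' *\<^sub>v u) $ i = 0\<^sub>v r' $ i"
      using e[of "r + i"] i assms by (simp add: scalar_prod_def atLeast0LessThan)
  qed (use assms in auto)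
qed

lemma poly_homs_mats:
  assumes P: "P \<in> pairs M N" and "\<And>t g. (t, g) \<in> set tgs \<Longrightarrow> poly_hom P t g"
  shows "\<exists>S T. hom_mats P M N (kronecker_pair (map fst tgs)) (total_rows (map fst tgs)) (total_cols (map fst tgs)) S T \<and>
    (\<forall>u. S *\<^sub>v vec M u = 0\<^sub>v (total_rows (map fst tgs)) \<longrightarrow>
      (\<forall>(t, g)\<in>set tgs. \<forall>s<summand_index t. (\<Sum>i<M. u i * coeff (g i) s) = 0))"
  using assms(2)
proof (induction tgs)
  case Nil
  have "hom_mats P M N (kronecker_pair []) 0 0 (0\<^sub>m 0 M) (0\<^sub>m 0 N)"
    using P by (auto simp: hom_mats_def kronecker_pair_Nil pairs_def)
  then show ?case by auto
next
  case (Cons tg tgs)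
  obtain t g where tg: "tg = (t, g)" by (cases tg)
  obtain S T where S: "hom_mats P M N (summand_pair t) (nrows t) (ncols t) S T"
    "\<And>u. S *\<^sub>v vec M u = 0\<^sub>v (nrows t) \<Longrightarrow> \<forall>s<summand_index t. (\<Sum>i<M. u i * coeff (g i) s) = 0"
    using poly_hom_mats[OF P, of t g] Cons.prems[of t g] by (auto simp: tg)
  obtain S' T' where S': "hom_mats P M N (kronecker_pair (map fst tgs)) (total_rows (map fst tgs)) (total_cols (map fst tgs)) S' T'"
    "\<And>u. S' *\<^sub>v vec M u = 0\<^sub>v (total_rows (map fst tgs)) \<Longrightarrow>
      (\<forall>(t, g)\<in>set tgs. \<forall>s<summand_index t. (\<Sum>i<M. u i * coeff (g i) s) = 0)"
  proof -
    have "\<And>t g. (t, g) \<in> set tgs \<Longrightarrow> poly_hom P t g" using Cons.prems by simp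
    from Cons.IH[OF this] that show thesis by blast
  qed
  have c: "S \<in> carrier_mat (nrows t) M" "S' \<in> carrier_mat (total_rows (map fst tgs)) M"
    using S S' by (auto simp: hom_mats_def)
  have "hom_mats P M N (kronecker_pair (map fst (tg # tgs))) (total_rows (map fst (tg # tgs)))
      (total_cols (map fst (tg # tgs))) (S @\<^sub>r S') (T @\<^sub>r T')"
    using hom_mats_oplus[OF P summand_pair_in_pairs kronecker_pair_in_pairs S(1) S'(1)]
    by (simp add: tg kronecker_pair_Cons)
  moreover have "\<forall>(t, g)\<in>set (tg # tgs). \<forall>s<summand_index t. (\<Sum>i<M. u i * coeff (g i) s) = 0"
    if "(S @\<^sub>r S') *\<^sub>v vec M u = 0\<^sub>v (total_rows (map fst (tg # tgs)))" for u
    using append_rows_ker[OF c, of "vec M u"] that S(2)[of u] S'(2)[of u] by (simp add: tg)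
  ultimately show ?case by blast
qed

text \<open>Joint injectivity makes the square matrix \<open>S\<close> invertible. If
  \<open>T *\<^sub>v w = 0\<close>, then \<open>S\<close> kills \<open>A *\<^sub>v w\<close> and
  \<open>B *\<^sub>v w\<close>, so \<open>w\<close> is in the common kernel and \<open>ker\<close>
  gives \<open>w = 0\<close>. Hence \<open>T\<close> is invertible too, and the homomorphism is an
  equivalence.\<close>

theorem kcf_by_polynomials:
  assumes P: "P \<in> pairs M N" and hom: "\<And>t g. (t, g) \<in> set tgs \<Longrightarrow> poly_hom P t g"
    and ts: "ts = map fst tgs" and size: "total_rows ts = M" "total_cols ts = N"
    and inj: "\<And>u i. (\<And>t g s. (t, g) \<in> set tgs \<Longrightarrow> s < summand_index t \<Longrightarrow> (\<Sum>i<M. u i * coeff (g i) s) = 0)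
      \<Longrightarrow> i < M \<Longrightarrow> u i = 0"
    and ker: "\<And>w. w \<in> carrier_vec N \<Longrightarrow> fst P *\<^sub>v w = 0\<^sub>v M \<Longrightarrow> snd P *\<^sub>v w = 0\<^sub>v M \<Longrightarrow> w = 0\<^sub>v N"
  shows "pair_equiv P (kronecker_pair ts)"
proof -
  obtain A B where AB: "P = (A, B)" "A \<in> carrier_mat M N" "B \<in> carrier_mat M N"
    using P by (auto simp: pairs_def)
  let ?K = "kronecker_pair ts"
  have K: "fst ?K \<in> carrier_mat M N" "snd ?K \<in> carrier_mat M N"
    using kronecker_pair_in_pairs[of ts] size by (auto simp: pairs_def)
  obtain S T where S: "hom_mats P M N ?K M N S T"
    "\<And>u. S *\<^sub>v vec M u = 0\<^sub>v M \<Longrightarrow> \<forall>(t, g)\<in>set tgs. \<forall>s<summand_index t. (\<Sum>i<M. u i * coeff (g i) s) = 0"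
    using poly_homs_mats[OF P, of tgs] hom size unfolding ts by auto
  have c: "S \<in> carrier_mat M M" "T \<in> carrier_mat N N" and e: "S * A = fst ?K * T" "S * B = snd ?K * T"
    using S(1) AB by (auto simp: hom_mats_def)
  have injS: "u = 0\<^sub>v M" if "u \<in> carrier_vec M" "S *\<^sub>v u = 0\<^sub>v M" for u
  proof -
    have u: "u = vec M (\<lambda>i. u $ i)" using that(1) by auto
    then have "\<forall>(t, g)\<in>set tgs. \<forall>s<summand_index t. (\<Sum>i<M. u $ i * coeff (g i) s) = 0"
      using S(2)[of "\<lambda>i. u $ i"] that(2) by simp
    then have "u $ i = 0" if "i < M" for i using inj[of "\<lambda>i. u $ i" i] that by blast
    then show ?thesis using that(1) by (intro eq_vecI) auto
  qed
  have injT: "w = 0\<^sub>v N" if w: "w \<in> carrier_vec N" "T *\<^sub>v w = 0\<^sub>v N" for w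
  proof -
    have "C *\<^sub>v w = 0\<^sub>v M" if C: "C \<in> carrier_mat M N" "S * C = K' * T" "K' \<in> carrier_mat M N" for C K'
    proof (rule injS)
      show "C *\<^sub>v w \<in> carrier_vec M" using C w by auto
      have "S *\<^sub>v (C *\<^sub>v w) = (S * C) *\<^sub>v w" by (rule assoc_mult_mat_vec[symmetric]) (use c C w in auto)
      also have "\<dots> = K' *\<^sub>v (T *\<^sub>v w)" unfolding C(2) by (rule assoc_mult_mat_vec) (use c C w in auto)
      also have "\<dots> = 0\<^sub>v M" using w C by (auto simp: scalar_prod_def)
      finally show "S *\<^sub>v (C *\<^sub>v w) = 0\<^sub>v M" .
    qed
    then have "A *\<^sub>v w = 0\<^sub>v M" "B *\<^sub>v w = 0\<^sub>v M" using AB e K by blast+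
    then show ?thesis using ker w AB(1) by simp
  qed
  obtain S' where S': "mutual_inverse M S S'" using mutual_inverse_of_inj[OF c(1) injS] by blast
  obtain T' where T': "mutual_inverse N T T'" using mutual_inverse_of_inj[OF c(2) injT] by blast
  have "C * T * T' = C" if "C \<in> carrier_mat M N" for C
  proof -
    have "C * T * T' = C * (T * T')" by (rule assoc_mult_mat) (use that T' in \<open>auto simp: mutual_inverse_def\<close>)
    then show ?thesis using that T' by (simp add: mutual_inverse_def)
  qed
  then have "act S P T' = ?K"
    using e K by (simp add: act_def AB(1) del: assoc_mult_mat)
  then show ?thesis using pair_equivI[OF P S' mutual_inverse_sym[OF T']] by simp
qed

section \<open>Replacements (i), (iii) and (v)\<close>

lemma sum_lessThan_add: "(\<Sum>i<a + b. f i) = (\<Sum>i<a. f i) + (\<Sum>i<b. f (a + i :: nat) :: 'a::comm_monoid_add)"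
  by (induction b) (simp_all add: add.assoc)

lemma all_less_add: "(\<forall>j<a + b. Q j) \<longleftrightarrow> (\<forall>j<a. Q j) \<and> (\<forall>j<b. Q (a + j :: nat))"
  by (metis add_less_cancel_left le_add_diff_inverse not_le trans_less_add1)

definition glue :: "nat \<Rightarrow> (nat \<Rightarrow> 'a) \<Rightarrow> (nat \<Rightarrow> 'a) \<Rightarrow> nat \<Rightarrow> 'a" where
  "glue m e f = (\<lambda>i. if i < m then e i else f (i - m))"

lemma glue_simps [simp]: "i < m \<Longrightarrow> glue m e f i = e i" "glue m e f (m + i) = f i"
  by (simp_all add: glue_def)

lemma sum_glue: "(\<Sum>i<m + n. u i * coeff (glue m e f i) s) =
    (\<Sum>i<m. u i * coeff (e i) s) + (\<Sum>i<n. u (m + i) * coeff (f i) s :: complex)"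
  by (simp add: sum_lessThan_add)

lemma comb_upper_block:
  assumes "X \<in> carrier_mat m1 n1" "Z \<in> carrier_mat m1 n2" "Y \<in> carrier_mat m2 n2"
  shows "j < n1 \<Longrightarrow> comb (upper_block X Z Y) (glue m1 e f) j = comb X e j"
    and "j < n2 \<Longrightarrow> comb (upper_block X Z Y) (glue m1 e f) (n1 + j) = comb Z e j + comb Y f j"
  using assms by (simp_all add: comb_def upper_block_def sum_lessThan_add)

lemma upper_block_zero:
  "X \<in> carrier_mat m1 n1 \<Longrightarrow> Y \<in> carrier_mat m2 n2 \<Longrightarrow> upper_block X (0\<^sub>m m1 n2) Y = diag_block X Y"
  by (simp add: upper_block_def diag_block_def)

lemma upper_block_carrier:
  "X \<in> carrier_mat m1 n1 \<Longrightarrow> Y \<in> carrier_mat m2 n2 \<Longrightarrow> upper_block X Z Y \<in> carrier_mat (m1 + m2) (n1 + n2)"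
  by (auto simp: upper_block_def)

lemma comb_single:
  assumes "k < dim_row A" "\<And>i. i < dim_row A \<Longrightarrow> A $$ (i, j) = (if i = k then c else 0)"
  shows "comb A g j = Polynomial.smult c (g k)"
proof -
  have "comb A g j = (\<Sum>i<dim_row A. if i = k then Polynomial.smult c (g k) else 0)"
    unfolding comb_def by (rule sum.cong) (use assms in auto)
  then show ?thesis using assms(1) by simp
qed

lemma comb_zero:
  assumes "\<And>i. i < dim_row A \<Longrightarrow> A $$ (i, j) = 0"
  shows "comb A g j = 0"
  unfolding comb_def using assms by simp

lemma comb_L_transpose: "j < m - 1 \<Longrightarrow> comb (L_mat m)\<^sup>T g j = g j"
  by (subst comb_single[of j _ _ 1]) (auto simp: L_mat_def)

lemma comb_R_transpose: "j < m - 1 \<Longrightarrow> comb (R_mat m)\<^sup>T g j = g (Suc j)"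
  by (subst comb_single[of "Suc j" _ _ 1]) (auto simp: R_mat_def)

lemma comb_L: "j < n \<Longrightarrow> comb (L_mat n) g j = (if j < n - 1 then g j else 0)"
  by (cases "j < n - 1")
    (subst comb_single[of j _ _ 1], auto simp: L_mat_def intro!: comb_zero)

lemma comb_R: "j < n \<Longrightarrow> comb (R_mat n) g j = (if j = 0 then 0 else g (j - 1))"
proof (cases "j = 0")
  case True
  assume "j < n"
  with True show ?thesis by (simp, intro comb_zero) (auto simp: R_mat_def)
next
  case False
  assume "j < n"
  with False show ?thesis by (subst comb_single[of "j - 1" _ _ 1]) (auto simp: R_mat_def)
qed

lemma comb_one: "j < n \<Longrightarrow> comb (1\<^sub>m n) g j = g j"
  by (subst comb_single[of j _ _ 1]) auto

lemma comb_jordan_block: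
  assumes "j < n"
  shows "comb (jordan_block n a) g j = Polynomial.smult a (g j) + (if j = 0 then 0 else g (j - 1))"
proof -
  have "comb (jordan_block n a) g j =
      (\<Sum>i<n. (if i = j then Polynomial.smult a (g j) else 0) + (if Suc i = j then g (j - 1) else 0))"
    unfolding comb_def by (rule sum.cong) (use assms in \<open>auto simp: jordan_block_index\<close>)
  then show ?thesis using assms by (cases j) (simp_all add: sum.distrib)
qed

lemma comb_zero_mat: "j < n \<Longrightarrow> comb (0\<^sub>m m n) g j = 0"
  by (rule comb_zero) simp

lemma comb_corner:
  assumes "j < n" "0 < m"
  shows "comb (\<epsilon> \<cdot>\<^sub>m corner_nw m n) g j = (if j = 0 then Polynomial.smult \<epsilon> (g 0) else 0)"
    and "comb (\<epsilon> \<cdot>\<^sub>m corner_ne m n) g j = (if j = n - 1 then Polynomial.smult \<epsilon> (g 0) else 0)"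
    and "comb (\<epsilon> \<cdot>\<^sub>m corner_se m n) g j = (if j = n - 1 then Polynomial.smult \<epsilon> (g (m - 1)) else 0)"
  using assms
    comb_single[of 0 "\<epsilon> \<cdot>\<^sub>m corner_nw m n" j \<epsilon> g] comb_zero[of "\<epsilon> \<cdot>\<^sub>m corner_nw m n" j g]
    comb_single[of 0 "\<epsilon> \<cdot>\<^sub>m corner_ne m n" j \<epsilon> g] comb_zero[of "\<epsilon> \<cdot>\<^sub>m corner_ne m n" j g]
    comb_single[of "m - 1" "\<epsilon> \<cdot>\<^sub>m corner_se m n" j \<epsilon> g] comb_zero[of "\<epsilon> \<cdot>\<^sub>m corner_se m n" j g]
  by (auto simp: corner_nw_def corner_ne_def corner_se_def)

lemma left_inverse_ker:
  assumes "A \<in> carrier_mat M N" "A' \<in> carrier_mat N M" "A' * A = 1\<^sub>m N" "w \<in> carrier_vec N" "A *\<^sub>v w = 0\<^sub>v M"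
  shows "w = (0\<^sub>v N :: complex vec)"
proof -
  have "w = A' *\<^sub>v (A *\<^sub>v w)"
    using assoc_mult_mat_vec[OF assms(2,1,4)] assms(3,4) by simp
  also have "\<dots> = 0\<^sub>v N" unfolding assms(5) using assms(2) by (intro eq_vecI) (auto simp: scalar_prod_def)
  finally show ?thesis .
qed

lemma block_index_cases:
  assumes "(i :: nat) < m + n"
  obtains "i < m" | k where "i = m + k" "k < n"
  using assms by (metis add_less_cancel_left le_Suc_ex not_less)

lemma LT_carrier: "(L_mat m)\<^sup>T \<in> carrier_mat m (m - 1)" and RT_carrier: "(R_mat m)\<^sup>T \<in> carrier_mat m (m - 1)"
  using L_mat_carrier[of m] R_mat_carrier[of m] by simp_all

lemma L_mult_L_transpose: "L_mat m * (L_mat m)\<^sup>T = 1\<^sub>m (m - 1)"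
  unfolding L_mat_mult[OF LT_carrier] by (rule eq_matI) (auto simp: L_mat_def)

lemma R_mult_R_transpose: "R_mat m * (R_mat m)\<^sup>T = 1\<^sub>m (m - 1)"
  unfolding R_mat_mult[OF RT_carrier] by (rule eq_matI) (auto simp: R_mat_def)

text \<open>In (i) and (iii) one member of the pair stays block diagonal; its explicit left inverse
  shows that the common kernel is trivial.\<close>

lemma diag_block_ker:
  assumes "A \<in> carrier_mat m n" "A' \<in> carrier_mat n m" "A' * A = 1\<^sub>m n"
    and "B \<in> carrier_mat p q" "B' \<in> carrier_mat q p" "B' * B = 1\<^sub>m q"
    and "w \<in> carrier_vec (n + q)" "diag_block A B *\<^sub>v w = 0\<^sub>v (m + p)"
  shows "w = 0\<^sub>v (n + q)"
proof (rule left_inverse_ker)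
  show "diag_block A' B' * diag_block A B = 1\<^sub>m (n + q)"
    using diag_block_mult[OF assms(2,1,5,4)] assms(3,6) by (simp add: diag_block_one)
qed (use assms in auto)

lemma replacement_i_kcf:
  assumes m: "1 \<le> m" "m + 2 \<le> n" and \<epsilon>: "\<epsilon> \<noteq> 0"
  shows "pair_equiv (diag_block (L_mat m)\<^sup>T (L_mat n)\<^sup>T,
      upper_block (R_mat m)\<^sup>T (\<epsilon> \<cdot>\<^sub>m corner_nw m (n - 1)) (R_mat n)\<^sup>T)
    (kronecker_pair [SLT (m + 1), SLT (n - 1)])"
proof -
  define m' n' where "m' = m - 1" and "n' = n - 1"
  have m1: "m - 1 = m'" and n1: "n - 1 = n'" and lt: "m' < m" "m < n'" "m' + 1 = m" "n' + 1 = n"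
    using m by (auto simp: m'_def n'_def)
  let ?A = "diag_block (L_mat m)\<^sup>T (L_mat n)\<^sup>T" and ?B = "upper_block (R_mat m)\<^sup>T (\<epsilon> \<cdot>\<^sub>m corner_nw m n') (R_mat n)\<^sup>T"
  note car = LT_carrier[of m, unfolded m1] LT_carrier[of n, unfolded n1]
    RT_carrier[of m, unfolded m1] RT_carrier[of n, unfolded n1]
  have Z: "\<epsilon> \<cdot>\<^sub>m corner_nw m n' \<in> carrier_mat m n'" by (simp add: corner_nw_def)
  have A: "?A = upper_block (L_mat m)\<^sup>T (0\<^sub>m m n') (L_mat n)\<^sup>T"
    by (rule upper_block_zero[OF car(1,2), symmetric])
  have P: "(?A, ?B) \<in> pairs (m + n) (m' + n')"
    using car by (auto simp: pairs_iff intro!: upper_block_carrier)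
  then have dA: "dim_col ?A = m' + n'" by (auto simp: pairs_iff)
  note cA = comb_upper_block[OF car(1) zero_carrier_mat car(2), folded A]
  note cB = comb_upper_block[OF car(3) Z car(4)]
  note cs = cA cB comb_L_transpose[of _ m, unfolded m1] comb_R_transpose[of _ m, unfolded m1]
    comb_L_transpose[of _ n, unfolded n1] comb_R_transpose[of _ n, unfolded n1] comb_zero_mat comb_corner
  \<comment> \<open>The relations are \<open>e(i + 1) = x e(i)\<close>,
    \<open>x f(0) = f(1) + \<epsilon> e(0)\<close> and \<open>f(j + 1) = x f(j)\<close> for positive
    \<open>j\<close>. Choosing \<open>f(1) = 0\<close> leaves
    \<open>x f(0) = \<epsilon> e(0)\<close>, solved by \<open>f(0) = \<epsilon>\<close> and
    \<open>e(0) = x\<close>.\<close>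
  define e1 f1 where "e1 = (\<lambda>i. monom 1 (Suc i) :: complex poly)" and "f1 = (\<lambda>i::nat. if i = 0 then [:\<epsilon>:] else 0)"
  \<comment> \<open>The second solution has \<open>e(0) = 1\<close> and \<open>f(0) = 0\<close>,
    which forces \<open>f(1) = - \<epsilon>\<close>.\<close>
  define e2 f2 where "e2 = (\<lambda>i. monom 1 i :: complex poly)" and "f2 = (\<lambda>i::nat. if i = 0 then 0 else monom (- \<epsilon>) (i - 1))"
  let ?tgs = "[(SLT (m + 1), glue m e1 f1), (SLT n', glue m e2 f2)]"
  show ?thesis unfolding n1
  proof (rule kcf_by_polynomials[OF P, of ?tgs])
    fix t g assume "(t, g) \<in> set ?tgs"
    then consider "t = SLT (m + 1)" "g = glue m e1 f1" | "t = SLT n'" "g = glue m e2 f2" by auto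
    then show "poly_hom (?A, ?B) t g"
    proof cases
      case 1
      show ?thesis unfolding 1 poly_hom.simps dA all_less_add
        using lt by (auto simp: cs e1_def f1_def monom_Suc coeff_pCons monom_0 split: nat.splits)
    next
      case 2
      have f2_Suc: "f2 (Suc j) = pCons 0 (f2 j)" if "0 < j" for j
        using that by (cases j) (simp_all add: f2_def monom_Suc)
      have f2_1: "f2 (Suc 0) = [:- \<epsilon>:]" "f2 0 = 0" by (simp_all add: f2_def monom_0)
      have f2_c: "coeff (f2 j) t = 0" if "j < n'" "n' - 1 \<le> t" for j t using that by (auto simp: f2_def)
      have e2: "e2 (Suc j) = pCons 0 (e2 j)" "e2 0 = 1" for j by (simp_all add: e2_def monom_Suc one_pCons monom_0)
      have e2_c: "coeff (e2 j) t = 0" if "j < m'" "n' - 1 \<le> t" for j t using that lt by (auto simp: e2_def)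
      show ?thesis unfolding 2 poly_hom.simps dA all_less_add
        using lt f2_c e2_c by (auto simp: cs e2 f2_1 f2_Suc)
    qed
  next
    fix u i assume u: "\<And>t g s. (t, g) \<in> set ?tgs \<Longrightarrow> s < summand_index t \<Longrightarrow> (\<Sum>i<m + n. u i * coeff (g i) s) = 0"
      and i: "i < m + n"
    have u1: "(\<Sum>i<m. u i * coeff (e1 i) s) + (\<Sum>i<n. u (m + i) * coeff (f1 i) s) = 0" if "s < m + 1" for s
      using u[of "SLT (m + 1)" "glue m e1 f1" s] that by (simp add: sum_glue)
    have u2: "(\<Sum>i<m. u i * coeff (e2 i) s) + (\<Sum>i<n. u (m + i) * coeff (f2 i) s) = 0" if "s < n'" for s
      using u[of "SLT n'" "glue m e2 f2" s] that by (simp add: sum_glue)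
    have cf1: "coeff (f1 i) s = (if i = 0 then if s = 0 then \<epsilon> else 0 else 0)" for i s
      by (simp add: f1_def coeff_pCons split: nat.split)
    \<comment> \<open>Under the first map the coefficients of positive degree give
      \<open>u i\<close> for the first block and the constant one gives \<open>u m\<close>; the
      second map gives the rest.\<close>
    have a0: "u i = 0" if "i < m" for i
      using u1[of "Suc i"] that m by (simp add: e1_def cf1 if_distrib[of "\<lambda>x. _ * x"] cong: if_cong)
    have b0: "u m = 0"
      using u1[of 0] a0 m \<epsilon> by (simp add: cf1 if_distrib[of "\<lambda>x. _ * x"] cong: if_cong)
    have cf2: "coeff (f2 i) s = (if i = Suc s then - \<epsilon> else 0)" for i s
      by (auto simp: f2_def)
    have c0: "u (m + Suc s) = 0" if "Suc s < n" for s
      using u2[of s] that a0 \<epsilon> lt by (simp add: cf2 if_distrib[of "\<lambda>x. _ * x"] cong: if_cong)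
    from i show "u i = 0"
    proof (cases rule: block_index_cases)
      case (2 k)
      then show ?thesis using b0 c0 by (cases k) auto
    qed (rule a0)
  next
    fix w assume "w \<in> carrier_vec (m' + n')" "fst (?A, ?B) *\<^sub>v w = 0\<^sub>v (m + n)"
    then show "w = 0\<^sub>v (m' + n')"
      using diag_block_ker[OF car(1) L_mat_carrier[of m, unfolded m1] L_mult_L_transpose[of m, unfolded m1]
        car(2) L_mat_carrier[of n, unfolded n1] L_mult_L_transpose[of n, unfolded n1]] by simp
  qed (use lt in auto)
qed

lemma replacement_iii_fin_kcf:
  assumes m: "1 \<le> m" "1 \<le> n" and \<epsilon>: "\<epsilon> \<noteq> 0"
  shows "pair_equiv (diag_block (L_mat m)\<^sup>T (1\<^sub>m n),
      upper_block (R_mat m)\<^sup>T (\<epsilon> \<cdot>\<^sub>m corner_ne m n) (jordan_block n a))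
    (kronecker_pair [SLT (m + 1), SD (n - 1) (Fin a)])" (is "pair_equiv (?A, ?B) _")
proof -
  define m' n' where "m' = m - 1" and "n' = n - 1"
  have m1: "m - 1 = m'" and n1: "n - 1 = n'" and lt: "m' < m" "n' < n" "m' + 1 = m" "n' + 1 = n"
    using m by (auto simp: m'_def n'_def)
  note car = LT_carrier[of m, unfolded m1] one_carrier_mat[of n] RT_carrier[of m, unfolded m1] jordan_block_carrier[of n a]
  have Z: "\<epsilon> \<cdot>\<^sub>m corner_ne m n \<in> carrier_mat m n" by (simp add: corner_ne_def)
  have A: "?A = upper_block (L_mat m)\<^sup>T (0\<^sub>m m n) (1\<^sub>m n)"
    by (rule upper_block_zero[OF car(1,2), symmetric])
  have P: "(?A, ?B) \<in> pairs (m + n) (m' + n)"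
    using car by (auto simp: pairs_iff intro!: upper_block_carrier)
  then have dA: "dim_col ?A = m' + n" by (auto simp: pairs_iff)
  note cA = comb_upper_block[OF car(1) zero_carrier_mat car(2), folded A]
  note cB = comb_upper_block[OF car(3) Z car(4)]
  note cs = cA cB comb_L_transpose[of _ m, unfolded m1] comb_R_transpose[of _ m, unfolded m1]
    comb_one comb_jordan_block comb_zero_mat
    comb_corner(2)[of _ n m, unfolded n1] comb_corner(3)[of _ n m, unfolded n1 m1]
  \<comment> \<open>The coupling relation is
    \<open>(x - a) f(n') = f(n' - 1) + \<epsilon> e(0)\<close>. If only \<open>f(n')\<close> is
    nonzero in the second block, it is solved by \<open>f(n') = \<epsilon>\<close> and
    \<open>e(0) = x - a\<close>.\<close>
  define e1 f1 where "e1 = (\<lambda>i. monom 1 i * [:- a, 1:] :: complex poly)" and "f1 = (\<lambda>i. if i = n' then [:\<epsilon>:] else 0)"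
  \<comment> \<open>In the Jordan target \<open>x = a + y\<close> and \<open>e(0) = 1\<close>.
    Taking \<open>f(n') = 0\<close> gives \<open>f(n' - 1) = - \<epsilon>\<close>; going down
    multiplies by \<open>y\<close> until \<open>y^n' = 0\<close> satisfies the relation at index
    0.\<close>
  define e2 where "e2 = (\<lambda>i. [:a, 1:] ^ i :: complex poly)"
  define f2 where "f2 = (\<lambda>i. if i = n' then 0 else monom (- \<epsilon>) (n' - Suc i))"
  let ?tgs = "[(SLT (m + 1), glue m e1 f1), (SD n' (Fin a), glue m e2 f2)]"
  have ce1: "coeff (e1 i) s = (if Suc i = s then 1 else 0) - (if i = s then a else 0)" for i s
    unfolding e1_def coeff_monom_mult by (auto simp: coeff_pCons split: nat.splits)
  have e1_Suc: "e1 (Suc j) = pCons 0 (e1 j)" for j by (simp add: e1_def monom_Suc)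
  show ?thesis unfolding n1
  proof (rule kcf_by_polynomials[OF P, of ?tgs])
    fix t g assume "(t, g) \<in> set ?tgs"
    then consider "t = SLT (m + 1)" "g = glue m e1 f1" | "t = SD n' (Fin a)" "g = glue m e2 f2" by auto
    then show "poly_hom (?A, ?B) t g"
    proof cases
      case 1
      have e10: "e1 0 = [:- a, 1:]" by (simp add: e1_def monom_0)
      show ?thesis unfolding 1 poly_hom.simps dA all_less_add
        using lt by (auto simp: cs e1_Suc ce1 e10 f1_def coeff_pCons split: nat.splits)
    next
      case 2
      have f2_step: "coeff (if k = 0 then 0 else f2 (k - 1)) t = coeff (pCons 0 (f2 k)) t"
        if "k < n'" "t < n'" for k t
      proof (cases k)
        case 0
        then show ?thesis using that by (auto simp: f2_def monom_Suc[symmetric])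
      next
        case (Suc k')
        then have "n' - Suc k' = Suc (n' - Suc k)" using that by simp
        then show ?thesis using that Suc by (simp add: f2_def monom_Suc)
      qed
      have f2_last: "Polynomial.smult \<epsilon> 1 + (if n' = 0 then 0 else f2 (n' - 1)) = 0" if "0 < n'"
        using that by (simp add: f2_def one_pCons monom_0)
      have f2_n: "f2 n' = 0" by (simp add: f2_def)
      have e2_Suc: "e2 (Suc j) = Polynomial.smult a (e2 j) + pCons 0 (e2 j)" for j
        by (simp add: e2_def)
      have e20: "e2 0 = 1" by (simp add: e2_def)
      show ?thesis unfolding 2 poly_hom.simps dA all_less_add
      proof (intro conjI allI impI)
        fix j t assume "j < m'" "t < n'"
        then show "coeff (comb ?B (glue m e2 f2) j) t = coeff (Polynomial.smult a (comb ?A (glue m e2 f2) j) + pCons 0 (comb ?A (glue m e2 f2) j)) t"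
          by (simp add: cs e2_Suc)
      next
        fix k t assume kt: "k < n" "t < n'"
        show "coeff (comb ?B (glue m e2 f2) (m' + k)) t =
          coeff (Polynomial.smult a (comb ?A (glue m e2 f2) (m' + k)) + pCons 0 (comb ?A (glue m e2 f2) (m' + k))) t"
        proof (cases "k = n'")
          case True
          have "comb ?B (glue m e2 f2) (m' + k) = Polynomial.smult \<epsilon> 1 + (if n' = 0 then 0 else f2 (n' - 1))"
            using kt lt True by (simp add: cs e20 f2_n)
          then show ?thesis using True kt f2_last by (simp add: cs f2_n)
        next
          case False
          then have "k < n'" using kt lt by simp
          then show ?thesis using kt lt f2_step[of k t] False by (simp add: cs)
        qed
      qed
    qed
  next
    fix u i assume u: "\<And>t g s. (t, g) \<in> set ?tgs \<Longrightarrow> s < summand_index t \<Longrightarrow> (\<Sum>i<m + n. u i * coeff (g i) s) = 0"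
      and i: "i < m + n"
    have u1: "(\<Sum>i<m. u i * coeff (e1 i) s) + (\<Sum>i<n. u (m + i) * coeff (f1 i) s) = 0" if "s < m + 1" for s
      using u[of "SLT (m + 1)" "glue m e1 f1" s] that by (simp add: sum_glue)
    have u2: "(\<Sum>i<m. u i * coeff (e2 i) s) + (\<Sum>i<n. u (m + i) * coeff (f2 i) s) = 0" if "s < n'" for s
      using u[of "SD n' (Fin a)" "glue m e2 f2" s] that by (simp add: sum_glue)
    have cf1: "coeff (f1 i) s = (if i = n' then if s = 0 then \<epsilon> else 0 else 0)" for i s
      by (simp add: f1_def coeff_pCons split: nat.split)
    have se1: "(\<Sum>i<m. u i * coeff (e1 i) (Suc s)) = u s - (if Suc s < m then u (Suc s) * a else 0)" if "s < m" for s
      using that by (simp add: ce1 right_diff_distrib sum_subtractf if_distrib[of "\<lambda>x. _ * x"] cong: if_cong)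
    \<comment> \<open>A multiple of \<open>x - a\<close> determines its cofactor from the top
      coefficient downwards.\<close>
    have a0: "u i = 0" if "i < m" for i
      using that
    proof (induction "m - i" arbitrary: i rule: less_induct)
      case less
      have "u (Suc i) = 0" if "Suc i < m" by (rule less.hyps) (use that less.prems in auto)
      then show ?case using u1[of "Suc i"] se1[of i] less.prems by (simp add: cf1 split: if_splits)
    qed
    have b0: "u (m + n') = 0"
      using u1[of 0] a0 lt \<epsilon> by (simp add: cf1 if_distrib[of "\<lambda>x. _ * x"] cong: if_cong)
    have c0: "u (m + k) = 0" if "k < n'" for k
    proof -
      have "(\<Sum>i<n. u (m + i) * coeff (f2 i) (n' - Suc k)) = (\<Sum>i<n. if i = k then u (m + i) * (- \<epsilon>) else 0)"
        by (rule sum.cong) (use that lt in \<open>auto simp: f2_def\<close>)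
      moreover have "(\<Sum>i<m. u i * coeff (e2 i) (n' - Suc k)) = 0" using a0 by simp
      ultimately show ?thesis using u2[of "n' - Suc k"] \<epsilon> lt that by simp
    qed
    from i show "u i = 0"
    proof (cases rule: block_index_cases)
      case (2 k)
      then show ?thesis using b0 c0 lt by (cases "k = n'") auto
    qed (rule a0)
  next
    fix w assume "w \<in> carrier_vec (m' + n)" "fst (?A, ?B) *\<^sub>v w = 0\<^sub>v (m + n)"
    then show "w = 0\<^sub>v (m' + n)"
      using diag_block_ker[OF car(1) L_mat_carrier[of m, unfolded m1] L_mult_L_transpose[of m, unfolded m1] car(2) one_carrier_mat] by simp
  qed (use lt in auto)
qed

lemma replacement_iii_inf_kcf:
  assumes m: "1 \<le> m" "1 \<le> n" and \<epsilon>: "\<epsilon> \<noteq> 0"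
  shows "pair_equiv (upper_block (L_mat m)\<^sup>T (\<epsilon> \<cdot>\<^sub>m corner_se m n) (jordan_block n 0),
      diag_block (R_mat m)\<^sup>T (1\<^sub>m n))
    (kronecker_pair [SLT (m + 1), SD (n - 1) Infty])" (is "pair_equiv (?A, ?B) _")
proof -
  define m' n' where "m' = m - 1" and "n' = n - 1"
  have m1: "m - 1 = m'" and n1: "n - 1 = n'" and lt: "m' < m" "n' < n" "m' + 1 = m" "n' + 1 = n"
    using m by (auto simp: m'_def n'_def)
  note car = RT_carrier[of m, unfolded m1] one_carrier_mat[of n] LT_carrier[of m, unfolded m1] jordan_block_carrier[of n 0]
  have Z: "\<epsilon> \<cdot>\<^sub>m corner_se m n \<in> carrier_mat m n" by (simp add: corner_se_def)
  have B: "?B = upper_block (R_mat m)\<^sup>T (0\<^sub>m m n) (1\<^sub>m n)"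
    by (rule upper_block_zero[OF car(1,2), symmetric])
  have P: "(?A, ?B) \<in> pairs (m + n) (m' + n)"
    using car by (auto simp: pairs_iff intro!: upper_block_carrier)
  then have dA: "dim_col ?A = m' + n" by (auto simp: pairs_iff)
  note cB = comb_upper_block[OF car(1) zero_carrier_mat car(2), folded B]
  note cA = comb_upper_block[OF car(3) Z car(4)]
  note cs = cA cB comb_L_transpose[of _ m, unfolded m1] comb_R_transpose[of _ m, unfolded m1]
    comb_one comb_jordan_block comb_zero_mat
    comb_corner(2)[of _ n m, unfolded n1] comb_corner(3)[of _ n m, unfolded n1 m1]
  \<comment> \<open>At infinity the second block satisfies \<open>f(k) = x f(k - 1)\<close>, with
    \<open>\<epsilon> e(m')\<close> added to \<open>f(k - 1)\<close> at \<open>k = n'\<close>.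
    Starting from \<open>f(0) = 0\<close> when \<open>n'\<close> is positive, only
    \<open>f(n') = \<epsilon> x^m\<close> survives.\<close>
  define e1 f1 where "e1 = (\<lambda>i. monom 1 i :: complex poly)" and "f1 = (\<lambda>i. if i = n' then monom \<epsilon> m else 0)"
  \<comment> \<open>Here the variable is \<open>y = 1/x\<close>, so
    \<open>e(j) = y e(j + 1)\<close>, normalised by \<open>e(m') = 1\<close>.\<close>
  define e2 where "e2 = (\<lambda>i. monom 1 (m' - i) :: complex poly)"
  define f2 where "f2 = (\<lambda>i. if i = n' then 0 else monom (- \<epsilon>) (n' - Suc i))"
  let ?tgs = "[(SLT (m + 1), glue m e1 f1), (SD n' Infty, glue m e2 f2)]"
  have ce1: "coeff (e1 i) s = (if i = s then 1 else 0)" for i s by (simp add: e1_def)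
  have e1_Suc: "e1 (Suc j) = pCons 0 (e1 j)" for j by (simp add: e1_def monom_Suc)
  show ?thesis unfolding n1
  proof (rule kcf_by_polynomials[OF P, of ?tgs])
    fix t g assume "(t, g) \<in> set ?tgs"
    then consider "t = SLT (m + 1)" "g = glue m e1 f1" | "t = SD n' Infty" "g = glue m e2 f2" by auto
    then show "poly_hom (?A, ?B) t g"
    proof cases
      case 1
      have f1: "f1 j = (if j = n' then pCons 0 (Polynomial.smult \<epsilon> (e1 m')) else 0)" for j
        using lt(3) by (auto simp: f1_def e1_def smult_monom monom_Suc[symmetric])
      show ?thesis unfolding 1 poly_hom.simps dA all_less_add
        using lt by (auto simp: cs e1_Suc f1 ce1)
    next
      case 2
      have f2_step: "coeff (if k = 0 then 0 else f2 (k - 1)) t = coeff (pCons 0 (f2 k)) t"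
        if "k < n'" "t < n'" for k t
      proof (cases k)
        case 0
        then show ?thesis using that by (auto simp: f2_def monom_Suc[symmetric])
      next
        case (Suc k')
        then have "n' - Suc k' = Suc (n' - Suc k)" using that by simp
        then show ?thesis using that Suc by (simp add: f2_def monom_Suc)
      qed
      have f2_last: "Polynomial.smult \<epsilon> 1 + (if n' = 0 then 0 else f2 (n' - 1)) = 0" if "0 < n'"
        using that by (simp add: f2_def one_pCons monom_0)
      have f2_n: "f2 n' = 0" by (simp add: f2_def)
      have e2_m: "e2 m' = 1" by (simp add: e2_def monom_0 one_pCons)
      have e2_Suc: "e2 j = pCons 0 (e2 (Suc j))" if "j < m'" for j
      proof -
        have "m' - j = Suc (m' - Suc j)" using that by simp
        then show ?thesis unfolding e2_def by (simp only: monom_Suc)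
      qed
      show ?thesis unfolding 2 poly_hom.simps dA all_less_add
      proof (intro conjI allI impI)
        fix j t assume jt: "j < m'" "t < n'"
        then show "coeff (comb ?A (glue m e2 f2) j) t = coeff (pCons 0 (comb ?B (glue m e2 f2) j)) t"
          using e2_Suc[of j] by (simp add: cs)
      next
        fix k t assume kt: "k < n" "t < n'"
        show "coeff (comb ?A (glue m e2 f2) (m' + k)) t = coeff (pCons 0 (comb ?B (glue m e2 f2) (m' + k))) t"
        proof (cases "k = n'")
          case True
          have "comb ?A (glue m e2 f2) (m' + k) = Polynomial.smult \<epsilon> 1 + (if n' = 0 then 0 else f2 (n' - 1))"
            using kt lt True by (simp add: cs e2_m f2_n)
          then show ?thesis using True kt f2_last by (simp add: cs f2_n)
        next
          case False
          then have "k < n'" using kt lt by simp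
          then show ?thesis using kt lt f2_step[of k t] False by (simp add: cs)
        qed
      qed
    qed
  next
    fix u i assume u: "\<And>t g s. (t, g) \<in> set ?tgs \<Longrightarrow> s < summand_index t \<Longrightarrow> (\<Sum>i<m + n. u i * coeff (g i) s) = 0"
      and i: "i < m + n"
    have u1: "(\<Sum>i<m. u i * coeff (e1 i) s) + (\<Sum>i<n. u (m + i) * coeff (f1 i) s) = 0" if "s < m + 1" for s
      using u[of "SLT (m + 1)" "glue m e1 f1" s] that by (simp add: sum_glue)
    have u2: "(\<Sum>i<m. u i * coeff (e2 i) s) + (\<Sum>i<n. u (m + i) * coeff (f2 i) s) = 0" if "s < n'" for s
      using u[of "SD n' Infty" "glue m e2 f2" s] that by (simp add: sum_glue)
    have cf1: "coeff (f1 i) s = (if i = n' then if s = m then \<epsilon> else 0 else 0)" for i s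
      by (simp add: f1_def)
    have a0: "u i = 0" if "i < m" for i
      using u1[of i] that by (simp add: ce1 cf1 if_distrib[of "\<lambda>x. _ * x"] cong: if_cong)
    have b0: "u (m + n') = 0"
      using u1[of m] a0 lt \<epsilon> by (simp add: cf1 if_distrib[of "\<lambda>x. _ * x"] cong: if_cong)
    have c0: "u (m + k) = 0" if "k < n'" for k
    proof -
      have "(\<Sum>i<n. u (m + i) * coeff (f2 i) (n' - Suc k)) = (\<Sum>i<n. if i = k then u (m + i) * (- \<epsilon>) else 0)"
        by (rule sum.cong) (use that lt in \<open>auto simp: f2_def\<close>)
      moreover have "(\<Sum>i<m. u i * coeff (e2 i) (n' - Suc k)) = 0" using a0 by simp
      ultimately show ?thesis using u2[of "n' - Suc k"] \<epsilon> lt that by simp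
    qed
    from i show "u i = 0"
    proof (cases rule: block_index_cases)
      case (2 k)
      then show ?thesis using b0 c0 lt by (cases "k = n'") auto
    qed (rule a0)
  next
    fix w assume "w \<in> carrier_vec (m' + n)" "snd (?A, ?B) *\<^sub>v w = 0\<^sub>v (m + n)"
    then show "w = 0\<^sub>v (m' + n)"
      using diag_block_ker[OF car(1) R_mat_carrier[of m, unfolded m1] R_mult_R_transpose[of m, unfolded m1] car(2) one_carrier_mat] by simp
  qed (use lt in auto)
qed

lemma replacement_v_fin_kcf:
  assumes m: "1 \<le> m" "m \<le> n" and \<epsilon>: "\<epsilon> \<noteq> 0"
  shows "pair_equiv (1\<^sub>m (m + n), upper_block (jordan_block m a) (\<epsilon> \<cdot>\<^sub>m corner_nw m n) (jordan_block n a))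
    (kronecker_pair [SD (m - 1) (Fin a), SD (n + 1) (Fin a)])" (is "pair_equiv (?A, ?B) _")
proof -
  note car = one_carrier_mat[of m] one_carrier_mat[of n] jordan_block_carrier[of m a] jordan_block_carrier[of n a]
  have Z: "\<epsilon> \<cdot>\<^sub>m corner_nw m n \<in> carrier_mat m n" by (simp add: corner_nw_def)
  have P: "(?A, ?B) \<in> pairs (m + n) (m + n)"
    using car by (auto simp: pairs_iff intro!: upper_block_carrier)
  have dA: "dim_col ?A = m + n" by simp
  note cB = comb_upper_block[OF car(3) Z car(4)]
  have cA: "comb ?A (glue m e f) j = e j" if "j < m" for e f j
    using that by (simp add: comb_one)
  have cA': "comb ?A (glue m e f) (m + j) = f j" if "j < n" for e f j
    using that by (simp add: comb_one)
  note cs = cA cA' cB comb_jordan_block comb_corner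
  \<comment> \<open>The two chains are joined by \<open>y f(0) = \<epsilon> e(0)\<close> into one
    chain of length \<open>n + 1\<close>: \<open>f(0) = y^(n-1)\<close> gives
    \<open>e(0) = y^n / \<epsilon>\<close>. The hypothesis \<open>m \<le> n\<close> keeps the
    subtraction \<open>n - i\<close> from truncating.\<close>
  define e1 f1 where "e1 = (\<lambda>i. monom (1 / \<epsilon>) (n - i))" and "f1 = (\<lambda>i. monom 1 (n - 1 - i) :: complex poly)"
  \<comment> \<open>Modulo \<open>y^(m-1)\<close> the image \<open>e(0) = y^(m-1)\<close> vanishes,
    so the coupling disappears and the second block may be sent to zero.\<close>
  define e2 f2 where "e2 = (\<lambda>i. monom 1 (m - 1 - i) :: complex poly)" and "f2 = (\<lambda>i :: nat. 0 :: complex poly)"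
  let ?tgs = "[(SD (m - 1) (Fin a), glue m e2 f2), (SD (n + 1) (Fin a), glue m e1 f1)]"
  show ?thesis
  proof (rule kcf_by_polynomials[OF P, of ?tgs])
    fix t g assume "(t, g) \<in> set ?tgs"
    then consider "t = SD (m - 1) (Fin a)" "g = glue m e2 f2" | "t = SD (n + 1) (Fin a)" "g = glue m e1 f1" by auto
    then show "poly_hom (?A, ?B) t g"
    proof cases
      case 1
      have e2_step: "coeff (if k = 0 then 0 else e2 (k - 1)) t = coeff (pCons 0 (e2 k)) t"
        if "k < m" "t < m - 1" for k t
      proof (cases k)
        case 0
        then show ?thesis using that by (auto simp: e2_def monom_Suc[symmetric])
      next
        case (Suc k')
        then have "m - 1 - k' = Suc (m - 1 - k)" using that by simp
        then show ?thesis using that Suc by (simp add: e2_def monom_Suc)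
      qed
      have e20: "coeff (e2 0) t = 0" if "t < m - 1" for t using that by (simp add: e2_def)
      show ?thesis unfolding 1 poly_hom.simps dA all_less_add[of m n]
      proof (intro conjI allI impI)
        fix j t assume jt: "j < m" "t < m - 1"
        then show "coeff (comb ?B (glue m e2 f2) j) t = coeff (Polynomial.smult a (comb ?A (glue m e2 f2) j) + pCons 0 (comb ?A (glue m e2 f2) j)) t"
          using e2_step[of j t] by (simp add: cs)
      next
        fix j t assume jt: "j < n" "t < m - 1"
        then show "coeff (comb ?B (glue m e2 f2) (m + j)) t =
          coeff (Polynomial.smult a (comb ?A (glue m e2 f2) (m + j)) + pCons 0 (comb ?A (glue m e2 f2) (m + j))) t"
          using e20[of t] m by (simp add: cs f2_def)
      qed
    next
      case 2
      have e1_step: "coeff (if k = 0 then 0 else e1 (k - 1)) t = coeff (pCons 0 (e1 k)) t"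
        if "k < m" "t < n + 1" for k t
      proof (cases k)
        case 0
        then show ?thesis using that by (auto simp: e1_def monom_Suc[symmetric])
      next
        case (Suc k')
        then have "n - k' = Suc (n - k)" using that m by simp
        then show ?thesis using that Suc by (simp add: e1_def monom_Suc)
      qed
      have f1_step: "(if k = 0 then Polynomial.smult \<epsilon> (e1 0) else 0) + (if k = 0 then 0 else f1 (k - 1)) = pCons 0 (f1 k)"
        if "k < n" for k
      proof (cases k)
        case 0
        then have "n = Suc (n - 1 - k)" using that by simp
        then have "monom 1 n = pCons 0 (monom (1 :: complex) (n - 1 - k))" by (metis monom_Suc)
        then show ?thesis using 0 \<epsilon> by (simp add: e1_def f1_def smult_monom)
      next
        case (Suc k')
        then have "n - 1 - k' = Suc (n - 1 - k)" using that by simp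
        then show ?thesis using that Suc by (simp add: f1_def monom_Suc)
      qed
      show ?thesis unfolding 2 poly_hom.simps dA all_less_add[of m n]
      proof (intro conjI allI impI)
        fix j t assume jt: "j < m" "t < n + 1"
        then show "coeff (comb ?B (glue m e1 f1) j) t = coeff (Polynomial.smult a (comb ?A (glue m e1 f1) j) + pCons 0 (comb ?A (glue m e1 f1) j)) t"
          using e1_step[of j t] by (simp add: cs)
      next
        fix j t assume jt: "j < n" "t < n + 1"
        have "comb ?B (glue m e1 f1) (m + j) = Polynomial.smult a (f1 j) + pCons 0 (f1 j)"
          using jt m f1_step[of j] by (auto simp: cs)
        then show "coeff (comb ?B (glue m e1 f1) (m + j)) t =
          coeff (Polynomial.smult a (comb ?A (glue m e1 f1) (m + j)) + pCons 0 (comb ?A (glue m e1 f1) (m + j))) t"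
          using jt by (simp add: cA')
      qed
    qed
  next
    fix u i assume u: "\<And>t g s. (t, g) \<in> set ?tgs \<Longrightarrow> s < summand_index t \<Longrightarrow> (\<Sum>i<m + n. u i * coeff (g i) s) = 0"
      and i: "i < m + n"
    have u1: "(\<Sum>i<m. u i * coeff (e1 i) s) + (\<Sum>i<n. u (m + i) * coeff (f1 i) s) = 0" if "s < n + 1" for s
      using u[of "SD (n + 1) (Fin a)" "glue m e1 f1" s] that by (simp add: sum_glue)
    have u2: "(\<Sum>i<m. u i * coeff (e2 i) s) + (\<Sum>i<n. u (m + i) * coeff (f2 i) s) = 0" if "s < m - 1" for s
      using u[of "SD (m - 1) (Fin a)" "glue m e2 f2" s] that by (simp add: sum_glue)
    have a0: "u i = 0" if "0 < i" "i < m" for i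
    proof -
      have "(\<Sum>j<m. u j * coeff (e2 j) (m - 1 - i)) = (\<Sum>j<m. if j = i then u j else 0)"
        by (rule sum.cong) (use that in \<open>auto simp: e2_def\<close>)
      then show ?thesis using u2[of "m - 1 - i"] that by (simp add: f2_def)
    qed
    have s1: "(\<Sum>j<m. u j * coeff (e1 j) s) = (if s = n then u 0 / \<epsilon> else 0)" for s
    proof -
      have "(\<Sum>j<m. u j * coeff (e1 j) s) = (\<Sum>j<m. if j = 0 then if s = n then u 0 / \<epsilon> else 0 else 0)"
        by (rule sum.cong) (use a0 in \<open>auto simp: e1_def\<close>)
      then show ?thesis using m by simp
    qed
    have b0: "u (m + j) = 0" if "j < n" for j
    proof -
      have "(\<Sum>k<n. u (m + k) * coeff (f1 k) (n - 1 - j)) = (\<Sum>k<n. if k = j then u (m + k) else 0)"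
        by (rule sum.cong) (use that in \<open>auto simp: f1_def\<close>)
      then show ?thesis using u1[of "n - 1 - j"] that s1[of "n - 1 - j"] by (simp split: if_splits)
    qed
    have "u 0 = 0" using u1[of n] \<epsilon> b0 by (simp add: s1)
    then show "u i = 0" using a0 b0 i
      by (metis add_less_cancel_left le_add_diff_inverse not_less gr0I)
  next
    fix w assume "w \<in> carrier_vec (m + n)" "fst (?A, ?B) *\<^sub>v w = 0\<^sub>v (m + n)"
    then show "w = 0\<^sub>v (m + n)" by simp
  qed (use m in auto)
qed

section \<open>Replacement (vi)\<close>

lemma eigen_poly_simps:
  "eigen_poly [] = 1"
  "eigen_poly ((k, Fin a) # rs) = [:- a, 1:] ^ k * eigen_poly rs"
  "eigen_poly ((k, Infty) # rs) = eigen_poly rs"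
  by (simp_all add: eigen_poly_def)

lemma monic_eigen_poly: "lead_coeff (eigen_poly rs) = 1"
proof (induction rs)
  case (Cons r rs)
  obtain k \<mu> where "r = (k, \<mu>)" by (cases r)
  then show ?case using Cons by (cases \<mu>) (simp_all add: eigen_poly_simps lead_coeff_mult lead_coeff_power)
qed (simp add: eigen_poly_simps)

lemma eigen_poly_nonzero: "eigen_poly rs \<noteq> 0"
  using monic_eigen_poly[of rs] by auto

lemma degree_eigen_poly_Cons:
  "degree (eigen_poly ((k, Fin a) # rs)) = k + degree (eigen_poly rs)"
  by (simp add: eigen_poly_simps degree_mult_eq eigen_poly_nonzero degree_linear_power)

text \<open>The eigenvalue \<infinity> contributes no factor, so the size of its block is the amount
  by which the degree falls short of the total.\<close>

lemma degree_eigen_poly: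
  assumes "distinct (map snd rs)"
  shows "Infty \<notin> snd ` set rs \<Longrightarrow> degree (eigen_poly rs) = sum_list (map fst rs)"
    and "(k, Infty) \<in> set rs \<Longrightarrow> degree (eigen_poly rs) + k = sum_list (map fst rs)"
  using assms
proof (induction rs)
  case Nil
  { case 1 then show ?case by (simp add: eigen_poly_simps) }
  { case 2 then show ?case by simp }
next
  case (Cons r rs)
  obtain l \<mu> where r: "r = (l, \<mu>)" by (cases r)
  { case 1
    then show ?case using Cons.IH(1) by (cases \<mu>) (simp_all add: r degree_eigen_poly_Cons) }
  { case 2
    show ?case
    proof (cases \<mu>)
      case (Fin a)
      then show ?thesis using 2 Cons.IH(2) by (simp add: r degree_eigen_poly_Cons)
    next
      case Infty
      then have "(k, Infty) \<notin> set rs" "Infty \<notin> snd ` set rs" using 2 r by force+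
      then show ?thesis using 2 Cons.IH(1) Infty by (auto simp: r eigen_poly_simps)
    qed }
qed

lemma degree_eigen_poly_le: "degree (eigen_poly rs) \<le> sum_list (map fst rs)"
proof (induction rs)
  case (Cons r rs)
  obtain k \<mu> where "r = (k, \<mu>)" by (cases r)
  then show ?case
    using Cons by (cases \<mu>) (simp_all add: degree_eigen_poly_Cons eigen_poly_simps(3))
qed (simp add: eigen_poly_simps)

lemma dvd_eigen_poly: "(k, Fin a) \<in> set rs \<Longrightarrow> [:- a, 1:] ^ k dvd eigen_poly rs"
proof (induction rs)
  case (Cons r rs)
  obtain l \<mu> where r: "r = (l, \<mu>)" by (cases r)
  show ?case
  proof (cases "r = (k, Fin a)")
    case False
    then show ?thesis using Cons by (cases \<mu>) (auto simp: r eigen_poly_simps)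
  qed (simp add: eigen_poly_simps)
qed simp

text \<open>Cancelling a power of \<open>x - a\<close> does not change the order at any other root
  \<open>b\<close>.\<close>

lemma eigen_poly_dvd:
  assumes "distinct (map snd rs)" "\<And>k a. (k, Fin a) \<in> set rs \<Longrightarrow> [:- a, 1:] ^ k dvd U"
  shows "eigen_poly rs dvd U"
  using assms
proof (induction rs arbitrary: U)
  case (Cons r rs)
  obtain k \<mu> where r: "r = (k, \<mu>)" by (cases r)
  show ?case
  proof (cases \<mu>)
    case Infty
    have "eigen_poly rs dvd U" by (rule Cons.IH) (use Cons.prems in auto)
    then show ?thesis by (simp add: r Infty eigen_poly_simps)
  next
    case (Fin a)
    then have "[:- a, 1:] ^ k dvd U" using Cons.prems(2)[of k a] r by simp
    then obtain V where V: "U = [:- a, 1:] ^ k * V" by (rule dvdE)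
    have "eigen_poly rs dvd V"
    proof (rule Cons.IH)
      fix l b assume lb: "(l, Fin b) \<in> set rs"
      then have "b \<noteq> a" using Cons.prems(1) r Fin by force
      then have "order b ([:- a, 1:] ^ k) = 0" by (intro order_0I) simp
      moreover have "[:- b, 1:] ^ l dvd U" using Cons.prems(2)[of l b] lb by simp
      ultimately show "[:- b, 1:] ^ l dvd V"
        unfolding V order_divides by (cases "V = 0") (auto simp: order_mult)
    qed (use Cons.prems in simp)
    then show ?thesis by (simp add: r Fin eigen_poly_simps V)
  qed
qed (simp add: eigen_poly_simps)

lemma pcompose_linear_power: "pcompose (q ^ k) r = pcompose q r ^ k"
  by (induction k) (simp_all add: pcompose_1 pcompose_mult)

text \<open>Taylor expansion at \<open>a\<close>: divisibility by the power of \<open>x - a\<close>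
  means vanishing in the Jordan target, where \<open>y^k = 0\<close>.\<close>

lemma dvd_iff_pcompose_coeffs:
  "[:- a, 1:] ^ k dvd p \<longleftrightarrow> (\<forall>t<k. coeff (pcompose p [:a, 1:]) t = (0 :: complex))"
proof -
  have x: "pcompose [:0, 1:] q = (q :: complex poly)" for q by (simp add: pcompose_pCons)
  have "[:- a, 1:] ^ k dvd p \<longleftrightarrow> monom 1 k dvd pcompose p [:a, 1:]"
  proof
    assume "[:- a, 1:] ^ k dvd p"
    then obtain q where "p = [:- a, 1:] ^ k * q" by (rule dvdE)
    then have "pcompose p [:a, 1:] = [:0, 1:] ^ k * pcompose q [:a, 1:]"
      by (simp add: pcompose_mult pcompose_linear_power pcompose_pCons)
    then show "monom 1 k dvd pcompose p [:a, 1:]" by (simp add: monom_altdef)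
  next
    assume "monom 1 k dvd pcompose p [:a, 1:]"
    then obtain q where q: "pcompose p [:a, 1:] = [:0, 1:] ^ k * q" by (auto simp: monom_altdef)
    have "p = pcompose (pcompose p [:a, 1:]) [:- a, 1:]"
      by (simp add: pcompose_assoc[symmetric] pcompose_pCons)
    also have "\<dots> = [:- a, 1:] ^ k * pcompose q [:- a, 1:]"
      unfolding q pcompose_mult pcompose_linear_power x ..
    finally show "[:- a, 1:] ^ k dvd p" by (rule dvdI)
  qed
  then show ?thesis by (simp add: monom_1_dvd_iff')
qed

lemma pcompose_monom: "pcompose (monom c i) q = Polynomial.smult c (q ^ i :: complex poly)"
  by (induction i) (simp_all add: monom_0 monom_Suc pcompose_pCons)

lemma poly_shift_Suc: "poly_shift j p = pCons (coeff p j) (poly_shift (Suc j) p)"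
  by (rule poly_eqI) (auto simp: coeff_poly_shift coeff_pCons add.commute split: nat.splits)

lemma poly_shift_zero: "poly_shift 0 p = p"
  by (rule poly_eqI) (simp add: coeff_poly_shift)

lemma comb_alpha:
  "j < n \<Longrightarrow> comb (alpha_mat m n rs \<epsilon>) g j =
    (if j = n - 1 then \<Sum>i<m. Polynomial.smult (\<epsilon> * coeff (eigen_poly rs) (n + i)) (g i) else 0)"
  by (auto simp: comb_def alpha_mat_def)

lemma comb_beta:
  "0 < m \<Longrightarrow> j < n \<Longrightarrow> comb (beta_mat m n rs \<epsilon>) g j = Polynomial.smult (- (\<epsilon> * coeff (eigen_poly rs) j)) (g 0)"
  by (rule comb_single) (auto simp: beta_mat_def)

context
  fixes m n m' n' :: nat and rs :: "(nat \<times> ext_complex) list" and \<epsilon> :: complex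
  assumes m1: "m - 1 = m'" and n1: "n - 1 = n'" and lt: "m' + 1 = m" "n' + 1 = n"
    and dist: "distinct (map snd rs)"
    and total: "sum_list (map fst rs) = m + n'" and \<epsilon>: "\<epsilon> \<noteq> 0"
begin

private abbreviation "p \<equiv> eigen_poly rs"

private abbreviation "A_vi \<equiv> upper_block (L_mat m)\<^sup>T (alpha_mat m n rs \<epsilon>) (L_mat n)"

private abbreviation "B_vi \<equiv> upper_block (R_mat m)\<^sup>T (beta_mat m n rs \<epsilon>) (R_mat n)"

lemma carriers_vi:
  "(L_mat m)\<^sup>T \<in> carrier_mat m m'" "(R_mat m)\<^sup>T \<in> carrier_mat m m'"
  "L_mat n \<in> carrier_mat n' n" "R_mat n \<in> carrier_mat n' n"
  "alpha_mat m n rs \<epsilon> \<in> carrier_mat m n" "beta_mat m n rs \<epsilon> \<in> carrier_mat m n"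
  using LT_carrier[of m, unfolded m1] RT_carrier[of m, unfolded m1]
    L_mat_carrier[of n, unfolded n1] R_mat_carrier[of n, unfolded n1]
  by (simp_all add: alpha_mat_def beta_mat_def)

lemma pairs_vi: "(A_vi, B_vi) \<in> pairs (m + n') (m' + n)"
  using carriers_vi by (auto simp: pairs_iff intro!: upper_block_carrier)

lemmas comb_vi =
  comb_upper_block[OF carriers_vi(1) carriers_vi(5) carriers_vi(3)]
  comb_upper_block[OF carriers_vi(2) carriers_vi(6) carriers_vi(4)]
  comb_L_transpose[of _ m, unfolded m1] comb_R_transpose[of _ m, unfolded m1]
  comb_L[of _ n, unfolded n1] comb_R[of _ n] comb_alpha[of _ n, unfolded n1] comb_beta[of m _ n]

lemma high_coeff: "m + n' < i \<Longrightarrow> coeff p i = 0"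
  using degree_eigen_poly_le[of rs] total by (intro coeff_eq_0) simp

definition e_fin :: "complex \<Rightarrow> nat \<Rightarrow> complex poly" where
  "e_fin a i = [:a, 1:] ^ i"

text \<open>Writing \<open>p_j\<close> for the coefficients of \<open>p\<close>, the pair demands
  \<open>x f(0) = - \<epsilon> p_0\<close> and \<open>x f(j) = f(j - 1) - \<epsilon> p_j\<close>.
  Modulo \<open>p\<close> this is solved by the Horner polynomials
  \<open>\<epsilon> (p_(b+1) + p_(b+2) x + ...)\<close>, here expanded at \<open>a\<close>. The top
  coefficients left over after \<open>n\<close> Horner steps are those placed in
  \<open>alpha_mat\<close>.\<close>

definition f_fin :: "complex \<Rightarrow> nat \<Rightarrow> complex poly" where
  "f_fin a b = Polynomial.smult \<epsilon> (pcompose (poly_shift (Suc b) p) [:a, 1:])"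

definition e_inf :: "nat \<Rightarrow> complex poly" where
  "e_inf i = monom 1 (m' - i)"

text \<open>Modulo \<open>p\<close> the Horner polynomial equals minus the lower part of
  \<open>p\<close> divided by \<open>x^(b+1)\<close>, up to the factor \<epsilon>. Multiplied by
  \<open>y^m'\<close> with \<open>y = 1/x\<close>, as \<open>e_inf\<close> is, this becomes a
  polynomial in \<open>y\<close>.\<close>

definition f_inf :: "nat \<Rightarrow> complex poly" where
  "f_inf b = - (\<Sum>l\<le>b. monom (\<epsilon> * coeff p l) (m + b - l))"

lemma hom_vi_fin:
  assumes k: "(k, Fin a) \<in> set rs"
  shows "poly_hom (A_vi, B_vi) (SD k (Fin a)) (glue m (e_fin a) (f_fin a))"
proof -
  let ?g = "glue m (e_fin a) (f_fin a)"
  have dA: "dim_col A_vi = m' + n" using pairs_vi by (auto simp: pairs_iff)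
  have e_Suc: "e_fin a (Suc j) = Polynomial.smult a (e_fin a j) + pCons 0 (e_fin a j)" for j
    by (simp add: e_fin_def)
  have e0: "e_fin a 0 = 1" by (simp add: e_fin_def)
  have shift: "Polynomial.smult \<epsilon> (pcompose (poly_shift j p) [:a, 1:]) =
      Polynomial.smult (\<epsilon> * coeff p j) 1 + (Polynomial.smult a (f_fin a j) + pCons 0 (f_fin a j))" for j
    by (subst poly_shift_Suc) (simp add: pcompose_pCons f_fin_def smult_add_right one_pCons mult.commute)
  \<comment> \<open>The last column, which has no basis vector \<open>f(n')\<close> of its own,
    receives from \<open>alpha_mat\<close> exactly what \<open>f(n')\<close> should be. The bound on
    the degree of \<open>p\<close> makes the \<open>m\<close> available coefficients
    sufficient.\<close>
  have cA: "comb A_vi ?g (m' + j) = f_fin a j" if j: "j < n" for j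
  proof (cases "j = n'")
    case True
    have "poly_shift n p = (\<Sum>i<m. monom (coeff p (n + i)) i)"
    proof (rule poly_eqI)
      fix t
      have "coeff p (n + t) = 0" if "m \<le> t" using that lt by (intro high_coeff) simp
      then show "coeff (poly_shift n p) t = coeff (\<Sum>i<m. monom (coeff p (n + i)) i) t"
        by (simp add: coeff_poly_shift coeff_sum add.commute)
    qed
    then have "f_fin a n' = (\<Sum>i<m. Polynomial.smult (\<epsilon> * coeff p (n + i)) (e_fin a i))"
      using lt by (simp add: f_fin_def pcompose_sum pcompose_monom e_fin_def smult_sum2)
    then show ?thesis using True j by (simp add: comb_vi)
  next
    case False
    then show ?thesis using j lt by (simp add: comb_vi)
  qed
  show ?thesis unfolding poly_hom.simps dA all_less_add[of m' n]
  proof (intro conjI allI impI)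
    fix j t assume "j < m'" "t < k"
    then show "coeff (comb B_vi ?g j) t = coeff (Polynomial.smult a (comb A_vi ?g j) + pCons 0 (comb A_vi ?g j)) t"
      using lt by (simp add: comb_vi e_Suc)
  next
    fix j t assume j: "j < n" and t: "t < k"
    have B: "comb B_vi ?g (m' + j) = Polynomial.smult (- (\<epsilon> * coeff p j)) 1 + (if j = 0 then 0 else f_fin a (j - 1))"
      using j lt by (simp add: comb_vi e0)
    show "coeff (comb B_vi ?g (m' + j)) t =
        coeff (Polynomial.smult a (comb A_vi ?g (m' + j)) + pCons 0 (comb A_vi ?g (m' + j))) t"
    proof (cases "j = 0")
      case True
      \<comment> \<open>The only relation that uses the eigenvalue: the first column requires
        \<open>p\<close> to vanish modulo \<open>y^k\<close>. All the others are Horner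
        steps.\<close>
      have "coeff (pcompose p [:a, 1:]) t = 0"
        using dvd_eigen_poly[OF k] t by (simp add: dvd_iff_pcompose_coeffs)
      then have "coeff (Polynomial.smult \<epsilon> (pcompose (poly_shift 0 p) [:a, 1:])) t = 0"
        by (simp add: poly_shift_zero)
      then have "coeff (Polynomial.smult (\<epsilon> * coeff p 0) 1) t
          + coeff (Polynomial.smult a (f_fin a 0) + pCons 0 (f_fin a 0)) t = 0"
        unfolding shift[of 0] coeff_add[of "Polynomial.smult (\<epsilon> * coeff p 0) 1"] .
      from minus_unique[OF this] show ?thesis
        unfolding B cA[OF j] unfolding True by (simp only: simp_thms if_True add_0_right smult_minus_left coeff_minus)
    next
      case False
      then have "f_fin a (j - 1) = Polynomial.smult \<epsilon> (pcompose (poly_shift j p) [:a, 1:])"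
        by (simp add: f_fin_def)
      then show ?thesis unfolding B cA[OF j] using False
        by (simp only: if_False shift smult_minus_left add.assoc[symmetric] left_minus add_0_left)
    qed
  qed
qed

lemma coeff_f_inf: "coeff (f_inf b) t = - (if m \<le> t \<and> t \<le> m + b then \<epsilon> * coeff p (m + b - t) else 0)"
proof -
  have "(\<Sum>l\<le>b. if m + b - l = t then \<epsilon> * coeff p l else 0) =
      (\<Sum>l\<le>b. if l = m + b - t then if m \<le> t \<and> t \<le> m + b then \<epsilon> * coeff p (m + b - t) else 0 else 0)"
    by (rule sum.cong) auto
  also have "\<dots> = (if m \<le> t \<and> t \<le> m + b then \<epsilon> * coeff p (m + b - t) else 0)"
    by auto
  finally show ?thesis by (simp add: f_inf_def coeff_sum)
qed

lemma hom_vi_inf: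
  assumes k: "(k, Infty) \<in> set rs"
  shows "poly_hom (A_vi, B_vi) (SD k Infty) (glue m e_inf f_inf)"
proof -
  let ?g = "glue m e_inf f_inf"
  have dA: "dim_col A_vi = m' + n" using pairs_vi by (auto simp: pairs_iff)
  \<comment> \<open>A block of size \<open>k\<close> at infinity means
    \<open>degree p = m + n' - k\<close>. The vanishing of these top coefficients is what the last
    column requires modulo \<open>y^k\<close>.\<close>
  have deg: "coeff p (m + n' - t) = 0" if "t < k" for t
    using degree_eigen_poly(2)[OF dist k] total that by (intro coeff_eq_0) simp
  show ?thesis unfolding poly_hom.simps dA all_less_add[of m' n]
  proof (intro conjI allI impI)
    fix j t assume j: "j < m'"
    then have "m' - j = Suc (m' - Suc j)" by simp
    then have "e_inf j = pCons 0 (e_inf (Suc j))" unfolding e_inf_def by (simp only: monom_Suc)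
    then show "coeff (comb A_vi ?g j) t = coeff (pCons 0 (comb B_vi ?g j)) t"
      using j lt by (simp add: comb_vi)
  next
    fix j t assume j: "j < n" and t: "t < k"
    define h where "h = comb B_vi ?g (m' + j)"
    have h: "h = Polynomial.smult (- (\<epsilon> * coeff p j)) (e_inf 0) + (if j = 0 then 0 else f_inf (j - 1))"
      using j lt by (simp add: h_def comb_vi)
    have "pCons 0 h = f_inf j"
    proof (rule poly_eqI)
      fix s
      show "coeff (pCons 0 h) s = coeff (f_inf j) s"
      proof (cases s)
        case 0
        then show ?thesis using lt by (simp add: coeff_f_inf)
      next
        case (Suc r)
        have "coeff (e_inf 0) r = (if r = m' then 1 else 0)" by (simp add: e_inf_def)
        then show ?thesis using Suc lt unfolding h
          by (cases j) (auto simp: coeff_f_inf)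
      qed
    qed
    moreover have "coeff (comb A_vi ?g (m' + j)) t = coeff (f_inf j) t"
    proof (cases "j = n'")
      case True
      have "coeff (\<Sum>i<m. Polynomial.smult (\<epsilon> * coeff p (n + i)) (e_inf i)) t
          = (\<Sum>i<m. if m' - i = t then \<epsilon> * coeff p (n + i) else 0)"
        by (simp add: coeff_sum e_inf_def if_distrib[of "\<lambda>x. _ * x"] cong: if_cong)
      also have "\<dots> = (\<Sum>i<m. 0)"
      proof (rule sum.cong)
        fix i assume "i \<in> {..<m}"
        then have "n + i = m + n' - t" if "m' - i = t" using that lt by auto
        then show "(if m' - i = t then \<epsilon> * coeff p (n + i) else 0) = 0" using deg[OF t] by auto
      qed simp
      finally have "coeff (comb A_vi ?g (m' + j)) t = 0" using True j lt by (simp add: comb_vi)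
      then show ?thesis using deg[OF t] True by (simp add: coeff_f_inf)
    next
      case False
      then show ?thesis using j lt by (simp add: comb_vi)
    qed
    ultimately show "coeff (comb A_vi ?g (m' + j)) t = coeff (pCons 0 (comb B_vi ?g (m' + j))) t"
      by (simp add: h_def)
  qed
qed

text \<open>\<open>U\<close> is the image of \<open>u\<close> under the homomorphism with target \<open>\<complex>[x]/p\<close>; the high coefficients of
  \<open>x^n' U - \<epsilon> p b\<close> are those of the image of \<open>u\<close> at infinity, in reverse order.\<close>
lemma inj_vi:
  assumes fin: "\<And>k a s. (k, Fin a) \<in> set rs \<Longrightarrow> s < k \<Longrightarrow>
      (\<Sum>i<m + n'. u i * coeff (glue m (e_fin a) (f_fin a) i) s) = 0"
    and inf: "\<And>k s. (k, Infty) \<in> set rs \<Longrightarrow> s < k \<Longrightarrow>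
      (\<Sum>i<m + n'. u i * coeff (glue m e_inf f_inf i) s) = 0"
    and i: "i < m + n'"
  shows "u i = 0"
proof -
  define U where "U = (\<Sum>i<m. monom (u i) i) + (\<Sum>b<n'. Polynomial.smult (\<epsilon> * u (m + b)) (poly_shift (Suc b) p))"
  define bt where "bt = (\<Sum>b<n'. monom (u (m + b)) (n' - 1 - b))"
  have "p dvd U"
  proof (rule eigen_poly_dvd[OF dist])
    fix k a assume k: "(k, Fin a) \<in> set rs"
    have "pcompose U [:a, 1:] = (\<Sum>i<m. Polynomial.smult (u i) (e_fin a i))
        + (\<Sum>b<n'. Polynomial.smult (u (m + b)) (f_fin a b))"
      by (simp add: U_def pcompose_add pcompose_sum pcompose_monom pcompose_smult e_fin_def f_fin_def mult.commute)
    then have "coeff (pcompose U [:a, 1:]) s = (\<Sum>i<m + n'. u i * coeff (glue m (e_fin a) (f_fin a) i) s)" for s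
      by (simp add: sum_glue coeff_sum)
    then show "[:- a, 1:] ^ k dvd U" using fin[OF k] by (simp add: dvd_iff_pcompose_coeffs)
  qed
  then obtain q where q: "U = p * q" by (rule dvdE)
  \<comment> \<open>\<open>W\<close> is the quotient by \<open>p\<close> of
    \<open>x^n' U - \<epsilon> p bt\<close>. The subtraction cancels the contribution of the second
    block in all degrees from \<open>n'\<close> on, so that only the shifted \<open>u i\<close> of
    the first block remain there.\<close>
  define W where "W = monom 1 n' * q - Polynomial.smult \<epsilon> bt"
  have pW: "p * W = monom 1 n' * U - Polynomial.smult \<epsilon> (p * bt)"
    by (simp add: W_def q right_diff_distrib mult.left_commute)
  have cU: "coeff U s = (if s < m then u s else 0) + (\<Sum>b<n'. \<epsilon> * u (m + b) * coeff p (s + Suc b))" for s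
    by (simp add: U_def coeff_sum coeff_poly_shift)
  have cb: "coeff (p * bt) d = (\<Sum>b<n'. if n' - 1 - b \<le> d then u (m + b) * coeff p (d - (n' - 1 - b)) else 0)" for d
    unfolding bt_def sum_distrib_left coeff_sum
    by (rule sum.cong) (auto simp: coeff_monom_mult mult.commute[of p])
  have high: "coeff (p * W) d = (if d - n' < m then u (d - n') else 0)" if "n' \<le> d" for d
  proof -
    have "(\<Sum>b<n'. \<epsilon> * u (m + b) * coeff p (d - n' + Suc b)) = \<epsilon> * coeff (p * bt) d"
      unfolding cb sum_distrib_left
    proof (rule sum.cong)
      fix b assume "b \<in> {..<n'}"
      then have idx: "d - n' + Suc b = d - (n' - 1 - b)" "n' - 1 - b \<le> d" using that by auto
      then show "\<epsilon> * u (m + b) * coeff p (d - n' + Suc b) =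
          \<epsilon> * (if n' - 1 - b \<le> d then u (m + b) * coeff p (d - (n' - 1 - b)) else 0)"
        by (simp only: idx if_True mult.assoc)
    qed simp
    then show ?thesis unfolding pW using that by (simp add: coeff_monom_mult cU)
  qed
  have low: "coeff (p * W) d = - (\<epsilon> * coeff (p * bt) d)" if "d < n'" for d
    unfolding pW using that by (simp add: coeff_monom_mult)
  \<comment> \<open>No coefficients occur from degree \<open>m + n'\<close> on, and the block at
    infinity removes those between \<open>degree p\<close> and that bound; its coefficient of
    \<open>y^t\<close> is matched with degree \<open>d = m + n' - 1 - t\<close>. A multiple of
    \<open>p\<close> without coefficients from \<open>degree p\<close> on is zero.\<close>
  have zero: "coeff (p * W) d = 0" if d: "degree p \<le> d" for d
  proof (cases "m + n' \<le> d")
    case True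
    then show ?thesis using high[of d] by simp
  next
    case False
    have "Infty \<in> snd ` set rs"
    proof (rule ccontr)
      assume "Infty \<notin> snd ` set rs"
      then show False using degree_eigen_poly(1)[OF dist] total d False by simp
    qed
    then obtain k where k: "(k, Infty) \<in> set rs" by auto
    define t where "t = m + n' - 1 - d"
    have t: "t < k" using degree_eigen_poly(2)[OF dist k] total d False by (simp add: t_def)
    have E: "(\<Sum>i<m. u i * coeff (e_inf i) t) + (\<Sum>b<n'. u (m + b) * coeff (f_inf b) t) = 0"
      using inf[OF k t] unfolding sum_glue .
    show ?thesis
    proof (cases "n' \<le> d")
      case True
      have "(\<Sum>i<m. u i * coeff (e_inf i) t) = (\<Sum>i<m. if i = d - n' then u i else 0)"
        by (rule sum.cong) (use True False lt in \<open>auto simp: e_inf_def t_def\<close>)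
      also have "\<dots> = u (d - n')" using True False by simp
      moreover have "(\<Sum>b<n'. u (m + b) * coeff (f_inf b) t) = 0"
        using True False by (intro sum.neutral) (auto simp: coeff_f_inf t_def)
      ultimately show ?thesis using E high[OF True] by simp
    next
      case False
      have "(\<Sum>i<m. u i * coeff (e_inf i) t) = 0"
        using False lt by (intro sum.neutral) (auto simp: e_inf_def t_def)
      moreover have "(\<Sum>b<n'. u (m + b) * coeff (f_inf b) t) = - (\<epsilon> * coeff (p * bt) d)"
        unfolding cb sum_distrib_left sum_negf[symmetric]
      proof (rule sum.cong)
        fix b assume "b \<in> {..<n'}"
        then have b: "b < n'" by simp
        have "m \<le> t" using False lt by (simp add: t_def)
        moreover have "t \<le> m + b \<longleftrightarrow> n' - 1 - b \<le> d" using False b lt by (auto simp: t_def)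
        moreover have "m + b - t = d - (n' - 1 - b)" if "n' - 1 - b \<le> d" using that False b lt by (simp add: t_def)
        ultimately show "u (m + b) * coeff (f_inf b) t =
            - (\<epsilon> * (if n' - 1 - b \<le> d then u (m + b) * coeff p (d - (n' - 1 - b)) else 0))"
          by (simp add: coeff_f_inf)
      qed simp
      ultimately show ?thesis using E low[of d] False by simp
    qed
  qed
  have "W = 0"
  proof (rule ccontr)
    assume "W \<noteq> 0"
    then have "degree (p * W) = degree p + degree W" by (simp add: degree_mult_eq eigen_poly_nonzero)
    then have "lead_coeff (p * W) = 0" using zero[of "degree (p * W)"] by simp
    then show False using \<open>W \<noteq> 0\<close> eigen_poly_nonzero[of rs] by simp
  qed
  then have mq: "monom 1 n' * q = Polynomial.smult \<epsilon> bt" by (simp add: W_def)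
  have cbt: "coeff bt s = (\<Sum>b<n'. if b = n' - 1 - s \<and> s < n' then u (m + b) else 0)" for s
    unfolding bt_def coeff_sum by (rule sum.cong) auto
  \<comment> \<open>\<open>bt\<close> has no coefficient from degree \<open>n'\<close> on, yet
    \<open>\<epsilon> bt\<close> is a multiple of \<open>x^n'\<close>.\<close>
  have "q = 0"
  proof (rule poly_eqI)
    fix s
    have "coeff q s = coeff (monom 1 n' * q) (n' + s)" by (simp add: coeff_monom_mult)
    also have "\<dots> = 0" unfolding mq by (simp add: cbt)
    finally show "coeff q s = coeff 0 s" by simp
  qed
  then have "bt = 0" and U0: "U = 0" using mq \<epsilon> q by simp_all
  have b0: "u (m + b) = 0" if "b < n'" for b
  proof -
    have "coeff bt (n' - 1 - b) = (\<Sum>c<n'. if c = b then u (m + c) else 0)"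
      unfolding cbt by (rule sum.cong) (use that in auto)
    then show ?thesis using \<open>bt = 0\<close> that by simp
  qed
  from i show ?thesis
  proof (cases rule: block_index_cases)
    case 1
    then show ?thesis using cU[of i] U0 b0 by simp
  qed (use b0 in simp)
qed

lemma upper_block_mult_vec:
  assumes "X \<in> carrier_mat m m'" "Z \<in> carrier_mat m n" "Y \<in> carrier_mat n' n"
    and "w \<in> carrier_vec (m' + n)" "upper_block X Z Y *\<^sub>v w = (0\<^sub>v (m + n') :: complex vec)"
  shows "i < m \<Longrightarrow> (\<Sum>j<m'. X $$ (i, j) * w $ j) + (\<Sum>j<n. Z $$ (i, j) * w $ (m' + j)) = 0"
    and "r < n' \<Longrightarrow> (\<Sum>j<n. Y $$ (r, j) * w $ (m' + j)) = 0"
proof -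
  have U: "upper_block X Z Y \<in> carrier_mat (m + n') (m' + n)" by (rule upper_block_carrier[OF assms(1,3)])
  have e: "(\<Sum>j<m'. upper_block X Z Y $$ (i, j) * w $ j) + (\<Sum>j<n. upper_block X Z Y $$ (i, m' + j) * w $ (m' + j)) = 0"
    if "i < m + n'" for i
    using arg_cong[OF assms(5), of "\<lambda>v. v $ i"] that assms(4) carrier_matD[OF U]
    by (simp add: scalar_prod_def atLeast0LessThan sum_lessThan_add)
  show "i < m \<Longrightarrow> (\<Sum>j<m'. X $$ (i, j) * w $ j) + (\<Sum>j<n. Z $$ (i, j) * w $ (m' + j)) = 0"
    using e[of i] assms(1-3) by (simp add: upper_block_def)
  show "r < n' \<Longrightarrow> (\<Sum>j<n. Y $$ (r, j) * w $ (m' + j)) = 0"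
    using e[of "m + r"] assms(1-3) by (simp add: upper_block_def)
qed

text \<open>For \<open>n > 1\<close> the matrices \<open>L_n\<close> and \<open>R_n\<close> together
  detect every coordinate of the second block, and \<open>L_m^T\<close> detects the rest. For
  \<open>n = 1\<close> they have no rows; then the single last column carries all coefficients of
  \<open>p\<close>, which are not all zero.\<close>

lemma ker_vi:
  assumes w: "w \<in> carrier_vec (m' + n)" and A: "A_vi *\<^sub>v w = 0\<^sub>v (m + n')" and B: "B_vi *\<^sub>v w = 0\<^sub>v (m + n')"
  shows "w = 0\<^sub>v (m' + n)"
proof -
  note A = upper_block_mult_vec[OF carriers_vi(1) carriers_vi(5) carriers_vi(3) w A]
  note B = upper_block_mult_vec[OF carriers_vi(2) carriers_vi(6) carriers_vi(4) w B]
  have lowA: "w $ (m' + r) = 0" if "r < n'" for r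
  proof -
    have "(\<Sum>j<n. L_mat n $$ (r, j) * w $ (m' + j)) = (\<Sum>j<n. if j = r then w $ (m' + j) else 0)"
      by (rule sum.cong) (use that lt in \<open>auto simp: L_mat_def\<close>)
    then show ?thesis using A(2)[OF that] that lt by simp
  qed
  have lowB: "w $ (m' + Suc r) = 0" if "r < n'" for r
  proof -
    have "(\<Sum>j<n. R_mat n $$ (r, j) * w $ (m' + j)) = (\<Sum>j<n. if j = Suc r then w $ (m' + j) else 0)"
      by (rule sum.cong) (use that lt in \<open>auto simp: R_mat_def\<close>)
    then show ?thesis using B(2)[OF that] that lt by simp
  qed
  have topL: "(\<Sum>j<m'. (L_mat m)\<^sup>T $$ (i, j) * w $ j) = (if i < m' then w $ i else 0)" if "i < m" for i
  proof -
    have "(\<Sum>j<m'. (L_mat m)\<^sup>T $$ (i, j) * w $ j) = (\<Sum>j<m'. if j = i then w $ j else 0)"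
      by (rule sum.cong) (use that lt in \<open>auto simp: L_mat_def\<close>)
    then show ?thesis by simp
  qed
  have topR: "(\<Sum>j<m'. (R_mat m)\<^sup>T $$ (i, j) * w $ j) = (if i = 0 then 0 else w $ (i - 1))" if "i < m" for i
  proof -
    have "(\<Sum>j<m'. (R_mat m)\<^sup>T $$ (i, j) * w $ j) = (\<Sum>j<m'. if Suc j = i then w $ j else 0)"
      by (rule sum.cong) (use that lt in \<open>auto simp: R_mat_def\<close>)
    then show ?thesis using that lt by (cases i) simp_all
  qed
  have right: "w $ (m' + j) = 0" if "j < n" for j
  proof (cases "n' = 0")
    case False
    then show ?thesis using lowA[of j] lowB[of "j - 1"] that lt by (cases j) auto
  next
    case True
    then have n: "n = Suc 0" "j = 0" using lt that by auto
    show ?thesis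
    proof (rule ccontr)
      assume ne: "w $ (m' + j) \<noteq> 0"
      have left: "w $ i = 0" if "i < m'" for i
        using B(1)[of "Suc i"] topR[of "Suc i"] that lt by (simp add: n beta_mat_def)
      have "coeff p 0 * w $ m' = 0"
        using B(1)[of 0] topR[of 0] lt \<epsilon> by (simp add: n beta_mat_def)
      moreover have "coeff p (Suc i) * w $ m' = 0" if "i < m" for i
        using A(1)[of i] topL[of i] left \<epsilon> that by (simp add: n alpha_mat_def split: if_splits)
      ultimately have "coeff p l = 0" if "l \<le> m" for l using ne n that by (cases l) auto
      then have "coeff p l = 0" for l using high_coeff[of l] True by (cases "l \<le> m") auto
      then show False using eigen_poly_nonzero[of rs] by (simp add: poly_eq_iff)
    qed
  qed
  have left: "w $ i = 0" if "i < m'" for i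
    using A(1)[of i] topL[of i] right that lt by simp
  show ?thesis
  proof (rule eq_vecI)
    fix i assume "i < dim_vec (0\<^sub>v (m' + n) :: complex vec)"
    then have "i < m' + n" by simp
    then show "w $ i = 0\<^sub>v (m' + n) $ i"
      by (cases rule: block_index_cases) (use left right in auto)
  qed (use w in simp)
qed

lemma kcf_vi: "pair_equiv (A_vi, B_vi) (kronecker_pair (map (\<lambda>(k, \<mu>). SD k \<mu>) rs))"
proof -
  define G where "G = (\<lambda>\<mu>. case \<mu> of Fin a \<Rightarrow> glue m (e_fin a) (f_fin a) | Infty \<Rightarrow> glue m e_inf f_inf)"
  let ?tgs = "map (\<lambda>(k, \<mu>). (SD k \<mu>, G \<mu>)) rs"
  show ?thesis
  proof (rule kcf_by_polynomials[OF pairs_vi, of ?tgs])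
    fix t g assume "(t, g) \<in> set ?tgs"
    then obtain k \<mu> where k: "(k, \<mu>) \<in> set rs" "t = SD k \<mu>" "g = G \<mu>" by auto
    then show "poly_hom (A_vi, B_vi) t g"
      using hom_vi_fin hom_vi_inf by (cases \<mu>) (auto simp: G_def)
  next
    show "map (\<lambda>(k, \<mu>). SD k \<mu>) rs = map fst ?tgs" by (simp add: case_prod_unfold)
    have "total_rows (map (\<lambda>(k, \<mu>). SD k \<mu>) rs) = sum_list (map fst rs)"
      "total_cols (map (\<lambda>(k, \<mu>). SD k \<mu>) rs) = sum_list (map fst rs)"
      by (induction rs) auto
    then show "total_rows (map (\<lambda>(k, \<mu>). SD k \<mu>) rs) = m + n'" "total_cols (map (\<lambda>(k, \<mu>). SD k \<mu>) rs) = m' + n"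
      using total lt by simp_all
  next
    fix u i assume u: "\<And>t g s. (t, g) \<in> set ?tgs \<Longrightarrow> s < summand_index t \<Longrightarrow> (\<Sum>i<m + n'. u i * coeff (g i) s) = 0"
      and i: "i < m + n'"
    have u': "(\<Sum>i<m + n'. u i * coeff (G \<mu> i) s) = 0" if "(k, \<mu>) \<in> set rs" "s < k" for k \<mu> s
    proof (rule u)
      show "(SD k \<mu>, G \<mu>) \<in> set ?tgs" using that(1) by force
      show "s < summand_index (SD k \<mu>)" using that(2) by simp
    qed
    show "u i = 0"
    proof (rule inj_vi[OF _ _ i])
      fix k a s assume "(k, Fin a) \<in> set rs" "s < k"
      from u'[OF this] show "(\<Sum>i<m + n'. u i * coeff (glue m (e_fin a) (f_fin a) i) s) = 0" by (simp add: G_def)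
    next
      fix k s assume "(k, Infty) \<in> set rs" "s < k"
      from u'[OF this] show "(\<Sum>i<m + n'. u i * coeff (glue m e_inf f_inf i) s) = 0" by (simp add: G_def)
    qed
  qed (use ker_vi in simp)
qed

end

lemma replacement_vi_kcf:
  assumes "1 \<le> m" "1 \<le> n" "distinct (map snd rs)"
    "sum_list (map fst rs) = m + n - 1" "\<epsilon> \<noteq> 0"
  shows "pair_equiv (upper_block (L_mat m)\<^sup>T (alpha_mat m n rs \<epsilon>) (L_mat n),
      upper_block (R_mat m)\<^sup>T (beta_mat m n rs \<epsilon>) (R_mat n))
    (kronecker_pair (map (\<lambda>(k, \<mu>). SD k \<mu>) rs))"
  by (rule kcf_vi[of m "m - 1" n "n - 1"]) (use assms in auto)

section \<open>The remaining replacements and the theorem\<close>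

lemma kronecker_pair_omit_zero:
  "kronecker_pair (xs @ D_opt n \<mu> @ ys) = kronecker_pair (xs @ SD n \<mu> # ys)"
proof (cases "n = 0")
  case True
  have "fst (summand_pair (SD 0 \<mu>)) \<in> carrier_mat 0 0" "snd (summand_pair (SD 0 \<mu>)) \<in> carrier_mat 0 0"
    using summand_pair_in_pairs[of "SD 0 \<mu>"] by (auto simp: pairs_def)
  then have "oplus (summand_pair (SD 0 \<mu>)) P = P" for P
    by (cases P) (auto simp: oplus_def diag_block_def intro!: eq_matI)
  then show ?thesis
    by (simp add: True D_opt_def kronecker_pair_append[of xs] kronecker_pair_Cons)
qed (simp add: D_opt_def)

section \<open>Transposing (i) and (iii) into (ii) and (iv)\<close>

lemma transpose_upper_block:
  assumes "X \<in> carrier_mat m1 n1" "Z \<in> carrier_mat m1 n2" "Y \<in> carrier_mat m2 n2"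
  shows "(upper_block X Z Y)\<^sup>T = lower_block X\<^sup>T Z\<^sup>T Y\<^sup>T"
  using assms by (simp add: upper_block_def lower_block_def transpose_four_block_mat[of X m1 n1 Z n2 _ m2 Y])

lemma transpose_diag_block:
  assumes "X \<in> carrier_mat m1 n1" "Y \<in> carrier_mat m2 n2"
  shows "(diag_block X Y)\<^sup>T = diag_block X\<^sup>T Y\<^sup>T"
  using assms by (simp add: diag_block_def transpose_four_block_mat[of X m1 n1 _ n2 _ m2 Y])

text \<open>Reversal in the second block alone turns a transposed Jordan block back and moves the
  perturbing corner from the last row to the first.\<close>

lemma diag_flip_lower_block:
  assumes "X \<in> carrier_mat m1 n1" "Z \<in> carrier_mat n n1" "Y \<in> carrier_mat n n"
  shows "diag_block (1\<^sub>m m1) (flip_mat n) * lower_block X Z Y * diag_block (1\<^sub>m n1) (flip_mat n)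
    = lower_block X (flip_mat n * Z) (flip_mat n * Y * flip_mat n)"
proof -
  have c: "flip_mat n * Z \<in> carrier_mat n n1" "flip_mat n * Y \<in> carrier_mat n n"
    "flip_mat n * Y * flip_mat n \<in> carrier_mat n n"
    using assms by auto
  have "diag_block (1\<^sub>m m1) (flip_mat n) * lower_block X Z Y =
      four_block_mat (1\<^sub>m m1) (0\<^sub>m m1 n) (0\<^sub>m n m1) (flip_mat n) * four_block_mat X (0\<^sub>m m1 n) Z Y"
    using assms by (simp add: diag_block_def lower_block_def)
  also have "\<dots> = four_block_mat (1\<^sub>m m1 * X + 0\<^sub>m m1 n * Z) (1\<^sub>m m1 * 0\<^sub>m m1 n + 0\<^sub>m m1 n * Y)
      (0\<^sub>m n m1 * X + flip_mat n * Z) (0\<^sub>m n m1 * 0\<^sub>m m1 n + flip_mat n * Y)"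
    by (rule mult_four_block_mat) (use assms in auto)
  also have "\<dots> = four_block_mat X (0\<^sub>m m1 n) (flip_mat n * Z) (flip_mat n * Y)"
    using assms c by simp
  finally have "diag_block (1\<^sub>m m1) (flip_mat n) * lower_block X Z Y * diag_block (1\<^sub>m n1) (flip_mat n) =
      four_block_mat X (0\<^sub>m m1 n) (flip_mat n * Z) (flip_mat n * Y) *
      four_block_mat (1\<^sub>m n1) (0\<^sub>m n1 n) (0\<^sub>m n n1) (flip_mat n)"
    by (simp add: diag_block_def)
  also have "\<dots> = four_block_mat (X * 1\<^sub>m n1 + 0\<^sub>m m1 n * 0\<^sub>m n n1) (X * 0\<^sub>m n1 n + 0\<^sub>m m1 n * flip_mat n)
      (flip_mat n * Z * 1\<^sub>m n1 + flip_mat n * Y * 0\<^sub>m n n1) (flip_mat n * Z * 0\<^sub>m n1 n + flip_mat n * Y * flip_mat n)"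
    by (rule mult_four_block_mat) (use assms in auto)
  also have "\<dots> = lower_block X (flip_mat n * Z) (flip_mat n * Y * flip_mat n)"
    using assms c by (simp add: lower_block_def del: assoc_mult_mat)
  finally show ?thesis .
qed

lemma diag_block_eq_lower_block:
  "X \<in> carrier_mat m1 n1 \<Longrightarrow> Y \<in> carrier_mat m2 n2 \<Longrightarrow> diag_block X Y = lower_block X (0\<^sub>m m2 n1) Y"
  by (simp add: lower_block_def diag_block_def)

lemma pair_equiv_flip_lower:
  assumes "X1 \<in> carrier_mat m1 n1" "X2 \<in> carrier_mat m1 n1" "Z1 \<in> carrier_mat n n1" "Z2 \<in> carrier_mat n n1"
    "Y1 \<in> carrier_mat n n" "Y2 \<in> carrier_mat n n"
  shows "pair_equiv (lower_block X1 Z1 Y1, lower_block X2 Z2 Y2)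
    (lower_block X1 (flip_mat n * Z1) (flip_mat n * Y1 * flip_mat n),
     lower_block X2 (flip_mat n * Z2) (flip_mat n * Y2 * flip_mat n))"
proof -
  have P: "(lower_block X1 Z1 Y1, lower_block X2 Z2 Y2) \<in> pairs (m1 + n) (n1 + n)"
    using assms by (auto simp: pairs_iff lower_block_def)
  show ?thesis
    using pair_equivI[OF P mutual_inverse_diag_block[OF mutual_inverse_one mutual_inverse_flip_mat]
      mutual_inverse_diag_block[OF mutual_inverse_one mutual_inverse_flip_mat]]
    by (simp add: act_def diag_flip_lower_block[OF assms(1,3,5)] diag_flip_lower_block[OF assms(2,4,6)]
        del: assoc_mult_mat)
qed

lemma kcf_transpose:
  assumes "P \<in> pairs m n" "pair_equiv P (kronecker_pair ss)"
  shows "pair_equiv (transpose_pair P) (kronecker_pair (map dual ss))"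
  using pair_equiv_trans[OF transpose_pair_in_pairs[OF assms(1)] pair_equiv_transpose[OF assms] transpose_kronecker_pair] .

lemma replacement_ii_kcf:
  assumes m: "1 \<le> m" "m + 2 \<le> n" and \<epsilon>: "\<epsilon> \<noteq> 0"
  shows "pair_equiv (diag_block (L_mat m) (L_mat n), lower_block (R_mat m) (\<epsilon> \<cdot>\<^sub>m corner_nw (n - 1) m) (R_mat n))
    (kronecker_pair [SL (m + 1), SL (n - 1)])"
proof -
  let ?Z = "\<epsilon> \<cdot>\<^sub>m corner_nw m (n - 1)"
  let ?P = "(diag_block (L_mat m)\<^sup>T (L_mat n)\<^sup>T, upper_block (R_mat m)\<^sup>T ?Z (R_mat n)\<^sup>T)"
  have Z: "?Z \<in> carrier_mat m (n - 1)" "?Z\<^sup>T = \<epsilon> \<cdot>\<^sub>m corner_nw (n - 1) m"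
    by (auto simp: corner_nw_def intro!: eq_matI)
  have P: "?P \<in> pairs (m + n) ((m - 1) + (n - 1))"
    using LT_carrier RT_carrier by (auto simp: pairs_iff simp del: One_nat_def intro!: upper_block_carrier)
  have "transpose_pair ?P = (diag_block (L_mat m) (L_mat n), lower_block (R_mat m) (\<epsilon> \<cdot>\<^sub>m corner_nw (n - 1) m) (R_mat n))"
    by (simp add: transpose_pair_def transpose_diag_block[OF LT_carrier LT_carrier]
        transpose_upper_block[OF RT_carrier Z(1) RT_carrier] Z(2) del: One_nat_def)
  then show ?thesis using kcf_transpose[OF P replacement_i_kcf[OF assms]] by simp
qed

lemma replacement_iv_fin_kcf:
  assumes m: "1 \<le> m" "1 \<le> n" and \<epsilon>: "\<epsilon> \<noteq> 0"
  shows "pair_equiv (diag_block (L_mat m) (1\<^sub>m n), lower_block (R_mat m) (\<epsilon> \<cdot>\<^sub>m corner_nw n m) (jordan_block n a))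
    (kronecker_pair [SL (m + 1), SD (n - 1) (Fin a)])" (is "pair_equiv ?Q _")
proof -
  let ?Z = "\<epsilon> \<cdot>\<^sub>m corner_ne m n"
  let ?P = "(diag_block (L_mat m)\<^sup>T (1\<^sub>m n), upper_block (R_mat m)\<^sup>T ?Z (jordan_block n a))"
  have Z: "?Z \<in> carrier_mat m n" by (simp add: corner_ne_def)
  \<comment> \<open>Transposition takes the top right corner to the bottom left, and the row
    reversal takes it to the top left.\<close>
  have flipZ: "flip_mat n * ?Z\<^sup>T = \<epsilon> \<cdot>\<^sub>m corner_nw n m"
    by (subst flip_mat_mult_left[of _ n m], simp add: corner_ne_def, rule eq_matI)
      (use m in \<open>auto simp: corner_nw_def corner_ne_def\<close>)
  note car = L_mat_carrier[of m] R_mat_carrier[of m] zero_carrier_mat[of n m] one_carrier_mat[of n]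
  have J: "(jordan_block n a)\<^sup>T \<in> carrier_mat n n" by simp
  have ZT: "?Z\<^sup>T \<in> carrier_mat n m" using Z by simp
  have P: "?P \<in> pairs (m + n) ((m - 1) + n)"
    using LT_carrier RT_carrier by (auto simp: pairs_iff simp del: One_nat_def intro!: upper_block_carrier)
  have T: "transpose_pair ?P = (lower_block (L_mat m) (0\<^sub>m n m) (1\<^sub>m n), lower_block (R_mat m) ?Z\<^sup>T (jordan_block n a)\<^sup>T)"
    by (simp add: transpose_pair_def transpose_diag_block[OF LT_carrier one_carrier_mat]
        transpose_upper_block[OF RT_carrier Z jordan_block_carrier] diag_block_eq_lower_block[OF car(1) car(4)]
        transpose_one del: One_nat_def)
  have "pair_equiv (transpose_pair ?P) ?Q"
    using pair_equiv_flip_lower[OF car(1,2,3) ZT car(4) J]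
    unfolding T flipZ flip_jordan_block flip_one
    by (simp add: diag_block_eq_lower_block[OF car(1) car(4)])
  moreover have "pair_equiv (transpose_pair ?P) (kronecker_pair [SL (m + 1), SD (n - 1) (Fin a)])"
    using kcf_transpose[OF P replacement_iii_fin_kcf[OF assms]] by simp
  moreover note T' = transpose_pair_in_pairs[OF P]
  ultimately show ?thesis
    using pair_equiv_trans[OF pair_equiv_in_pairs[OF T'] pair_equiv_sym[OF T']] by blast
qed

lemma replacement_iv_inf_kcf:
  assumes m: "1 \<le> m" "1 \<le> n" and \<epsilon>: "\<epsilon> \<noteq> 0"
  shows "pair_equiv (lower_block (L_mat m) (\<epsilon> \<cdot>\<^sub>m corner_ne n m) (jordan_block n 0), diag_block (R_mat m) (1\<^sub>m n))
    (kronecker_pair [SL (m + 1), SD (n - 1) Infty])" (is "pair_equiv ?Q _")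
proof -
  let ?Z = "\<epsilon> \<cdot>\<^sub>m corner_se m n"
  let ?P = "(upper_block (L_mat m)\<^sup>T ?Z (jordan_block n 0), diag_block (R_mat m)\<^sup>T (1\<^sub>m n))"
  have Z: "?Z \<in> carrier_mat m n" by (simp add: corner_se_def)
  \<comment> \<open>The bottom right corner stays there under transposition, and the row reversal
    takes it to the top right.\<close>
  have flipZ: "flip_mat n * ?Z\<^sup>T = \<epsilon> \<cdot>\<^sub>m corner_ne n m"
    by (subst flip_mat_mult_left[of _ n m], simp add: corner_se_def, rule eq_matI)
      (use m in \<open>auto simp: corner_se_def corner_ne_def\<close>)
  note car = R_mat_carrier[of m] L_mat_carrier[of m] zero_carrier_mat[of n m] one_carrier_mat[of n]
  have J: "(jordan_block n (0::complex))\<^sup>T \<in> carrier_mat n n" by simp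
  have ZT: "?Z\<^sup>T \<in> carrier_mat n m" using Z by simp
  have P: "?P \<in> pairs (m + n) ((m - 1) + n)"
    using LT_carrier RT_carrier by (auto simp: pairs_iff simp del: One_nat_def intro!: upper_block_carrier)
  have T: "transpose_pair ?P = (lower_block (L_mat m) ?Z\<^sup>T (jordan_block n 0)\<^sup>T, lower_block (R_mat m) (0\<^sub>m n m) (1\<^sub>m n))"
    by (simp add: transpose_pair_def transpose_diag_block[OF RT_carrier one_carrier_mat]
        transpose_upper_block[OF LT_carrier Z jordan_block_carrier] diag_block_eq_lower_block[OF car(1) car(4)]
        transpose_one del: One_nat_def)
  have "pair_equiv (transpose_pair ?P) ?Q"
    using pair_equiv_flip_lower[OF car(2,1) ZT car(3) J car(4)]
    unfolding T flipZ flip_jordan_block flip_one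
    by (simp add: diag_block_eq_lower_block[OF car(1) car(4)])
  moreover have "pair_equiv (transpose_pair ?P) (kronecker_pair [SL (m + 1), SD (n - 1) Infty])"
    using kcf_transpose[OF P replacement_iii_inf_kcf[OF assms]] by simp
  moreover note T' = transpose_pair_in_pairs[OF P]
  ultimately show ?thesis
    using pair_equiv_trans[OF pair_equiv_in_pairs[OF T'] pair_equiv_sym[OF T']] by blast
qed

lemma pair_equiv_swap: "pair_equiv (A, B) (C, D) \<Longrightarrow> A \<in> carrier_mat m n \<Longrightarrow> B \<in> carrier_mat m n \<Longrightarrow> pair_equiv (B, A) (D, C)"
  by (auto simp: pair_equiv_iff[of _ m n] pairs_iff act_def)

text \<open>Exchanging the two members of a pair turns the eigenvalue 0 into \<infinity>.\<close>

lemma replacement_v_inf_kcf: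
  assumes m: "1 \<le> m" "m \<le> n" and \<epsilon>: "\<epsilon> \<noteq> 0"
  shows "pair_equiv (upper_block (jordan_block m 0) (\<epsilon> \<cdot>\<^sub>m corner_nw m n) (jordan_block n 0), 1\<^sub>m (m + n))
    (kronecker_pair [SD (m - 1) Infty, SD (n + 1) Infty])"
proof -
  have "kronecker_pair [SD (m - 1) Infty, SD (n + 1) Infty] =
      (snd (kronecker_pair [SD (m - 1) (Fin 0), SD (n + 1) (Fin 0)]), fst (kronecker_pair [SD (m - 1) (Fin 0), SD (n + 1) (Fin 0)]))"
    by (simp add: kronecker_pair_def)
  moreover have "upper_block (jordan_block m 0) (\<epsilon> \<cdot>\<^sub>m corner_nw m n) (jordan_block n 0) \<in> carrier_mat (m + n) (m + n)"
    by (rule upper_block_carrier) auto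
  ultimately show ?thesis
    using pair_equiv_swap[of "1\<^sub>m (m + n)" _ _ _ "m + n" "m + n"] replacement_v_fin_kcf[OF assms, of 0]
    by (metis one_carrier_mat prod.collapse)
qed

lemma replacement_kcf:
  assumes "replacement P Q V" "\<epsilon> \<noteq> 0"
  shows "pair_equiv (V \<epsilon>) (kronecker_pair Q)"
  using assms(1)
proof (cases rule: replacement.cases)
  case (i m n)
  then show ?thesis using replacement_i_kcf[OF _ _ assms(2)] by simp
next
  case (ii m n)
  then show ?thesis using replacement_ii_kcf[OF _ _ assms(2)] by simp
next
  case (iii_fin m n a)
  then show ?thesis using replacement_iii_fin_kcf[OF _ _ assms(2), of m n a]
      kronecker_pair_omit_zero[of "[SLT (m + 1)]" "n - 1" "Fin a" "[]"] by simp
next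
  case (iii_inf m n)
  then show ?thesis using replacement_iii_inf_kcf[OF _ _ assms(2), of m n]
      kronecker_pair_omit_zero[of "[SLT (m + 1)]" "n - 1" Infty "[]"] by simp
next
  case (iv_fin m n a)
  then show ?thesis using replacement_iv_fin_kcf[OF _ _ assms(2), of m n a]
      kronecker_pair_omit_zero[of "[SL (m + 1)]" "n - 1" "Fin a" "[]"] by simp
next
  case (iv_inf m n)
  then show ?thesis using replacement_iv_inf_kcf[OF _ _ assms(2), of m n]
      kronecker_pair_omit_zero[of "[SL (m + 1)]" "n - 1" Infty "[]"] by simp
next
  case (v_fin m n a)
  then show ?thesis using replacement_v_fin_kcf[OF _ _ assms(2), of m n a]
      kronecker_pair_omit_zero[of "[]" "m - 1" "Fin a" "[SD (n + 1) (Fin a)]"] by simp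
next
  case (v_inf m n)
  then show ?thesis using replacement_v_inf_kcf[OF _ _ assms(2), of m n]
      kronecker_pair_omit_zero[of "[]" "m - 1" Infty "[SD (n + 1) Infty]"] by simp
next
  case (vi m n rs)
  then show ?thesis using replacement_vi_kcf[OF _ _ _ _ assms(2)] by simp
qed

text \<open>All perturbations in \<open>replacement\<close> are entrywise affine in \<epsilon>, so a
  single limit lemma covers every case.\<close>

definition depends_affinely :: "nat \<Rightarrow> nat \<Rightarrow> (complex \<Rightarrow> complex mat) \<Rightarrow> complex mat \<Rightarrow> bool" where
  "depends_affinely m n V A \<longleftrightarrow> A \<in> carrier_mat m n \<and> (\<forall>\<epsilon>. V \<epsilon> \<in> carrier_mat m n) \<and>
    (\<exists>C. \<forall>\<epsilon>. \<forall>i<m. \<forall>j<n. V \<epsilon> $$ (i, j) = A $$ (i, j) + \<epsilon> * C i j)"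

lemma depends_affinely_const: "A \<in> carrier_mat m n \<Longrightarrow> depends_affinely m n (\<lambda>_. A) A"
  unfolding depends_affinely_def by (auto intro!: exI[of _ "\<lambda>_ _. 0"])

lemma depends_affinely_upper_block:
  assumes "X \<in> carrier_mat m1 n1" "Y \<in> carrier_mat m2 n2" "\<And>\<epsilon>. Z \<epsilon> \<in> carrier_mat m1 n2"
    "\<And>\<epsilon> i j. i < m1 \<Longrightarrow> j < n2 \<Longrightarrow> Z \<epsilon> $$ (i, j) = \<epsilon> * W i j"
  shows "depends_affinely (m1 + m2) (n1 + n2) (\<lambda>\<epsilon>. upper_block X (Z \<epsilon>) Y) (diag_block X Y)"
  unfolding depends_affinely_def
  by (intro conjI allI upper_block_carrier[OF assms(1,2)] diag_block_carrier[OF assms(1,2)]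
      exI[of _ "\<lambda>i j. if i < m1 \<and> n1 \<le> j then W i (j - n1) else 0"])
    (use assms in \<open>auto simp: upper_block_def diag_block_def\<close>)

lemma depends_affinely_lower_block:
  assumes "X \<in> carrier_mat m1 n1" "Y \<in> carrier_mat m2 n2" "\<And>\<epsilon>. Z \<epsilon> \<in> carrier_mat m2 n1"
    "\<And>\<epsilon> i j. i < m2 \<Longrightarrow> j < n1 \<Longrightarrow> Z \<epsilon> $$ (i, j) = \<epsilon> * W i j"
  shows "depends_affinely (m1 + m2) (n1 + n2) (\<lambda>\<epsilon>. lower_block X (Z \<epsilon>) Y) (diag_block X Y)"
proof -
  have "lower_block X (Z \<epsilon>) Y \<in> carrier_mat (m1 + m2) (n1 + n2)" for \<epsilon>
    using assms by (auto simp: lower_block_def)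
  then show ?thesis
    unfolding depends_affinely_def
    by (intro conjI allI diag_block_carrier[OF assms(1,2)]
        exI[of _ "\<lambda>i j. if m1 \<le> i \<and> j < n1 then W (i - m1) j else 0"])
      (use assms in \<open>auto simp: lower_block_def diag_block_def\<close>)
qed

lemma entries_tendsto_affine:
  assumes "depends_affinely m n V A" "depends_affinely m n W B"
  shows "entries_tendsto m n (\<lambda>\<epsilon>. (V \<epsilon>, W \<epsilon>)) (A, B) (at 0)"
proof -
  have *: "((\<lambda>\<epsilon>. V \<epsilon> $$ (i, j)) \<longlongrightarrow> A $$ (i, j)) (at 0)"
    if V: "depends_affinely m n V A" and ij: "i < m" "j < n" for V A i j
  proof -
    obtain C where "\<And>\<epsilon>. V \<epsilon> $$ (i, j) = A $$ (i, j) + \<epsilon> * C i j"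
      using V ij unfolding depends_affinely_def by blast
    moreover have "((\<lambda>\<epsilon>. A $$ (i, j) + \<epsilon> * C i j) \<longlongrightarrow> A $$ (i, j) + 0 * C i j) (at 0)"
      by (intro tendsto_intros)
    ultimately show ?thesis by simp
  qed
  show ?thesis
    using *[OF assms(1)] *[OF assms(2)] assms
    by (auto simp: entries_tendsto_def pairs_iff depends_affinely_def)
qed

lemma replacement_limit:
  assumes "replacement P Q V"
  shows "entries_tendsto (total_rows P) (total_cols P) V (kronecker_pair P) (at 0)"
  using assms
proof (cases rule: replacement.cases)
  have two: "entries_tendsto (total_rows [s, t]) (total_cols [s, t]) (\<lambda>\<epsilon>. (f \<epsilon>, g \<epsilon>)) (kronecker_pair [s, t]) (at 0)"
    if "summand_pair s = (X, X')" "summand_pair t = (Y, Y')"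
      "depends_affinely (nrows s + nrows t) (ncols s + ncols t) f (diag_block X Y)"
      "depends_affinely (nrows s + nrows t) (ncols s + ncols t) g (diag_block X' Y')" for s t f g X X' Y Y'
    using entries_tendsto_affine[OF that(3,4)] that(1,2)
    by (simp add: kronecker_pair_Cons[of s] kronecker_pair_singleton oplus_def)
  have unperturbed: "depends_affinely (m1 + m2) (n1 + n2) (\<lambda>_. diag_block X Y) (diag_block X Y)"
    if "X \<in> carrier_mat m1 n1" "Y \<in> carrier_mat m2 n2" for X Y m1 m2 n1 n2
    using that by (intro depends_affinely_const diag_block_carrier)
  have upper: "depends_affinely (m1 + m2) (n1 + n2) (\<lambda>\<epsilon>. upper_block X (\<epsilon> \<cdot>\<^sub>m C) Y) (diag_block X Y)"
    if "X \<in> carrier_mat m1 n1" "Y \<in> carrier_mat m2 n2" "C \<in> carrier_mat m1 n2" for X Y C m1 m2 n1 n2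
    by (rule depends_affinely_upper_block[where W = "\<lambda>i j. C $$ (i, j)"]) (use that in auto)
  have lower: "depends_affinely (m1 + m2) (n1 + n2) (\<lambda>\<epsilon>. lower_block X (\<epsilon> \<cdot>\<^sub>m C) Y) (diag_block X Y)"
    if "X \<in> carrier_mat m1 n1" "Y \<in> carrier_mat m2 n2" "C \<in> carrier_mat m2 n1" for X Y C m1 m2 n1 n2
    by (rule depends_affinely_lower_block[where W = "\<lambda>i j. C $$ (i, j)"]) (use that in auto)
  note car = L_mat_carrier R_mat_carrier LT_carrier RT_carrier one_carrier_mat jordan_block_carrier
  note corners = corner_nw_def corner_ne_def corner_se_def
  {
    case (i m n)
    show ?thesis
      unfolding i(1,3)
      by (rule two, rule summand_pair.simps, rule summand_pair.simps, unfold nrows.simps ncols.simps)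
        (rule unperturbed, rule car, rule car, rule upper, rule car, rule car, simp add: corners)
  next
    case (ii m n)
    show ?thesis
      unfolding ii(1,3)
      by (rule two, rule summand_pair.simps, rule summand_pair.simps, unfold nrows.simps ncols.simps)
        (rule unperturbed, rule car, rule car, rule lower, rule car, rule car, simp add: corners)
  next
    case (iii_fin m n a)
    show ?thesis
      unfolding iii_fin(1,3)
      by (rule two, rule summand_pair.simps, rule summand_pair.simps, unfold nrows.simps ncols.simps)
        (rule unperturbed, rule car, rule car, rule upper, rule car, rule car, simp add: corners)
  next
    case (iii_inf m n)
    show ?thesis
      unfolding iii_inf(1,3)
      by (rule two, rule summand_pair.simps, rule summand_pair.simps, unfold nrows.simps ncols.simps)
        (rule upper, rule car, rule car, simp add: corners, rule unperturbed, rule car, rule car)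
  next
    case (iv_fin m n a)
    show ?thesis
      unfolding iv_fin(1,3)
      by (rule two, rule summand_pair.simps, rule summand_pair.simps, unfold nrows.simps ncols.simps)
        (rule unperturbed, rule car, rule car, rule lower, rule car, rule car, simp add: corners)
  next
    case (iv_inf m n)
    show ?thesis
      unfolding iv_inf(1,3)
      by (rule two, rule summand_pair.simps, rule summand_pair.simps, unfold nrows.simps ncols.simps)
        (rule lower, rule car, rule car, simp add: corners, rule unperturbed, rule car, rule car)
  next
    case (v_fin m n a)
    show ?thesis
      unfolding v_fin(1,3) diag_block_one[symmetric]
      by (rule two, rule summand_pair.simps, rule summand_pair.simps, unfold nrows.simps ncols.simps)
        (rule unperturbed, rule car, rule car, rule upper, rule car, rule car, simp add: corners)
  next
    case (v_inf m n)
    show ?thesis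
      unfolding v_inf(1,3) diag_block_one[symmetric]
      by (rule two, rule summand_pair.simps, rule summand_pair.simps, unfold nrows.simps ncols.simps)
        (rule upper, rule car, rule car, simp add: corners, rule unperturbed, rule car, rule car)
  next
    case (vi m n rs)
    have "depends_affinely (m + (n - 1)) (m - 1 + n) (\<lambda>\<epsilon>. upper_block (L_mat m)\<^sup>T (alpha_mat m n rs \<epsilon>) (L_mat n))
        (diag_block (L_mat m)\<^sup>T (L_mat n))"
      by (rule depends_affinely_upper_block[where W = "\<lambda>i j. alpha_mat m n rs 1 $$ (i, j)"], rule car, rule car)
        (auto simp: alpha_mat_def)
    moreover have "depends_affinely (m + (n - 1)) (m - 1 + n) (\<lambda>\<epsilon>. upper_block (R_mat m)\<^sup>T (beta_mat m n rs \<epsilon>) (R_mat n))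
        (diag_block (R_mat m)\<^sup>T (R_mat n))"
      by (rule depends_affinely_upper_block[where W = "\<lambda>i j. beta_mat m n rs 1 $$ (i, j)"], rule car, rule car)
        (auto simp: beta_mat_def)
    ultimately show ?thesis
      unfolding vi(1,3) by (intro two[OF summand_pair.simps(2) summand_pair.simps(1)]) simp_all
  }
qed

section \<open>Steps enlarge orbit closures; the theorem\<close>

lemma replacement_summands: "replacement P Q V \<Longrightarrow> summands Q"
  by (cases rule: replacement.cases, assumption) (auto simp: summands_def D_opt_def)

text \<open>Only the replaced summand is perturbed, while \<open>us\<close> and \<open>vs\<close>
  stay fixed in the direct sum. The size statement is carried along because transitivity of
  \<open>orbit_le\<close> is available for one fixed size only.\<close>

lemma kronecker_step_orbit_le:
  assumes "kronecker_step xs ys"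
  shows "orbit_le (kronecker_pair xs) (kronecker_pair ys)
    \<and> kronecker_pair ys \<in> pairs (total_rows xs) (total_cols xs)"
  using assms
proof cases
  case permute
  note K = kronecker_pair_in_pairs[of xs]
  show ?thesis
    using orbit_le_of_equiv[OF K kronecker_pair_permute[OF permute]]
      pair_equiv_in_pairs[OF K kronecker_pair_permute[OF permute]] by blast
next
  case (replace P Q V us vs)
  note K = kronecker_pair_in_pairs
  note lim = replacement_limit[OF replace(3)]
  have V: "V \<epsilon> \<in> pairs (total_rows P) (total_cols P)" for \<epsilon> using lim by (simp add: entries_tendsto_def)
  have "entries_tendsto (total_rows xs) (total_cols xs)
      (\<lambda>\<epsilon>. oplus (kronecker_pair us) (oplus (V \<epsilon>) (kronecker_pair vs))) (kronecker_pair xs) (at 0)"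
    using entries_tendsto_oplus[OF entries_tendsto_const[OF K[of us]]
        entries_tendsto_oplus[OF lim entries_tendsto_const[OF K[of vs]]]]
    by (simp add: replace(1) kronecker_pair_append)
  moreover have "pair_equiv (oplus (kronecker_pair us) (oplus (V \<epsilon>) (kronecker_pair vs))) (kronecker_pair ys)"
    if "\<epsilon> \<noteq> 0" for \<epsilon>
    using pair_equiv_oplus[OF K oplus_in_pairs[OF V K] pair_equiv_refl[OF K]
        pair_equiv_oplus[OF V K replacement_kcf[OF replace(3) that] pair_equiv_refl[OF K]]]
    by (simp add: replace(2) kronecker_pair_append)
  ultimately show ?thesis by (rule orbit_le_of_perturbation)
qed

lemma kronecker_steps_orbit_le:
  "kronecker_step\<^sup>*\<^sup>* xs ys \<Longrightarrow> orbit_le (kronecker_pair xs) (kronecker_pair ys)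
    \<and> kronecker_pair ys \<in> pairs (total_rows xs) (total_cols xs)"
proof (induction rule: rtranclp_induct)
  case base
  note K = kronecker_pair_in_pairs[of xs]
  show ?case using orbit_le_of_equiv[OF K pair_equiv_refl[OF K]] K by blast
next
  case (step ys zs)
  note K = kronecker_pair_in_pairs
  have "total_rows ys = total_rows xs" "total_cols ys = total_cols xs"
    using step.IH K[of ys] by (auto simp: pairs_def)
  then show ?case
    using kronecker_step_orbit_le[OF step.hyps(2)] step.IH orbit_le_trans[OF K[of xs]] by metis
qed

theorem theoremI:
  shows "(\<forall>as bs. summands as \<longrightarrow> summands bs \<longrightarrow>
            \<not> pair_equiv (kronecker_pair as) (kronecker_pair bs) \<longrightarrow>
            (orbit_less (kronecker_pair as) (kronecker_pair bs) \<longleftrightarrow> kronecker_step\<^sup>*\<^sup>* as bs)) \<and>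
         (\<forall>P Q V. replacement P Q V \<longrightarrow>
            limitin (pair_space (dim_row (fst (kronecker_pair P))) (dim_col (fst (kronecker_pair P))))
              V (kronecker_pair P) (at 0) \<and>
            (\<forall>\<epsilon>. \<epsilon> \<noteq> 0 \<longrightarrow> has_kcf (V \<epsilon>) Q))"
proof (intro conjI allI impI)
  fix as bs
  assume ss: "summands as" "summands bs" and ne: "\<not> pair_equiv (kronecker_pair as) (kronecker_pair bs)"
  note K = kronecker_pair_in_pairs
  show "orbit_less (kronecker_pair as) (kronecker_pair bs) \<longleftrightarrow> kronecker_step\<^sup>*\<^sup>* as bs"
  proof
    assume "orbit_less (kronecker_pair as) (kronecker_pair bs)"
    then have "orbit_le (kronecker_pair as) (kronecker_pair bs)" by (simp add: orbit_less_def)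
    from dominates_imp_kronecker_steps[OF orbit_le_imp_dominates[OF this ss] ss]
    show "kronecker_step\<^sup>*\<^sup>* as bs" .
  next
    assume "kronecker_step\<^sup>*\<^sup>* as bs"
    then have le: "orbit_le (kronecker_pair as) (kronecker_pair bs)"
      and B: "kronecker_pair bs \<in> pairs (total_rows as) (total_cols as)"
      using kronecker_steps_orbit_le by blast+
    show "orbit_less (kronecker_pair as) (kronecker_pair bs)"
      using le ne orbit_eq_iff[OF K B] by (simp add: orbit_less_def)
  qed
next
  fix P Q V assume r: "replacement P Q V"
  show "limitin (pair_space (dim_row (fst (kronecker_pair P))) (dim_col (fst (kronecker_pair P)))) V (kronecker_pair P) (at 0)"
    using limitin_pair_space[OF replacement_limit[OF r]] pairs_dims[OF kronecker_pair_in_pairs[of P]] by simp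
  fix \<epsilon> :: complex assume "\<epsilon> \<noteq> 0"
  then show "has_kcf (V \<epsilon>) Q"
    using replacement_kcf[OF r] replacement_summands[OF r] by (simp add: has_kcf_def)
qed

end
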